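(* Let $\alpha,\beta,\gamma\in[0,1]$ and $K_0,F_0\ge 0$. Let $K,F\colon(0,\infty)^2\to[0,\infty)$ be continuous symmetric functions with $$K(x,y)\le K_0\,(x^{-\alpha}+y^{-\alpha})(x^{\beta}+y^{\beta}),\qquad F(x,y)\le F_0\,(x^{\gamma}+y^{\gamma})\qquad (x,y>0).$$ Let $\mu_{\mathrm{in}}\in\mathcal{M}_b^+(0,1]$ and let $g$ be a boundary datum with $M_{\max\{\beta,\gamma\}}<\infty$. Then there exists a solution $\mu\in C\big([0,\infty);\mathcal{M}_b^+(0,1]\big)$ of the boundary valued coagulation-fragmentation equation with initial value $\mu_{\mathrm{in}}$ and boundary datum $g$.
   Context: $\mathcal{M}_b^+(0,1]$ is the set of finite nonnegative Borel measures on $(0,1]$, with the topology of the total variation norm $\|\cdot\|_{TV}$. $\langle\mu,\varphi\rangle=\int\varphi\,d\mu$; $\mathcal{L}$ is Lebesgue measure on $(0,1]$. A boundary datum is a nonnegative continuous map $g\colon[0,\infty)\to L^1(1,\infty)$, $t\mapsto g(t,\cdot)$. For $\lambda\in\mathbb{R}$, $\mathfrak{M}_\lambda(t)=\int_1^\infty x^\lambda g(t,x)\,dx$ and $M_\lambda=\sup_{t\ge0}\mathfrak{M}_\lambda(t)$. $\mathrm{Lip}_0(0,1]$ is the set of Lipschitz functions $\varphi\colon(0,1]\to\mathbb{R}$ vanishing at $0$ (i.e. $\varphi(x)\to0$ as $x\to0^+$). For $\varphi\colon(0,1]\to\mathbb{R}$ let $\overline{\varphi}(x)=\varphi(x)$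 for $x\in(0,1]$ and $\overline\varphi(x)=\varphi(1)$ for $x>1$. For $x,y\in(0,1]$, $$\mathcal{A}[\varphi](x,y)=\overline\varphi(x+y)-\varphi(x)-\varphi(y),\qquad \mathcal{B}[\varphi](x)=\tfrac12\int_0^xF(x-y,y)\big(\varphi(x)-\varphi(x-y)-\varphi(y)\big)\,dy,$$ $$\mathcal{G}_t(x)=\mathcal{G}(t,x)=\int_1^\infty K(x,y)g(t,y)\,dy,\qquad \mathcal{C}_t(x)=\mathcal{C}(t,x)=\int_1^\infty F(y-x,x)g(t,y)\,dy.$$ A map $\mu\in C([0,\infty);\mathcal{M}_b^+(0,1])$, $t\mapsto\mu_t$, is a solution of the boundary valued coagulation-fragmentation equation (with initial value $\mu_{\mathrm{in}}$ and boundary datum $g$) if for all $\varphi\in\mathrm{Lip}_0(0,1]$ and $t\ge0$ $$\langle\mu_t,\varphi\rangle=\langle\mu_{\mathrm{in}},\varphi\rangle+\int_0^t\Big(\tfrac12\langle\mu_s\otimes\mu_s,K\mathcal{A}[\varphi]\rangle-\langle\mu_s,\mathcal{G}_s\varphi+\mathcal{B}[\varphi]\rangle+\langle\mathcal{L},\mathcal{C}_s\varphi\rangle\Big)ds.$$ *)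

theory Defs
  imports "HOL-Analysis.Analysis"
begin

text \<open>
  Throughout, maps on \<open>(0,1]\<close>, \<open>(0,\<infinity>)\<^sup>2\<close>, \<open>[0,\<infinity>)\<close> or \<open>(1,\<infinity>)\<close> are total HOL functions of which
  only the values on the respective domain are ever used.
\<close>

definition finite_measures :: "real measure set" where
  "finite_measures = {\<mu>. sets \<mu> = sets (restrict_space borel {0<..1}) \<and> finite_measure \<mu>}"

text \<open>The total variation norm of the signed measure \<open>\<mu> - \<nu>\<close> on \<open>(0,1]\<close>.\<close>

definition tv_dist :: "real measure \<Rightarrow> real measure \<Rightarrow> real" where
  "tv_dist \<mu> \<nu> =
     (SUP P \<in> {P. finite P \<and> partition_on {0<..1} P \<and> P \<subseteq> sets (restrict_space borel {0<..1})}.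
        \<Sum>A\<in>P. \<bar>measure \<mu> A - measure \<nu> A\<bar>)"

definition tv_continuous :: "(real \<Rightarrow> real measure) \<Rightarrow> bool" where
  "tv_continuous \<mu> \<longleftrightarrow>
     (\<forall>t\<ge>0. ((\<lambda>s. tv_dist (\<mu> s) (\<mu> t)) \<longlongrightarrow> 0) (at t within {0..}))"

text \<open>
  Elements of \<open>L\<^sup>1(1,\<infinity>)\<close> are given by Borel representatives, hence nonnegativity is only
  required almost everywhere.
\<close>

definition boundary_datum :: "(real \<Rightarrow> real \<Rightarrow> real) \<Rightarrow> bool" where
  "boundary_datum g \<longleftrightarrow>
     (\<forall>t\<ge>0. set_integrable lborel {1<..} (g t)) \<and>
     (\<forall>t\<ge>0. AE x\<in>{1<..} in lborel. 0 \<le> g t x) \<and>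
     (\<forall>t\<ge>0. ((\<lambda>s. LINT x:{1<..}|lborel. \<bar>g s x - g t x\<bar>) \<longlongrightarrow> 0) (at t within {0..}))"

definition moment :: "(real \<Rightarrow> real \<Rightarrow> real) \<Rightarrow> real \<Rightarrow> real \<Rightarrow> ennreal" where
  "moment g l t = (\<integral>\<^sup>+x\<in>{1<..}. ennreal (x powr l * g t x) \<partial>lborel)"

definition sup_moment :: "(real \<Rightarrow> real \<Rightarrow> real) \<Rightarrow> real \<Rightarrow> ennreal" where
  "sup_moment g l = (SUP t\<in>{0..}. moment g l t)"

definition Lip0 :: "(real \<Rightarrow> real) set" where
  "Lip0 = {\<phi>. (\<exists>L. L-lipschitz_on {0<..1} \<phi>) \<and> (\<phi> \<longlongrightarrow> 0) (at_right 0)}"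

definition extend_const :: "(real \<Rightarrow> real) \<Rightarrow> real \<Rightarrow> real" where
  "extend_const \<phi> x = (if x \<le> 1 then \<phi> x else \<phi> 1)"

definition coag_op :: "(real \<Rightarrow> real) \<Rightarrow> real \<Rightarrow> real \<Rightarrow> real" where
  "coag_op \<phi> x y = extend_const \<phi> (x + y) - \<phi> x - \<phi> y"

definition frag_integrand :: "(real \<Rightarrow> real \<Rightarrow> real) \<Rightarrow> (real \<Rightarrow> real) \<Rightarrow> real \<Rightarrow> real \<Rightarrow> real" where
  "frag_integrand F \<phi> x y = F (x - y) y * (\<phi> x - \<phi> (x - y) - \<phi> y)"

definition frag_op :: "(real \<Rightarrow> real \<Rightarrow> real) \<Rightarrow> (real \<Rightarrow> real) \<Rightarrow> real \<Rightarrow> real" where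
  "frag_op F \<phi> x = 1 / 2 * (LINT y:{0<..<x}|lborel. frag_integrand F \<phi> x y)"

definition bdry_coag :: "(real \<Rightarrow> real \<Rightarrow> real) \<Rightarrow> (real \<Rightarrow> real \<Rightarrow> real) \<Rightarrow> real \<Rightarrow> real \<Rightarrow> real" where
  "bdry_coag K g t x = (LINT y:{1<..}|lborel. K x y * g t y)"

definition bdry_frag :: "(real \<Rightarrow> real \<Rightarrow> real) \<Rightarrow> (real \<Rightarrow> real \<Rightarrow> real) \<Rightarrow> real \<Rightarrow> real \<Rightarrow> real" where
  "bdry_frag F g t x = (LINT y:{1<..}|lborel. F (y - x) x * g t y)"

definition weak_rhs ::
  "(real \<Rightarrow> real \<Rightarrow> real) \<Rightarrow> (real \<Rightarrow> real \<Rightarrow> real) \<Rightarrow> (real \<Rightarrow> real \<Rightarrow> real) \<Rightarrow>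
   (real \<Rightarrow> real measure) \<Rightarrow> (real \<Rightarrow> real) \<Rightarrow> real \<Rightarrow> real" where
  "weak_rhs K F g \<mu> \<phi> s =
     1 / 2 * integral\<^sup>L (\<mu> s \<Otimes>\<^sub>M \<mu> s) (\<lambda>(x, y). K x y * coag_op \<phi> x y)
     - (LINT x|\<mu> s. bdry_coag K g s x * \<phi> x + frag_op F \<phi> x)
     + (LINT x:{0<..1}|lborel. bdry_frag F g s x * \<phi> x)"

text \<open>
  Since the Bochner integral of a non-integrable function is \<open>0\<close> by convention, the existence of
  all integrals that occur in the weak formulation is stated explicitly.
\<close>

definition weak_integrals_exist ::
  "(real \<Rightarrow> real \<Rightarrow> real) \<Rightarrow> (real \<Rightarrow> real \<Rightarrow> real) \<Rightarrow> (real \<Rightarrow> real \<Rightarrow> real) \<Rightarrow>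
   (real \<Rightarrow> real measure) \<Rightarrow> (real \<Rightarrow> real) \<Rightarrow> bool" where
  "weak_integrals_exist K F g \<mu> \<phi> \<longleftrightarrow>
     (\<forall>x\<in>{0<..1}. set_integrable lborel {0<..<x} (frag_integrand F \<phi> x)) \<and>
     (\<forall>s\<ge>0. \<forall>x\<in>{0<..1}. set_integrable lborel {1<..} (\<lambda>y. K x y * g s y)) \<and>
     (\<forall>s\<ge>0. \<forall>x\<in>{0<..1}. set_integrable lborel {1<..} (\<lambda>y. F (y - x) x * g s y)) \<and>
     (\<forall>s\<ge>0. integrable (\<mu> s \<Otimes>\<^sub>M \<mu> s) (\<lambda>(x, y). K x y * coag_op \<phi> x y)) \<and>
     (\<forall>s\<ge>0. integrable (\<mu> s) (\<lambda>x. bdry_coag K g s x * \<phi> x + frag_op F \<phi> x)) \<and>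
     (\<forall>s\<ge>0. set_integrable lborel {0<..1} (\<lambda>x. bdry_frag F g s x * \<phi> x)) \<and>
     (\<forall>t\<ge>0. set_integrable lborel {0..t} (weak_rhs K F g \<mu> \<phi>))"

text \<open>
  No integrability of \<open>\<phi>\<close> itself has to be demanded: functions in \<open>Lip\<^sub>0(0,1]\<close> are bounded and
  continuous on \<open>(0,1]\<close>.
\<close>

definition bvcf_solution ::
  "(real \<Rightarrow> real \<Rightarrow> real) \<Rightarrow> (real \<Rightarrow> real \<Rightarrow> real) \<Rightarrow> real measure \<Rightarrow> (real \<Rightarrow> real \<Rightarrow> real) \<Rightarrow>
   (real \<Rightarrow> real measure) \<Rightarrow> bool" where
  "bvcf_solution K F \<mu>in g \<mu> \<longleftrightarrow>
     (\<forall>t\<ge>0. \<mu> t \<in> finite_measures) \<and>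
     tv_continuous \<mu> \<and>
     (\<forall>\<phi>\<in>Lip0.
        weak_integrals_exist K F g \<mu> \<phi> \<and>
        (\<forall>t\<ge>0. (LINT x|\<mu> t. \<phi> x) =
                 (LINT x|\<mu>in. \<phi> x) + (LINT s:{0..t}|lborel. weak_rhs K F g \<mu> \<phi> s)))"

end

theory Submission
  imports Defs "HOL-Probability.Helly_Selection"
begin

text \<open>
  The initial measure is discretised into point masses at the nodes \<open>i/n\<close> and the equation is solved
  there by an explicit Euler scheme, so that only finite sums occur; the gain from fragmentation and
  from the boundary is distributed by exact cell integrals, which turns sums against a test function
  \<open>\<phi>\<close> into integrals against \<open>\<phi>\<close> rounded up to the grid. Testing with \<open>1\<close> bounds the number of
  particles; testing with the decreasing function \<open>1\<^bsub>(0,\<epsilon>]\<^esub>\<close>, for which coagulation only helps,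
  shows that no particles accumulate at \<open>0\<close>. Since \<open>K(x,y) min(x,y)\<close> is bounded, the pairings with
  \<open>Lip\<^sub>0\<close> functions are equi-Lipschitz in time, so Helly's theorem and a diagonal argument give a
  subsequence that converges weakly at every time, and Skorohod's theorem passes to the limit in the
  quadratic term. Finally, testing the limit equation with \<open>min(x/\<delta>,1)\<close> and letting \<open>\<delta> \<rightarrow> 0\<close> shows
  that the total loss rate \<open>\<langle>\<mu>\<^sub>s\<otimes>\<mu>\<^sub>s,K\<rangle> + \<langle>\<mu>\<^sub>s,\<G>\<^sub>s\<rangle>\<close> is integrable in time, which upgrades weak
  continuity to continuity in total variation.
\<close>

section \<open>Weak convergence on the unit interval\<close>

text \<open>The obstacle is the singularity of K at 0. For test functions vanishing linearly at 0
  the bracket \<open>coag_op\<close> supplies a factor min(x,y), so K times the bracket is bounded,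
  but it need not extend continuously to the axes; a weak limit passes through it only when the
  limit measure does not charge 0. Moreover, every rate estimate obtained this way carries the
  Lipschitz constant of the test function, which blows up when indicators of sets are approximated.
  The last part removes this constant: the number of particles cannot become negative, so all losses
  up to a time T are paid for by the initial mass and by gains that are bounded. This yields one
  integrable function of time dominating the rates of all Lipschitz test functions with values in
  [0,1], and inner regularity carries the estimate to Borel sets. On the grid all sizes are at least
  1/n, so the loss rates are finite and a small time step keeps the explicit scheme nonnegative.
  Helly's theorem is applied to probability measures, hence a normalisation with an auxiliary
  atom.\<close>

lemma weak_conv_m_subseq:
  "weak_conv_m P Q \<Longrightarrow> strict_mono r \<Longrightarrow> weak_conv_m (\<lambda>n. P (r n)) Q"
  unfolding weak_conv_m_def weak_conv_def
  by (auto intro: filterlim_compose[OF _ filterlim_subseq])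

lemma integral_cts_step_conv:
  assumes "\<And>n. real_distribution (P n)" "real_distribution Q" "weak_conv_m P Q" "a < b"
  shows "(\<lambda>n. integral\<^sup>L (P n) (cts_step a b)) \<longlonglongrightarrow> integral\<^sup>L Q (cts_step a b)"
proof (rule weak_conv_imp_integral_bdd_continuous_conv[OF assms(1-3), where B=1])
  show "isCont (cts_step a b) x" for x
    using uniformly_continuous_imp_continuous[OF cts_step_uniformly_continuous[OF \<open>a<b\<close>]]
    by (simp add: continuous_on_eq_continuous_at)
  show "norm (cts_step a b x) \<le> 1" for x
    using \<open>a<b\<close> by (auto simp: cts_step_def)
qed

text \<open>All measures are carried by the same bounded interval, so the family is tight at every
  time and Helly's theorem applies along any subsequence. The first claim treats a whole sequence of
  times \<open>r k\<close> at once; the second extracts a further subsequence for one more time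
  \<open>t\<close>.\<close>

lemma diagonal_weak_conv:
  fixes P :: "nat \<Rightarrow> real \<Rightarrow> real measure" and r :: "nat \<Rightarrow> real" and s :: "nat \<Rightarrow> nat"
  assumes rd: "\<And>n t. real_distribution (P n t)"
    and supp: "\<And>n t. measure (P n t) {-2<..1} = 1"
  shows "\<exists>s. strict_mono s \<and> (\<forall>k. \<exists>Q. real_distribution Q \<and> weak_conv_m (\<lambda>n. P (s n) (r k)) Q)"
    and "strict_mono s \<Longrightarrow> \<exists>(s'::nat\<Rightarrow>nat) Q. strict_mono s' \<and> real_distribution Q \<and> weak_conv_m (\<lambda>n. P (s (s' n)) t) Q"
proof -
  have tight: "tight (\<lambda>n. P n t)" for t
    unfolding tight_def
  proof (intro conjI allI impI)
    fix e :: real assume "0 < e"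
    then have "(-2::real) < 1 \<and> (\<forall>n. 1 - e < measure (P n t) {-2<..1})" by (simp add: supp)
    then show "\<exists>a b. a < b \<and> (\<forall>n. 1 - e < measure (P n t) {a<..b})" by blast
  qed (rule rd)
  show sub: "\<exists>(s'::nat\<Rightarrow>nat) Q. strict_mono s' \<and> real_distribution Q \<and> weak_conv_m (\<lambda>n. P (s (s' n)) t) Q"
    if "strict_mono s" for s :: "nat \<Rightarrow> nat" and t
    using tight_imp_convergent_subsubsequence[OF tight that, of t] by (auto simp: o_def)
  let ?R = "\<lambda>k s. \<exists>Q. real_distribution Q \<and> weak_conv_m (\<lambda>n. P (s n) (r k)) Q"
  interpret D: subseqs ?R
    by unfold_locales (use sub in \<open>fastforce simp: o_def\<close>)
  define d where "d = D.diagseq"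
  have hold: "?R k (d \<circ> (+) (Suc k))" for k
    unfolding d_def by (rule D.diagseq_holds) (auto simp: o_def dest: weak_conv_m_subseq)
  have d: "strict_mono d" unfolding d_def by (rule D.subseq_diagseq)
  have "?R k d" for k
  proof -
    obtain Q where Q: "real_distribution Q" "weak_conv_m (\<lambda>n. P (d (Suc k + n)) (r k)) Q"
      using hold[of k] unfolding o_def by blast
    \<comment> \<open>The diagonal sequence is known to converge at \<open>r k\<close> only after
      its first \<open>Suc k\<close> entries are dropped; a limit does not see them.\<close>
    have "weak_conv_m (\<lambda>n. P (d n) (r k)) Q"
      unfolding weak_conv_m_def weak_conv_def
    proof (intro allI impI, rule LIMSEQ_offset[where k="Suc k"])
      fix x assume "isCont (cdf Q) x"
      then show "(\<lambda>n. cdf (P (d (n + Suc k)) (r k)) x) \<longlonglongrightarrow> cdf Q x"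
        using Q(2) unfolding weak_conv_m_def weak_conv_def by (simp add: add.commute)
    qed
    with Q(1) show ?thesis by blast
  qed
  with d
  show "\<exists>s. strict_mono s \<and> (\<forall>k. \<exists>Q. real_distribution Q \<and> weak_conv_m (\<lambda>n. P (s n) (r k)) Q)"
    by blast
qed

text \<open>An Arzela-Ascoli argument: after convergence at a dense set of times, equicontinuity
  makes the integrals of each \<open>cts_step a b\<close> Cauchy at every time, so all cluster
  points at that time coincide. Equicontinuity is asked only for large \<open>n\<close>, since the
  approximating paths are piecewise constant and jump.\<close>

lemma weakly_convergent_paths:
  fixes P :: "nat \<Rightarrow> real \<Rightarrow> real measure"
  assumes rd: "\<And>n t. real_distribution (P n t)"
    and supp: "\<And>n t. measure (P n t) {-2<..1} = 1"
    and equi: "\<And>t a b e. 0 \<le> t \<Longrightarrow> a < b \<Longrightarrow> 0 < e \<Longrightarrow>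
      \<exists>d>0. \<forall>q\<ge>0. \<bar>q - t\<bar> < d \<longrightarrow> (\<forall>\<^sub>F n in sequentially.
        \<bar>integral\<^sup>L (P n t) (cts_step a b) - integral\<^sup>L (P n q) (cts_step a b)\<bar> < e)"
  obtains s Q where "strict_mono s"
    "\<And>t. 0 \<le> t \<Longrightarrow> real_distribution (Q t)"
    "\<And>t. 0 \<le> t \<Longrightarrow> weak_conv_m (\<lambda>n. P (s n) t) (Q t)"
proof -
  \<comment> \<open>The absolute value turns this into an enumeration of the nonnegative rationals,
    a dense set of admissible times.\<close>
  define r where "r k = \<bar>real_of_rat (from_nat k)\<bar>" for k
  obtain s where s: "strict_mono s"
    and conv: "\<And>k. \<exists>Q. real_distribution Q \<and> weak_conv_m (\<lambda>n. P (s n) (r k)) Q"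
    using diagonal_weak_conv(1)[of P r, OF rd supp] by blast
  have "\<exists>Q. real_distribution Q \<and> weak_conv_m (\<lambda>n. P (s n) t) Q" if t: "0 \<le> t" for t
  proof -
    obtain s' Q where s': "strict_mono s'" "real_distribution Q" "weak_conv_m (\<lambda>n. P (s (s' n)) t) Q"
      using diagonal_weak_conv(2)[of P, OF rd supp s] by blast
    have "weak_conv_m (\<lambda>n. P (s n) t) Q"
    proof (rule integral_cts_step_conv_imp_weak_conv[OF rd s'(2)])
      fix a b :: real assume ab: "a < b"
      let ?u = "\<lambda>n. integral\<^sup>L (P (s n) t) (cts_step a b)"
      have "Cauchy ?u"
      proof (rule metric_CauchyI)
        fix e :: real assume e: "0 < e"
        obtain d where d: "d > 0" "\<And>q. q \<ge> 0 \<Longrightarrow> \<bar>q - t\<bar> < d \<Longrightarrow> \<forall>\<^sub>F n in sequentially.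
          \<bar>integral\<^sup>L (P n t) (cts_step a b) - integral\<^sup>L (P n q) (cts_step a b)\<bar> < e/3"
          using equi[OF t ab, of "e/3"] e by auto
        obtain q where q: "t < real_of_rat q" "real_of_rat q < t + d"
          using of_rat_dense[of t "t+d"] d(1) by auto
        define k where "k = to_nat q"
        have step_rate: "r k = real_of_rat q" unfolding r_def k_def from_nat_to_nat
          using q t by (intro abs_of_nonneg) linarith
        have "\<forall>\<^sub>F n in sequentially.
          \<bar>integral\<^sup>L (P (s n) t) (cts_step a b) - integral\<^sup>L (P (s n) (r k)) (cts_step a b)\<bar> < e/3"
          by (rule eventually_compose_filterlim[OF d(2) filterlim_subseq[OF s]]) (use q t in \<open>unfold step_rate, linarith+\<close>)
        then obtain N1 where N1: "\<And>n. n \<ge> N1 \<Longrightarrow>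
          \<bar>?u n - integral\<^sup>L (P (s n) (r k)) (cts_step a b)\<bar> < e/3"
          by (auto simp: eventually_sequentially)
        obtain Q' where "real_distribution Q'" "weak_conv_m (\<lambda>n. P (s n) (r k)) Q'"
          using conv by blast
        then have "Cauchy (\<lambda>n. integral\<^sup>L (P (s n) (r k)) (cts_step a b))"
          by (intro LIMSEQ_imp_Cauchy[OF integral_cts_step_conv]) (use rd ab in auto)
        from metric_CauchyD[OF this, of "e/3"] e obtain N2 where N2: "\<And>m n. m \<ge> N2 \<Longrightarrow> n \<ge> N2 \<Longrightarrow>
          \<bar>integral\<^sup>L (P (s m) (r k)) (cts_step a b) - integral\<^sup>L (P (s n) (r k)) (cts_step a b)\<bar> < e/3"
          by (auto simp: dist_real_def)
        show "\<exists>M. \<forall>m\<ge>M. \<forall>n\<ge>M. dist (?u m) (?u n) < e"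
        proof (intro exI[of _ "max N1 N2"] allI impI)
          fix m n assume "max N1 N2 \<le> m" "max N1 N2 \<le> n"
          then show "dist (?u m) (?u n) < e"
            using N1[of m] N1[of n] N2[of m n] unfolding dist_real_def by arith
        qed
      qed
      then obtain l where l: "?u \<longlonglongrightarrow> l"
        using Cauchy_convergent_iff convergent_def by blast
      have "(\<lambda>n. ?u (s' n)) \<longlonglongrightarrow> l"
        using LIMSEQ_subseq_LIMSEQ[OF l s'(1)] by (simp add: o_def)
      moreover have "(\<lambda>n. ?u (s' n)) \<longlonglongrightarrow> integral\<^sup>L Q (cts_step a b)"
        by (rule integral_cts_step_conv[OF rd s'(2,3) ab])
      ultimately show "?u \<longlonglongrightarrow> integral\<^sup>L Q (cts_step a b)"
        using l LIMSEQ_unique by blast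
    qed
    with s' show ?thesis by blast
  qed
  then obtain Q where "\<And>t. 0 \<le> t \<Longrightarrow> real_distribution (Q t) \<and> weak_conv_m (\<lambda>n. P (s n) t) (Q t)"
    by metis
  with s that show ?thesis by blast
qed

text \<open>Skorohod realises the measures as laws of \<open>Y n\<close> converging pointwise to
  \<open>Z\<close> on one probability space. The double integral runs over two independent sample
  points \<open>u\<close> and \<open>v\<close>, and the limit point \<open>(Z u, Z v)\<close> lies
  on the axes, where \<open>H\<close> may be discontinuous, only in a null event. Dominated
  convergence is applied first in \<open>v\<close>, then in \<open>u\<close>.\<close>

lemma weak_conv_double_integral:
  fixes H :: "real \<Rightarrow> real \<Rightarrow> real"
  assumes rd: "\<And>n. real_distribution (P n)" "real_distribution Q" "weak_conv_m P Q"
    and nz: "AE x in Q. x \<noteq> 0"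
    and cont: "\<And>x y. x \<noteq> 0 \<Longrightarrow> y \<noteq> 0 \<Longrightarrow> isCont (\<lambda>(x,y). H x y) (x,y)"
    and bdd: "\<And>x y. \<bar>H x y\<bar> \<le> B"
    and meas: "(\<lambda>(x,y). H x y) \<in> borel_measurable borel"
  shows "(\<lambda>n. \<integral>x. (\<integral>y. H x y \<partial>P n) \<partial>P n) \<longlonglongrightarrow> (\<integral>x. (\<integral>y. H x y \<partial>Q) \<partial>Q)"
proof -
  obtain \<Omega> :: "real measure" and Y :: "nat \<Rightarrow> real \<Rightarrow> real" and Z :: "real \<Rightarrow> real" where
    \<Omega>: "prob_space \<Omega>" and Y[measurable]: "\<And>n. Y n \<in> measurable \<Omega> borel"
    and dY: "\<And>n. distr \<Omega> borel (Y n) = P n" and Z0: "Z \<in> measurable \<Omega> lborel"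
    and dZ: "distr \<Omega> borel Z = Q" and lim: "\<And>x. x \<in> space \<Omega> \<Longrightarrow> (\<lambda>n. Y n x) \<longlonglongrightarrow> Z x"
    using Skorohod[OF rd] by metis
  interpret \<Omega>: prob_space \<Omega> by fact
  have Z[measurable]: "Z \<in> measurable \<Omega> borel" using Z0 by simp
  have meas'[measurable]: "(\<lambda>(x,y). H x y) \<in> borel_measurable (borel \<Otimes>\<^sub>M borel)"
    using meas by (simp add: borel_prod)
  have nzZ: "AE u in \<Omega>. Z u \<noteq> 0"
    using nz unfolding dZ[symmetric] by (subst (asm) AE_distr_iff) auto
  have eq: "(\<integral>x. (\<integral>y. H x y \<partial>distr \<Omega> borel V) \<partial>distr \<Omega> borel V) = (\<integral>u. (\<integral>v. H (V u) (V v) \<partial>\<Omega>) \<partial>\<Omega>)"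
    if [measurable]: "V \<in> measurable \<Omega> borel" for V
  proof -
    have "(\<integral>x. (\<integral>y. H x y \<partial>distr \<Omega> borel V) \<partial>distr \<Omega> borel V)
        = (\<integral>x. (\<integral>v. H x (V v) \<partial>\<Omega>) \<partial>distr \<Omega> borel V)"
      by (intro Bochner_Integration.integral_cong refl integral_distr) auto
    also have "\<dots> = (\<integral>u. (\<integral>v. H (V u) (V v) \<partial>\<Omega>) \<partial>\<Omega>)"
      by (intro integral_distr) auto
    finally show ?thesis .
  qed
  have inner: "(\<lambda>n. \<integral>v. H (Y n u) (Y n v) \<partial>\<Omega>) \<longlonglongrightarrow> (\<integral>v. H (Z u) (Z v) \<partial>\<Omega>)"
    if u: "u \<in> space \<Omega>" "Z u \<noteq> 0" for u
  proof (rule integral_dominated_convergence[where w="\<lambda>_. B"])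
    show "AE v in \<Omega>. (\<lambda>n. H (Y n u) (Y n v)) \<longlonglongrightarrow> H (Z u) (Z v)"
      using nzZ AE_space
    proof eventually_elim
      case (elim v)
      have "(\<lambda>n. (Y n u, Y n v)) \<longlonglongrightarrow> (Z u, Z v)"
        using lim[OF u(1)] lim[OF elim(2)] by (rule tendsto_Pair)
      from isCont_tendsto_compose[OF cont[OF u(2) elim(1)] this] show ?case by simp
    qed
    show "(\<lambda>v. H (Z u) (Z v)) \<in> borel_measurable \<Omega>" "\<And>n. (\<lambda>v. H (Y n u) (Y n v)) \<in> borel_measurable \<Omega>"
      using u(1) by measurable
  qed (use bdd in auto)
  have "(\<lambda>n. \<integral>u. (\<integral>v. H (Y n u) (Y n v) \<partial>\<Omega>) \<partial>\<Omega>) \<longlonglongrightarrow> (\<integral>u. (\<integral>v. H (Z u) (Z v) \<partial>\<Omega>) \<partial>\<Omega>)"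
  proof (rule integral_dominated_convergence[where w="\<lambda>_. B"])
    show "AE u in \<Omega>. (\<lambda>n. \<integral>v. H (Y n u) (Y n v) \<partial>\<Omega>) \<longlonglongrightarrow> (\<integral>v. H (Z u) (Z v) \<partial>\<Omega>)"
      using nzZ AE_space by eventually_elim (rule inner)
    have B: "\<bar>\<integral>v. H a (Y n v) \<partial>\<Omega>\<bar> \<le> B" for a n
    proof -
      have "\<bar>\<integral>v. H a (Y n v) \<partial>\<Omega>\<bar> \<le> (\<integral>v. B \<partial>\<Omega>)"
        unfolding real_norm_def[symmetric]
        by (rule Bochner_Integration.integral_norm_bound_integral)
          (use bdd in \<open>auto intro!: \<Omega>.integrable_const_bound[where B=B]\<close>)
      then show ?thesis by (simp add: \<Omega>.prob_space)
    qed
    then show "\<And>n. AE u in \<Omega>. norm (\<integral>v. H (Y n u) (Y n v) \<partial>\<Omega>) \<le> B" by simp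
  qed auto
  then show ?thesis unfolding dY[symmetric] dZ[symmetric] using eq by simp
qed

text \<open>The approximations do not charge a neighbourhood of 0 from the left, so the limit could
  charge 0 only through mass arriving from the right; the tail hypothesis bounds that mass for all
  large \<open>n\<close>.\<close>

lemma weak_limit_no_atom:
  assumes rd: "\<And>n. real_distribution (P n)" "real_distribution Q" "weak_conv_m P Q"
    and supp: "\<And>n. AE x in P n. x = -1 \<or> 0 < x \<and> x \<le> 1"
    and tail: "\<And>e. e > 0 \<Longrightarrow> \<exists>d>0. \<forall>\<^sub>F n in sequentially. measure (P n) {0<..d} \<le> e"
  shows "AE x in Q. x \<noteq> 0" "AE x in Q. x \<le> 1"
proof -
  interpret P: real_distribution "P n" for n by (rule rd)
  interpret Q: real_distribution Q by (rule rd)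
  have le: "measure Q {0} \<le> e" if e: "e > 0" for e
  proof -
    obtain d where d: "d > 0" "\<forall>\<^sub>F n in sequentially. measure (P n) {0<..d} \<le> e"
      using tail[OF e] by auto
    \<comment> \<open>Keeping \<open>d'\<close> below 1 lets the hat function \<open>\<psi>\<close>
      vanish at the auxiliary atom \<open>-1\<close>, so that it sees only mass in
      \<open>{0<..d}\<close>.\<close>
    define d' where "d' = min d (1/2)"
    have d': "0 < d'" "d' \<le> d" "d' < 1" using d(1) by (auto simp: d'_def)
    define \<psi> where "\<psi> x = max 0 (1 - \<bar>x\<bar>/d')" for x :: real
    have \<psi>01: "0 \<le> \<psi> x" "\<psi> x \<le> 1" for x using d' by (auto simp: \<psi>_def)
    have [measurable]: "\<psi> \<in> borel_measurable borel" unfolding \<psi>_def by measurable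
    have "(\<lambda>n. integral\<^sup>L (P n) \<psi>) \<longlonglongrightarrow> integral\<^sup>L Q \<psi>"
    proof (rule weak_conv_imp_integral_bdd_continuous_conv[OF rd, where B=1])
      show "isCont \<psi> x" for x unfolding \<psi>_def using d' by (intro continuous_intros) auto
    qed (use \<psi>01 in auto)
    moreover have "\<forall>\<^sub>F n in sequentially. integral\<^sup>L (P n) \<psi> \<le> e"
      using d(2)
    proof eventually_elim
      case (elim n)
      have "integral\<^sup>L (P n) \<psi> \<le> integral\<^sup>L (P n) (indicator {0<..d})"
      proof (rule integral_mono_AE)
        show "integrable (P n) \<psi>" by (rule P.integrable_const_bound[where B=1]) (use \<psi>01 in simp_all)
        show "AE x in P n. \<psi> x \<le> indicator {0<..d} x"
          using supp[of n]
        proof eventually_elim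
          case (elim x)
          have "\<psi> x = 0" if "d' \<le> \<bar>x\<bar>" using that d' by (simp add: \<psi>_def)
          with elim \<psi>01[of x] d' show ?case by (auto simp: indicator_def)
        qed
      qed (rule P.integrable_const_bound[where B=1], simp_all)
      also have "\<dots> = measure (P n) {0<..d}" by simp
      finally show ?case using elim by simp
    qed
    ultimately have "integral\<^sup>L Q \<psi> \<le> e"
      by (intro tendsto_upperbound) auto
    moreover have "integral\<^sup>L Q (indicator {0}) \<le> integral\<^sup>L Q \<psi>"
      using \<psi>01 by (intro integral_mono Q.integrable_const_bound[where B=1])
        (auto simp: indicator_def \<psi>_def)
    ultimately show ?thesis by simp
  qed
  have "measure Q {0} \<le> 0" by (rule field_le_epsilon) (simp add: le)
  then have "{0} \<in> null_sets Q"
    by (simp add: null_sets_def Q.emeasure_eq_measure ennreal_eq_0_iff)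
  from AE_not_in[OF this] show "AE x in Q. x \<noteq> 0" by simp
  let ?f = "\<lambda>x::real. min 1 (max 0 (x - 1))"
  have "(\<lambda>n. integral\<^sup>L (P n) ?f) \<longlonglongrightarrow> integral\<^sup>L Q ?f"
    by (rule weak_conv_imp_integral_bdd_continuous_conv[OF rd, where B=1])
      (auto intro!: continuous_intros)
  moreover have "integral\<^sup>L (P n) ?f = 0" for n
    by (rule integral_eq_zero_AE) (use supp[of n] in \<open>eventually_elim, auto\<close>)
  ultimately have "integral\<^sup>L Q ?f = 0" by (simp add: LIMSEQ_const_iff)
  moreover have "integrable Q ?f" by (intro Q.integrable_const_bound[where B=1]) auto
  ultimately have "AE x in Q. ?f x = 0"
    by (subst (asm) integral_nonneg_eq_0_iff_AE) auto
  then show "AE x in Q. x \<le> 1"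
  proof eventually_elim
    case (elim x)
    then show ?case by linarith
  qed
qed

lemma weak_conv_unit_double:
  fixes H :: "real \<Rightarrow> real \<Rightarrow> real"
  assumes rd: "\<And>n. real_distribution (P n)" "real_distribution Q" "weak_conv_m P Q"
    and supp: "\<And>n. AE x in P n. x = -1 \<or> 0 < x \<and> x \<le> 1"
    and tail: "\<And>e. e > 0 \<Longrightarrow> \<exists>d>0. \<forall>\<^sub>F n in sequentially. measure (P n) {0<..d} \<le> e"
    and cont: "continuous_on ({0<..1} \<times> {0<..1}) (\<lambda>(x,y). H x y)"
    and bdd: "\<And>x y. x \<in> {0<..1} \<Longrightarrow> y \<in> {0<..1} \<Longrightarrow> \<bar>H x y\<bar> \<le> B"
  shows "(\<lambda>n. \<integral>x. (\<integral>y. (if x \<in> {0<..1} \<and> y \<in> {0<..1} then H x y else 0) \<partial>P n) \<partial>P n)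
    \<longlonglongrightarrow> (\<integral>x. (\<integral>y. (if x \<in> {0<..1} \<and> y \<in> {0<..1} then H x y else 0) \<partial>Q) \<partial>Q)"
proof -
  interpret P: real_distribution "P n" for n by (rule rd)
  interpret Q: real_distribution Q by (rule rd)
  have AEQ: "AE x in Q. x \<noteq> 0" "AE x in Q. x \<le> 1"
    by (rule weak_limit_no_atom[OF rd supp tail], assumption)+
  have AEP: "AE x in P n. x \<le> 1" for n using supp[of n] by eventually_elim auto
  define S where "S = {0::real<..} \<times> {0::real<..}"
  define f where "f = (\<lambda>p::real\<times>real. H (min (fst p) 1) (min (snd p) 1))"
  \<comment> \<open>Capping both arguments at 1 and taking the value 0 off the open quadrant gives a
    function on the whole plane that is continuous away from the axes. It agrees with the integrand
    of the claim except beyond 1, where neither measure has mass; at the atom \<open>-1\<close> both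
    vanish.\<close>
  define G where "G x y = (if 0 < x \<and> 0 < y then H (min x 1) (min y 1) else 0)" for x y
  have S: "open S" unfolding S_def by (intro open_Times) auto
  have Sb[measurable]: "S \<in> sets borel" using S by auto
  have contf: "continuous_on S f"
  proof -
    have "continuous_on S (\<lambda>p. (case (min (fst p) 1, min (snd p) 1) of (x,y) \<Rightarrow> H x y))"
      by (rule continuous_on_compose2[OF cont]) (auto intro!: continuous_intros simp: S_def)
    then show ?thesis by (simp add: f_def)
  qed
  have Gf: "(\<lambda>(x,y). G x y) = (\<lambda>p. indicator S p *\<^sub>R f p)"
    by (auto simp: fun_eq_iff G_def S_def f_def indicator_def)
  have meas: "(\<lambda>(x,y). G x y) \<in> borel_measurable borel"
    unfolding Gf by (rule borel_measurable_continuous_on_indicator[OF Sb contf])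
  have G0: "0 \<le> B" using bdd[of 1 1] by auto
  have bddG: "\<bar>G x y\<bar> \<le> B" for x y using bdd[of "min x 1" "min y 1"] G0 by (auto simp: G_def)
  have contG: "isCont (\<lambda>(x,y). G x y) (x,y)" if "x \<noteq> 0" "y \<noteq> 0" for x y
  proof (cases "0 < x \<and> 0 < y")
    case True
    have "continuous_on S (\<lambda>(x,y). G x y)"
      using contf by (rule continuous_on_eq) (auto simp: f_def G_def S_def)
    then show ?thesis using True S by (simp add: continuous_on_eq_continuous_at S_def)
  next
    case False
    define T where "T = {p::real\<times>real. fst p < 0 \<or> snd p < 0}"
    have T: "open T" unfolding T_def by (intro open_Collect_disj open_Collect_less continuous_intros)
    have "continuous_on T (\<lambda>(x,y). G x y)"
      by (rule continuous_on_eq[where f="\<lambda>_. 0"]) (auto simp: G_def T_def)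
    moreover have "x < 0 \<or> y < 0" using False that by linarith
    ultimately show ?thesis using T by (auto simp: continuous_on_eq_continuous_at T_def)
  qed
  have eq: "(\<integral>x. (\<integral>y. (if x \<in> {0<..1} \<and> y \<in> {0<..1} then H x y else 0) \<partial>R) \<partial>R)
       = (\<integral>x. (\<integral>y. G x y \<partial>R) \<partial>R)" if "real_distribution R" and R: "AE x in R. x \<le> 1" for R
  proof -
    interpret R: real_distribution R by fact
    have m1: "(\<lambda>(x,y). G x y) \<in> borel_measurable (borel \<Otimes>\<^sub>M borel)" using meas by (simp add: borel_prod)
    note [measurable] = m1
    define E where "E = {0::real<..1}"
    have G': "(if x \<in> {0<..1} \<and> y \<in> {0<..1} then H x y else 0)
       = indicator E x * (indicator E y * G x y)" for x y
      by (auto simp: G_def min_def indicator_def E_def)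
    have [measurable]: "E \<in> sets borel" by (simp add: E_def)
    have a: "AE y in R. indicator E y * G x y = G x y" for x
      using R by eventually_elim (auto simp: E_def indicator_def G_def)
    have b: "AE x in R. indicator E x * (\<integral>y. G x y \<partial>R) = (\<integral>y. G x y \<partial>R)"
      using R by eventually_elim (auto simp: E_def indicator_def G_def)
    have "(\<integral>y. indicator E x * (indicator E y * G x y) \<partial>R) = indicator E x * (\<integral>y. G x y \<partial>R)" for x
    proof -
      have "(\<integral>y. indicator E y * G x y \<partial>R) = (\<integral>y. G x y \<partial>R)"
        by (rule integral_cong_AE) (use a in auto)
      then show ?thesis by simp
    qed
    then have "(\<integral>x. (\<integral>y. indicator E x * (indicator E y * G x y) \<partial>R) \<partial>R)
        = (\<integral>x. indicator E x * (\<integral>y. G x y \<partial>R) \<partial>R)" by (simp only:)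
    also have "\<dots> = (\<integral>x. (\<integral>y. G x y \<partial>R) \<partial>R)"
      by (rule integral_cong_AE) (use b in auto)
    finally show ?thesis unfolding G' .
  qed
  have "(\<lambda>n. \<integral>x. (\<integral>y. G x y \<partial>P n) \<partial>P n) \<longlonglongrightarrow> (\<integral>x. (\<integral>y. G x y \<partial>Q) \<partial>Q)"
    by (rule weak_conv_double_integral[OF rd AEQ(1) contG bddG meas])
  then show ?thesis unfolding eq[OF rd(1) AEP] eq[OF rd(2) AEQ(2)] .
qed

lemma weak_conv_unit_single:
  fixes f :: "real \<Rightarrow> real"
  assumes rd: "\<And>n. real_distribution (P n)" "real_distribution Q" "weak_conv_m P Q"
    and supp: "\<And>n. AE x in P n. x = -1 \<or> 0 < x \<and> x \<le> 1"
    and tail: "\<And>e. e > 0 \<Longrightarrow> \<exists>d>0. \<forall>\<^sub>F n in sequentially. measure (P n) {0<..d} \<le> e"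
    and cont: "continuous_on {0<..1} f"
    and bdd: "\<And>x. x \<in> {0<..1} \<Longrightarrow> \<bar>f x\<bar> \<le> B"
  shows "(\<lambda>n. \<integral>x. (if x \<in> {0<..1} then f x else 0) \<partial>P n) \<longlonglongrightarrow> (\<integral>x. (if x \<in> {0<..1} then f x else 0) \<partial>Q)"
proof -
  interpret P: real_distribution "P n" for n by (rule rd)
  interpret Q: real_distribution Q by (rule rd)
  define f' where "f' = (\<lambda>x. if 0 < x then f (min x 1) else 0)"
  have AEQ: "AE x in Q. x \<noteq> 0" "AE x in Q. x \<le> 1"
    by (rule weak_limit_no_atom[OF rd supp tail], assumption)+
  have AEP: "AE x in P n. x \<le> 1" for n using supp[of n] by eventually_elim auto
  have cf': "continuous_on {0<..} (\<lambda>x. f (min x 1))"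
    by (rule continuous_on_compose2[OF cont]) (auto intro!: continuous_intros)
  have f'': "f' = (\<lambda>x. indicator {0<..} x *\<^sub>R f (min x 1))" by (auto simp: f'_def fun_eq_iff)
  have [measurable]: "f' \<in> borel_measurable borel"
    unfolding f'' by (rule borel_measurable_continuous_on_indicator[OF _ cf']) simp
  have B: "norm (f' x) \<le> B" for x using bdd[of "min x 1"] bdd[of 1] by (auto simp: f'_def)
  have "isCont f' x" if "x \<noteq> 0" for x
  proof (cases "0 < x")
    case True
    have "continuous_on {0<..} f'" using cf' by (rule continuous_on_eq) (auto simp: f'_def)
    then show ?thesis using True by (simp add: continuous_on_eq_continuous_at)
  next
    case False
    have "continuous_on {..<0} f'" by (rule continuous_on_eq[where f="\<lambda>_. 0"]) (auto simp: f'_def)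
    then show ?thesis using False that by (simp add: continuous_on_eq_continuous_at)
  qed
  then have sub: "{x. \<not> isCont f' x} \<subseteq> {0}" by auto
  have "emeasure Q {0} = 0" using AEQ(1) by (subst (asm) AE_iff_measurable[of "{0}"]) auto
  with sub have "emeasure Q {x. \<not> isCont f' x} = 0"
    using emeasure_mono[OF sub, of Q] by simp
  from weak_conv_imp_bdd_ae_continuous_conv[OF rd this B]
  have lim: "(\<lambda>n. integral\<^sup>L (P n) f') \<longlonglongrightarrow> integral\<^sup>L Q f'" by simp
  have eq: "(\<integral>x. (if x \<in> {0<..1} then f x else 0) \<partial>R) = integral\<^sup>L R f'"
    if "real_distribution R" and R: "AE x in R. x \<le> 1" for R
  proof -
    interpret R: real_distribution R by fact
    have m: "(\<lambda>x. if x \<in> {0<..1} then f x else 0) \<in> borel_measurable R"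
    proof -
      have *: "(\<lambda>x. if x \<in> {0<..1} then f x else 0) = (\<lambda>x. indicator {0<..1} x *\<^sub>R f x)" by auto
      have "(\<lambda>x. if x \<in> {0<..1} then f x else 0) \<in> borel_measurable borel"
        unfolding * by (rule borel_measurable_continuous_on_indicator[OF _ cont]) simp
      then show ?thesis by simp
    qed
    show ?thesis
    proof (rule integral_cong_AE[OF m])
      show "f' \<in> borel_measurable R" by simp
      show "AE x in R. (if x \<in> {0<..1} then f x else 0) = f' x"
        using R by eventually_elim (auto simp: f'_def)
    qed
  qed
  show ?thesis using lim unfolding eq[OF rd(1) AEP] eq[OF rd(2) AEQ(2)] .
qed

section \<open>Kernels and boundary data\<close>

locale bvcf =
  fixes \<alpha> \<beta> \<gamma> K0 F0 :: real
    and K F :: "real \<Rightarrow> real \<Rightarrow> real"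
    and \<mu>in :: "real measure"
    and g :: "real \<Rightarrow> real \<Rightarrow> real"
  assumes \<alpha>: "\<alpha> \<in> {0..1}" and \<beta>: "\<beta> \<in> {0..1}" and \<gamma>: "\<gamma> \<in> {0..1}"
    and K0: "K0 \<ge> 0" and F0: "F0 \<ge> 0"
    and K_cont: "continuous_on ({0<..} \<times> {0<..}) (\<lambda>(x, y). K x y)"
    and F_cont: "continuous_on ({0<..} \<times> {0<..}) (\<lambda>(x, y). F x y)"
    and K_nonneg: "\<And>x y. x > 0 \<Longrightarrow> y > 0 \<Longrightarrow> K x y \<ge> 0"
    and F_nonneg: "\<And>x y. x > 0 \<Longrightarrow> y > 0 \<Longrightarrow> F x y \<ge> 0"
    and K_sym: "\<And>x y. x > 0 \<Longrightarrow> y > 0 \<Longrightarrow> K x y = K y x"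
    and F_sym: "\<And>x y. x > 0 \<Longrightarrow> y > 0 \<Longrightarrow> F x y = F y x"
    and K_le: "\<And>x y. x > 0 \<Longrightarrow> y > 0 \<Longrightarrow>
           K x y \<le> K0 * (x powr (-\<alpha>) + y powr (-\<alpha>)) * (x powr \<beta> + y powr \<beta>)"
    and F_le: "\<And>x y. x > 0 \<Longrightarrow> y > 0 \<Longrightarrow> F x y \<le> F0 * (x powr \<gamma> + y powr \<gamma>)"
    and \<mu>in: "\<mu>in \<in> finite_measures"
    and datum: "boundary_datum g"
    and sup_moment: "sup_moment g (max \<beta> \<gamma>) < \<infinity>"
begin

definition "mx = max \<beta> \<gamma>"

lemma mx: "0 \<le> mx" "mx \<le> 1" "\<beta> \<le> mx" "\<gamma> \<le> mx"
  using \<beta> \<gamma> by (auto simp: mx_def)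

lemma powr_neg_mult_le:
  assumes "0 < x" "x \<le> y" "x \<le> 1"
  shows "y powr (-\<alpha>) * x \<le> 1" "y powr (-\<alpha>) \<le> x powr (-\<alpha>)"
proof -
  show *: "y powr (-\<alpha>) \<le> x powr (-\<alpha>)" using assms \<alpha> by (intro powr_mono2') auto
  have "y powr (-\<alpha>) * x \<le> x powr (-\<alpha>) * x" using * assms by (intro mult_right_mono) auto
  also have "\<dots> = x powr (1 - \<alpha>)" using assms by (simp add: powr_diff powr_minus field_simps)
  also have "\<dots> \<le> 1" using assms \<alpha> by (intro powr_le1) auto
  finally show "y powr (-\<alpha>) * x \<le> 1" .
qed

text \<open>Since \<alpha> is at most 1, multiplication by the smaller argument cancels the
  singularity of both negative powers. The number 4 counts two such powers times two growth terms;
  \<open>c\<close> is 1 inside the unit square and \<open>y powr mx\<close> for a partner beyond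
  1.\<close>

lemma K_mult_le:
  assumes "0 < x" "x \<le> 1" "x \<le> y" "1 \<le> c" "x powr \<beta> \<le> c" "y powr \<beta> \<le> c"
  shows "K x y * x \<le> 4 * K0 * c"
proof -
  have "K x y * x \<le> K0 * (x powr (-\<alpha>) + y powr (-\<alpha>)) * (x powr \<beta> + y powr \<beta>) * x"
    using K_le[of x y] assms by (intro mult_right_mono) auto
  also have "\<dots> = K0 * ((x powr (-\<alpha>) * x + y powr (-\<alpha>) * x) * (x powr \<beta> + y powr \<beta>))"
    by (simp add: algebra_simps)
  also have "\<dots> \<le> K0 * ((1 + 1) * (c + c))"
    using powr_neg_mult_le[of x x] powr_neg_mult_le[of x y] assms K0
    by (intro mult_left_mono mult_mono add_mono) auto
  finally show ?thesis by simp
qed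

lemma K_min_le:
  assumes "x \<in> {0<..1}" "y \<in> {0<..1}"
  shows "K x y * min x y \<le> 4 * K0"
proof -
  have "x powr \<beta> \<le> 1" "y powr \<beta> \<le> 1" using assms \<beta> by (auto intro!: powr_le1)
  then show ?thesis
    using assms K_mult_le[of x y 1] K_mult_le[of y x 1] K_sym[of x y] by (auto simp: min_def)
qed

lemma powr_mx: "1 < y \<Longrightarrow> 1 \<le> y powr mx" "1 < y \<Longrightarrow> y powr \<beta> \<le> y powr mx"
  "1 < y \<Longrightarrow> y powr \<gamma> \<le> y powr mx" "1 < y \<Longrightarrow> y powr mx \<le> y"
  using mx powr_mono[of mx 1 y] by (auto intro!: ge_one_powr_ge_zero powr_mono)

lemma K_bdry_le:
  assumes "x \<in> {0<..1}" "1 < y"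
  shows "K x y * x \<le> 4 * K0 * y powr mx"
proof -
  have "x powr \<beta> \<le> 1" using assms \<beta> by (auto intro!: powr_le1)
  then show ?thesis using assms powr_mx[of y] by (intro K_mult_le) auto
qed

lemma F_le_unit:
  assumes "0 < x" "x \<le> 1" "0 < y" "y \<le> 1"
  shows "F x y \<le> 2 * F0"
proof -
  have "F x y \<le> F0 * (x powr \<gamma> + y powr \<gamma>)" using assms by (intro F_le)
  also have "\<dots> \<le> F0 * (1 + 1)"
    using assms \<gamma> F0 by (intro mult_left_mono add_mono powr_le1) auto
  finally show ?thesis by simp
qed

lemma F_bdry_le:
  assumes "x \<in> {0<..1}" "1 < y"
  shows "F (y - x) x \<le> 2 * F0 * y powr mx"
proof -
  have "F (y - x) x \<le> F0 * ((y-x) powr \<gamma> + x powr \<gamma>)" using assms by (intro F_le) auto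
  also have "\<dots> \<le> F0 * (y powr mx + y powr mx)"
  proof (intro mult_left_mono add_mono)
    show "(y-x) powr \<gamma> \<le> y powr mx"
      using order_trans[OF powr_mono2[of \<gamma> "y-x" y] powr_mx(3)[of y]] assms \<gamma> by simp
    show "x powr \<gamma> \<le> y powr mx"
      using order_trans[OF powr_le1[of \<gamma> x] powr_mx(1)[of y]] assms \<gamma> by simp
  qed (rule F0)
  finally show ?thesis by simp
qed

section \<open>Boundary integrals against weights with a finite moment of order
  \<open>mx\<close>\<close>

definition "weight w \<longleftrightarrow> w \<in> borel_measurable borel \<and> (\<forall>y. 0 \<le> w y) \<and> (\<forall>y\<le>1. w y = 0) \<and>
  integrable lborel (\<lambda>y. y powr mx * w y)"

definition "wnorm w = (\<integral>y. y powr mx * \<bar>w y\<bar> \<partial>lborel)"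

text \<open>A common interface for the two kernels that are integrated against the boundary datum:
  coagulation with a particle beyond 1 and fragmentation of such a particle.\<close>

definition "bdry_kernel \<kappa> A \<longleftrightarrow>
  (\<forall>y>1. continuous_on {0<..1} (\<lambda>x. \<kappa> x y)) \<and>
  (\<forall>x\<in>{0<..1}. (\<lambda>y. indicator {1<..} y * \<kappa> x y) \<in> borel_measurable borel) \<and>
  (\<forall>x\<in>{0<..1}. \<forall>y>1. \<bar>\<kappa> x y\<bar> \<le> A * y powr mx)"

definition bint :: "(real \<Rightarrow> real \<Rightarrow> real) \<Rightarrow> (real \<Rightarrow> real) \<Rightarrow> real \<Rightarrow> real"
  where "bint \<kappa> w x = (\<integral>y. \<kappa> x y * w y \<partial>lborel)"

lemma weight_integrable: "weight w \<Longrightarrow> integrable lborel (\<lambda>y. y powr mx * \<bar>w y\<bar>)"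
  by (simp add: weight_def)

lemma bint_measurable:
  assumes "bdry_kernel \<kappa> A" "weight w" "x \<in> {0<..1}"
  shows "(\<lambda>y. \<kappa> x y * w y) \<in> borel_measurable lborel"
proof -
  have 1: "(\<lambda>y. \<kappa> x y * w y) = (\<lambda>y. (indicator {1<..} y * \<kappa> x y) * w y)"
    using assms(2) by (auto simp: fun_eq_iff weight_def indicator_def not_less)
  show ?thesis
    unfolding 1 using assms
    by (intro borel_measurable_times[of "\<lambda>y. indicator {1<..} y * \<kappa> x y"])
      (auto simp: bdry_kernel_def weight_def )
qed

lemma bint_pointwise:
  assumes "bdry_kernel \<kappa> A" "weight w" "x \<in> {0<..1}"
  shows "norm (\<kappa> x y * w y) \<le> A * (y powr mx * \<bar>w y\<bar>)"
proof (cases "1 < y")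
  case True
  then have "\<bar>\<kappa> x y\<bar> * \<bar>w y\<bar> \<le> (A * y powr mx) * \<bar>w y\<bar>"
    using assms by (intro mult_right_mono) (auto simp: bdry_kernel_def)
  then show ?thesis by (simp add: abs_mult mult.assoc)
qed (use assms in \<open>auto simp: weight_def not_less\<close>)

lemma bint_integrable:
  assumes "bdry_kernel \<kappa> A" "weight w" "x \<in> {0<..1}"
  shows "integrable lborel (\<lambda>y. \<kappa> x y * w y)"
proof (rule Bochner_Integration.integrable_bound)
  show "integrable lborel (\<lambda>y. A * (y powr mx * \<bar>w y\<bar>))"
    using weight_integrable[OF assms(2)] by simp
  show "AE y in lborel. norm (\<kappa> x y * w y) \<le> norm (A * (y powr mx * \<bar>w y\<bar>))"
    using bint_pointwise[OF assms] by (intro AE_I2) (smt (verit) real_norm_def)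
qed (rule bint_measurable[OF assms])

lemma bint_bound:
  assumes "bdry_kernel \<kappa> A" "weight w" "x \<in> {0<..1}"
  shows "\<bar>bint \<kappa> w x\<bar> \<le> A * wnorm w"
proof -
  have "norm (bint \<kappa> w x) \<le> (\<integral>y. A * (y powr mx * \<bar>w y\<bar>) \<partial>lborel)"
    unfolding bint_def
  proof (rule Bochner_Integration.integral_norm_bound_integral)
    show "integrable lborel (\<lambda>y. A * (y powr mx * \<bar>w y\<bar>))"
      using weight_integrable[OF assms(2)] by simp
  qed (use bint_integrable[OF assms] bint_pointwise[OF assms] in auto)
  then show ?thesis by (simp add: wnorm_def)
qed

lemma wnorm_nonneg: "0 \<le> wnorm w"
  unfolding wnorm_def by (intro Bochner_Integration.integral_nonneg) auto

text \<open>A difference of weights has no sign and is not a weight, so the bound is proved directly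
  with the norm of the difference. It makes \<open>bint\<close> Lipschitz in the weight, uniformly
  in \<open>x\<close>.\<close>

lemma bint_diff:
  assumes "bdry_kernel \<kappa> A" "weight w" "weight w'" "x \<in> {0<..1}"
  shows "\<bar>bint \<kappa> w x - bint \<kappa> w' x\<bar> \<le> A * wnorm (\<lambda>y. w y - w' y)"
proof -
  have int: "integrable lborel (\<lambda>y. y powr mx * \<bar>w y - w' y\<bar>)"
  proof (rule Bochner_Integration.integrable_bound)
    show "integrable lborel (\<lambda>y. y powr mx * \<bar>w y\<bar> + y powr mx * \<bar>w' y\<bar>)"
      using weight_integrable assms by (intro Bochner_Integration.integrable_add) auto
    show "(\<lambda>y. y powr mx * \<bar>w y - w' y\<bar>) \<in> borel_measurable lborel"
      using assms(2,3) by (auto simp: weight_def)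
    show "AE y in lborel. norm (y powr mx * \<bar>w y - w' y\<bar>) \<le> norm (y powr mx * \<bar>w y\<bar> + y powr mx * \<bar>w' y\<bar>)"
    proof (rule AE_I2)
      fix y
      have "y powr mx * \<bar>w y - w' y\<bar> \<le> y powr mx * (\<bar>w y\<bar> + \<bar>w' y\<bar>)"
        by (intro mult_left_mono) auto
      then show "norm (y powr mx * \<bar>w y - w' y\<bar>) \<le> norm (y powr mx * \<bar>w y\<bar> + y powr mx * \<bar>w' y\<bar>)"
        by (simp add: distrib_left abs_mult)
    qed
  qed
  have eq: "bint \<kappa> w x - bint \<kappa> w' x = (\<integral>y. \<kappa> x y * w y - \<kappa> x y * w' y \<partial>lborel)"
    unfolding bint_def using bint_integrable[OF assms(1)] assms
    by (intro Bochner_Integration.integral_diff[symmetric]) auto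
  have "norm (bint \<kappa> w x - bint \<kappa> w' x) \<le> (\<integral>y. A * (y powr mx * \<bar>w y - w' y\<bar>) \<partial>lborel)"
    unfolding eq
  proof (rule Bochner_Integration.integral_norm_bound_integral)
    show "integrable lborel (\<lambda>y. \<kappa> x y * w y - \<kappa> x y * w' y)"
      using bint_integrable[OF assms(1)] assms by (intro Bochner_Integration.integrable_diff) auto
    show "integrable lborel (\<lambda>y. A * (y powr mx * \<bar>w y - w' y\<bar>))" using int by simp
    show "norm (\<kappa> x y * w y - \<kappa> x y * w' y) \<le> A * (y powr mx * \<bar>w y - w' y\<bar>)" for y
    proof (cases "1 < y")
      case True
      then have "\<bar>\<kappa> x y\<bar> * \<bar>w y - w' y\<bar> \<le> (A * y powr mx) * \<bar>w y - w' y\<bar>"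
        using assms by (intro mult_right_mono) (auto simp: bdry_kernel_def)
      then show ?thesis by (simp add: abs_mult mult.assoc flip: right_diff_distrib)
    qed (use assms in \<open>auto simp: weight_def not_less\<close>)
  qed
  then show ?thesis by (simp add: wnorm_def)
qed

lemma bint_cont:
  assumes "bdry_kernel \<kappa> A" "weight w"
  shows "continuous_on {0<..1} (bint \<kappa> w)"
  unfolding continuous_on_sequentially
proof (intro allI impI ballI, elim conjE)
  fix u :: "nat \<Rightarrow> real" and x
  assume x: "x \<in> {0<..1}" and u: "\<forall>n. u n \<in> {0<..1}" "u \<longlonglongrightarrow> x"
  have "(\<lambda>n. \<integral>y. \<kappa> (u n) y * w y \<partial>lborel) \<longlonglongrightarrow> (\<integral>y. \<kappa> x y * w y \<partial>lborel)"
  proof (rule integral_dominated_convergence)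
    show "integrable lborel (\<lambda>y. A * (y powr mx * \<bar>w y\<bar>))"
      using weight_integrable[OF assms(2)] by simp
    show "AE y in lborel. (\<lambda>n. \<kappa> (u n) y * w y) \<longlonglongrightarrow> \<kappa> x y * w y"
    proof (rule AE_I2)
      fix y :: real
      show "(\<lambda>n. \<kappa> (u n) y * w y) \<longlonglongrightarrow> \<kappa> x y * w y"
      proof (cases "1 < y")
        case True
        with assms have "continuous_on {0<..1} (\<lambda>x. \<kappa> x y)" by (auto simp: bdry_kernel_def)
        with x u have "(\<lambda>n. \<kappa> (u n) y) \<longlonglongrightarrow> \<kappa> x y"
          unfolding continuous_on_sequentially by (auto simp: o_def)
        then show ?thesis by (intro tendsto_intros)
      qed (use assms in \<open>auto simp: weight_def not_less\<close>)
    qed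
    show "\<And>n. AE y in lborel. norm (\<kappa> (u n) y * w y) \<le> A * (y powr mx * \<bar>w y\<bar>)"
      using bint_pointwise[OF assms] u by auto
  qed (use bint_measurable[OF assms] x u in auto)
  then show "(bint \<kappa> w \<circ> u) \<longlonglongrightarrow> bint \<kappa> w x" by (simp add: bint_def o_def)
qed

text \<open>The factor \<open>x\<close> removes the singularity of \<open>K\<close> at \<open>x = 0\<close>; it comes from the test function.\<close>

definition "\<kappa>K x y = K x y * x"
definition "\<kappa>F x y = F (y - x) x"

lemma K_cont': 
  assumes "continuous_on S f" "continuous_on S h" "\<And>x. x \<in> S \<Longrightarrow> 0 < f x" "\<And>x. x \<in> S \<Longrightarrow> 0 < h x"
  shows "continuous_on S (\<lambda>x. K (f x) (h x))"
  using continuous_on_compose2[OF K_cont continuous_on_Pair[OF assms(1,2)]] assms(3,4) by auto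

lemma F_cont': 
  assumes "continuous_on S f" "continuous_on S h" "\<And>x. x \<in> S \<Longrightarrow> 0 < f x" "\<And>x. x \<in> S \<Longrightarrow> 0 < h x"
  shows "continuous_on S (\<lambda>x. F (f x) (h x))"
  using continuous_on_compose2[OF F_cont continuous_on_Pair[OF assms(1,2)]] assms(3,4) by auto

lemma bdry_kernel_K: "bdry_kernel \<kappa>K (4 * K0)"
  unfolding bdry_kernel_def \<kappa>K_def
proof (intro conjI allI ballI impI)
  fix y :: real assume "1 < y"
  then show "continuous_on {0<..1} (\<lambda>x. K x y * x)"
    by (intro continuous_intros K_cont') auto
next
  fix x :: real assume x: "x \<in> {0<..1}"
  have "continuous_on {1<..} (\<lambda>y. K x y * x)"
    using x by (intro continuous_intros K_cont') auto
  from borel_measurable_continuous_on_indicator[OF _ this]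
  show "(\<lambda>y. indicator {1<..} y * (K x y * x)) \<in> borel_measurable borel" by simp
  show "\<bar>K x y * x\<bar> \<le> 4 * K0 * y powr mx" if "1 < y" for y
    using K_bdry_le[OF x that] K_nonneg[of x y] x that by simp
qed

lemma bdry_kernel_F: "bdry_kernel \<kappa>F (2 * F0)"
  unfolding bdry_kernel_def \<kappa>F_def
proof (intro conjI allI ballI impI)
  fix y :: real assume "1 < y"
  then show "continuous_on {0<..1} (\<lambda>x. F (y - x) x)"
    by (intro continuous_intros F_cont') auto
next
  fix x :: real assume x: "x \<in> {0<..1}"
  have "continuous_on {1<..} (\<lambda>y. F (y - x) x)"
    using x by (intro continuous_intros F_cont') auto
  from borel_measurable_continuous_on_indicator[OF _ this]
  show "(\<lambda>y. indicator {1<..} y * (F (y - x) x)) \<in> borel_measurable borel" by simp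
  show "\<bar>F (y - x) x\<bar> \<le> 2 * F0 * y powr mx" if "1 < y" for y
    using F_bdry_le[OF x that] F_nonneg[of "y - x" x] x that by simp
qed

text \<open>The datum is nonnegative only almost everywhere; its positive part on
  \<open>{1<..}\<close> is a representative that is nonnegative at every point, as
  \<open>weight\<close> demands.\<close>

definition "datum_pos s y = (if 1 < y then max 0 (g s y) else 0)"

text \<open>
  The datum is truncated because \<open>t \<mapsto> g t\<close> is continuous only in \<open>L\<^sup>1\<close>: its moments are bounded,
  but they need not be continuous in time.
\<close>

definition "trunc n s y = (if y \<le> real n then datum_pos s y else 0)"
definition "M = enn2real (sup_moment g mx)"

lemma M_nonneg: "0 \<le> M" by (simp add: M_def)

lemma g_meas: "0 \<le> s \<Longrightarrow> (\<lambda>y. indicator {1<..} y * g s y) \<in> borel_measurable borel"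
  using datum unfolding boundary_datum_def set_integrable_def
  by (auto dest!: spec borel_measurable_integrable)

lemma datum_pos_meas: "0 \<le> s \<Longrightarrow> datum_pos s \<in> borel_measurable borel"
proof -
  assume s: "0 \<le> s"
  have "datum_pos s = (\<lambda>y. max 0 (indicator {1<..} y * g s y))" by (auto simp: datum_pos_def fun_eq_iff)
  then show ?thesis using g_meas[OF s] by simp
qed

lemma datum_pos_AE:
  assumes "0 \<le> s" shows "AE y in lborel. indicator {1<..} y * g s y = datum_pos s y"
proof -
  have "AE y in lborel. y \<in> {1<..} \<longrightarrow> 0 \<le> g s y" using datum assms by (auto simp: boundary_datum_def)
  then show ?thesis by eventually_elim (auto simp: datum_pos_def indicator_def)
qed

lemma datum_pos_weight:
  assumes s: "0 \<le> s"
  shows "weight (datum_pos s)" "wnorm (datum_pos s) \<le> M"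
proof -
  have nn: "(\<integral>\<^sup>+y. ennreal (y powr mx * datum_pos s y) \<partial>lborel) \<le> sup_moment g mx"
  proof -
    have "(\<integral>\<^sup>+y. ennreal (y powr mx * datum_pos s y) \<partial>lborel) = moment g mx s"
      unfolding moment_def by (rule nn_integral_cong_AE)
        (use datum_pos_AE[OF s] in \<open>eventually_elim, auto simp: indicator_def datum_pos_def\<close>)
    also have "\<dots> \<le> sup_moment g mx"
      unfolding sup_moment_def using s by (intro SUP_upper) auto
    finally show ?thesis .
  qed
  have fin: "sup_moment g mx < \<infinity>" using sup_moment by (simp add: mx_def)
  have m: "(\<lambda>y. y powr mx * datum_pos s y) \<in> borel_measurable lborel" using datum_pos_meas[OF s] by simp
  have pos: "0 \<le> datum_pos s y" for y by (simp add: datum_pos_def)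
  have int: "integrable lborel (\<lambda>y. y powr mx * datum_pos s y)"
    using m pos nn fin by (intro integrableI_nonneg) auto
  then show "weight (datum_pos s)"
    using datum_pos_meas[OF s] pos by (auto simp: weight_def datum_pos_def)
  have "ennreal (\<integral>y. y powr mx * datum_pos s y \<partial>lborel) = (\<integral>\<^sup>+y. ennreal (y powr mx * datum_pos s y) \<partial>lborel)"
    using int pos by (intro nn_integral_eq_integral[symmetric]) auto
  also note nn
  also have "sup_moment g mx = ennreal M" using fin by (simp add: M_def)
  finally show "wnorm (datum_pos s) \<le> M" using pos M_nonneg by (simp add: wnorm_def)
qed

lemma trunc_weight:
  assumes s: "0 \<le> s"
  shows "weight (trunc n s)" "wnorm (trunc n s) \<le> M"
proof -
  have w: "weight (datum_pos s)" and wm: "wnorm (datum_pos s) \<le> M" using datum_pos_weight[OF s] by auto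
  have m: "trunc n s \<in> borel_measurable borel"
    unfolding trunc_def using datum_pos_meas[OF s] by measurable
  have le: "0 \<le> trunc n s y" "trunc n s y \<le> datum_pos s y" for y
    using w by (auto simp: trunc_def weight_def)
  have "integrable lborel (\<lambda>y. y powr mx * trunc n s y)"
  proof (rule Bochner_Integration.integrable_bound)
    show "integrable lborel (\<lambda>y. y powr mx * datum_pos s y)" using w by (simp add: weight_def)
    show "AE y in lborel. norm (y powr mx * trunc n s y) \<le> norm (y powr mx * datum_pos s y)"
      using le w by (intro AE_I2) (auto simp: weight_def abs_mult intro!: mult_left_mono)
  qed (use m in measurable)
  then show w': "weight (trunc n s)" using m le w by (auto simp: weight_def trunc_def)
  have "wnorm (trunc n s) \<le> wnorm (datum_pos s)"
    unfolding wnorm_def using weight_integrable[OF w] weight_integrable[OF w'] le w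
    by (intro integral_mono mult_left_mono) (auto simp: weight_def)
  with wm show "wnorm (trunc n s) \<le> M" by simp
qed

end

section \<open>Test functions, fragmentation and the grid\<close>

lemma coag_op_cong:
  assumes "\<And>x. x \<in> {0<..1} \<Longrightarrow> \<phi> x = \<psi> x" "x \<in> {0<..1}" "y \<in> {0<..1}"
  shows "coag_op \<phi> x y = coag_op \<psi> x y"
  using assms by (simp add: coag_op_def extend_const_def)

text \<open>Normal form of the elements of \<open>Lip\<^sub>0\<close>: extended by \<open>0\<close> to the left and by \<open>\<phi>(1)\<close> to the right.\<close>

definition test_fun :: "real \<Rightarrow> (real \<Rightarrow> real) \<Rightarrow> bool" where
  "test_fun L \<phi> \<longleftrightarrow> L-lipschitz_on UNIV \<phi> \<and> (\<forall>x\<le>0. \<phi> x = 0) \<and> (\<forall>x\<ge>1. \<phi> x = \<phi> 1)"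

lemma test_funD:
  assumes "test_fun L \<phi>"
  shows "0 \<le> L" "\<bar>\<phi> x - \<phi> y\<bar> \<le> L * \<bar>x - y\<bar>" "x \<le> 0 \<Longrightarrow> \<phi> x = 0" "1 \<le> x \<Longrightarrow> \<phi> x = \<phi> 1"
    "0 \<le> x \<Longrightarrow> \<bar>\<phi> x\<bar> \<le> L * x" "\<bar>\<phi> x\<bar> \<le> L" "continuous_on UNIV \<phi>" "\<phi> \<in> borel_measurable borel"
proof -
  show L: "0 \<le> L" and zero: "x \<le> 0 \<Longrightarrow> \<phi> x = 0" and one: "1 \<le> x \<Longrightarrow> \<phi> x = \<phi> 1" for x
    using assms lipschitz_on_nonneg unfolding test_fun_def by blast+
  show lip: "\<bar>\<phi> x - \<phi> y\<bar> \<le> L * \<bar>x - y\<bar>" for x y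
    using assms lipschitz_onD[of L UNIV \<phi> x y] unfolding test_fun_def dist_real_def by blast
  show lin: "0 \<le> x \<Longrightarrow> \<bar>\<phi> x\<bar> \<le> L * x" for x
    using lip[of x 0] zero[of 0] by simp
  consider "x \<le> 0" | "0 \<le> x" "x \<le> 1" | "1 \<le> x" by linarith
  then show "\<bar>\<phi> x\<bar> \<le> L"
  proof cases
    case 1
    then show ?thesis using zero[of x] L by simp
  next
    case 2
    then show ?thesis using lin[of x] mult_left_mono[of x 1 L] L by simp
  next
    case 3
    show ?thesis using one[OF 3] lin[of 1] by simp
  qed
  show "continuous_on UNIV \<phi>"
    using assms lipschitz_on_continuous_on unfolding test_fun_def by blast
  then show "\<phi> \<in> borel_measurable borel"
    by (rule borel_measurable_continuous_onI)
qed

lemma test_fun_coag_op: "test_fun L \<phi> \<Longrightarrow> coag_op \<phi> x y = \<phi> (x + y) - \<phi> x - \<phi> y"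
  unfolding coag_op_def extend_const_def using test_funD(4)[of L \<phi> "x+y"] by simp

text \<open>The value at the sum is paired with the value at the larger argument, from which it
  differs by at most \<open>L\<close> times the smaller one; the remaining value has the same bound.
  The factor \<open>min x y\<close> is what balances the singular kernel.\<close>

lemma test_fun_coag_op_le:
  assumes "test_fun L \<phi>" "0 \<le> x" "0 \<le> y"
  shows "\<bar>coag_op \<phi> x y\<bar> \<le> 2 * L * min x y"
proof (cases "x \<le> y")
  case True
  then show ?thesis
    using test_funD(2)[OF assms(1), of "x+y" y] test_funD(5)[OF assms(1,2)] assms(2)
    unfolding test_fun_coag_op[OF assms(1)] by (simp add: min_def)
next
  case False
  then show ?thesis
    using test_funD(2)[OF assms(1), of "x+y" x] test_funD(5)[OF assms(1,3)] assms(3)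
    unfolding test_fun_coag_op[OF assms(1)] by (simp add: min_def)
qed

section \<open>Half-open grid cells and rounding up to their right endpoints\<close>

definition cell :: "nat \<Rightarrow> nat \<Rightarrow> real set"
  where "cell n l = {(real l - 1) / real n <.. real l / real n}"

definition cell_index :: "nat \<Rightarrow> real \<Rightarrow> nat"
  where "cell_index n x = nat \<lceil>real n * x\<rceil>"

definition round_up :: "nat \<Rightarrow> real \<Rightarrow> real"
  where "round_up n x = real (cell_index n x) / real n"

lemma cell_index_measurable [measurable]: "cell_index n \<in> borel \<rightarrow>\<^sub>M count_space UNIV"
  unfolding cell_index_def by measurable

lemma round_up_measurable [measurable]: "round_up n \<in> borel_measurable borel"
  unfolding round_up_def by measurable

lemma cell_sets [measurable, simp]: "cell n l \<in> sets borel" by (simp add: cell_def)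

lemma mem_cell_iff:
  assumes "1 \<le> n" "1 \<le> l" shows "x \<in> cell n l \<longleftrightarrow> cell_index n x = l"
proof -
  have "x \<in> cell n l \<longleftrightarrow> real l - 1 < real n * x \<and> real n * x \<le> real l"
    using assms by (auto simp: cell_def field_simps)
  also have "\<dots> \<longleftrightarrow> \<lceil>real n * x\<rceil> = int l"
    by (auto simp: ceiling_eq_iff)
  also have "\<dots> \<longleftrightarrow> cell_index n x = l" using assms by (auto simp: cell_index_def)
  finally show ?thesis .
qed

lemma cell_index_range:
  assumes "1 \<le> n" shows "cell_index n x \<in> {1..n} \<longleftrightarrow> x \<in> {0<..1}"
proof -
  have "cell_index n x \<in> {1..n} \<longleftrightarrow> 0 < real n * x \<and> real n * x \<le> real n"
    by (auto simp: cell_index_def nat_le_iff Suc_le_eq ceiling_le_iff)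
  then show ?thesis using assms by (auto simp: zero_less_mult_iff)
qed

lemma round_up:
  assumes "1 \<le> n" "x \<in> {0<..1}"
  shows "round_up n x \<in> {0<..1}" "\<bar>round_up n x - x\<bar> \<le> 1 / real n" "x \<le> round_up n x"
proof -
  define l where "l = cell_index n x"
  have l: "l \<in> {1..n}" using cell_index_range assms unfolding l_def by blast
  then have "x \<in> cell n l" using mem_cell_iff[of n l x] assms by (auto simp: l_def)
  then show "\<bar>round_up n x - x\<bar> \<le> 1 / real n" "x \<le> round_up n x"
    using assms l by (auto simp: cell_def round_up_def l_def[symmetric] diff_divide_distrib)
  show "round_up n x \<in> {0<..1}" using l assms by (auto simp: round_up_def l_def[symmetric] field_simps)
qed

text \<open>At each \<open>x\<close> in (0,1] exactly one cell contributes, the one with index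
  \<open>cell_index n x\<close>. Gains distributed by exact cell integrals therefore carry no other
  discretisation error than the rounding of the test function.\<close>

lemma cell_sum:
  fixes f :: "real \<Rightarrow> real" and \<psi> :: "nat \<Rightarrow> real"
  assumes n: "1 \<le> n" and f: "integrable N f" and N: "sets N = sets borel"
  shows "(\<Sum>l=1..n. (\<integral>x. indicator (cell n l) x * f x \<partial>N) * \<psi> l)
    = (\<integral>x. indicator {0<..1} x * (f x * \<psi> (cell_index n x)) \<partial>N)"
proof -
  have int: "integrable N (\<lambda>x. indicator (cell n l) x * f x)" for l
    using integrable_real_mult_indicator[OF _ f, of "cell n l"] N by (simp add: mult.commute)
  have pt: "(\<Sum>l=1..n. indicator (cell n l) x * f x * \<psi> l) = indicator {0<..1} x * (f x * \<psi> (cell_index n x))" for x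
  proof -
    have "(\<Sum>l=1..n. indicator (cell n l) x * f x * \<psi> l)
        = (\<Sum>l=1..n. if l = cell_index n x then f x * \<psi> l else 0)"
      using n by (intro sum.cong) (auto simp: indicator_def mem_cell_iff)
    also have "\<dots> = (if cell_index n x \<in> {1..n} then f x * \<psi> (cell_index n x) else 0)"
      by simp
    finally show ?thesis unfolding cell_index_range[OF n] by (auto simp: indicator_def)
  qed
  have "(\<Sum>l=1..n. (\<integral>x. indicator (cell n l) x * f x \<partial>N) * \<psi> l)
      = (\<Sum>l=1..n. (\<integral>x. indicator (cell n l) x * f x * \<psi> l \<partial>N))"
    by simp
  also have "\<dots> = (\<integral>x. (\<Sum>l=1..n. indicator (cell n l) x * f x * \<psi> l) \<partial>N)"
    by (intro Bochner_Integration.integral_sum[symmetric]) (use int in auto)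
  finally show ?thesis unfolding pt .
qed

context bvcf
begin

section \<open>Boundedness and continuity of coagulation and fragmentation on test functions\<close>

lemma K_coag_le:
  assumes "test_fun L \<phi>" "x \<in> {0<..1}" "y \<in> {0<..1}"
  shows "\<bar>K x y * coag_op \<phi> x y\<bar> \<le> 8 * K0 * L"
proof -
  have "\<bar>K x y * coag_op \<phi> x y\<bar> \<le> K x y * (2 * L * min x y)"
    using test_fun_coag_op_le[OF assms(1), of x y] K_nonneg[of x y] assms
    by (simp add: abs_mult mult_left_mono)
  also have "\<dots> = 2 * L * (K x y * min x y)" by simp
  also have "\<dots> \<le> 2 * L * (4 * K0)"
    using K_min_le[OF assms(2,3)] test_funD(1)[OF assms(1)] by (intro mult_left_mono) auto
  finally show ?thesis by (simp add: mult_ac)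
qed

lemma K_coag_cont:
  assumes "test_fun L \<phi>"
  shows "continuous_on ({0<..1}\<times>{0<..1}) (\<lambda>(x,y). K x y * coag_op \<phi> x y)"
proof -
  note c = continuous_on_compose2[OF test_funD(7)[OF assms]]
  have "continuous_on ({0<..1}\<times>{0<..1}) (\<lambda>p. K (fst p) (snd p) * (\<phi> (fst p + snd p) - \<phi> (fst p) - \<phi> (snd p)))"
    by (intro continuous_intros K_cont' c) auto
  then show ?thesis by (simp add: test_fun_coag_op[OF assms] case_prod_beta)
qed

text \<open>By symmetry both fragments contribute equally, so the factor 1/2 of
  \<open>frag_op\<close> cancels in the gain \<open>fragint\<close> and survives only in the
  break-up rate \<open>frag_rate\<close>. The gain of the constant 1 is thus twice that rate: one
  particle becomes two.\<close>

definition "fragint \<phi> x = (\<integral>y. indicator {0<..<x} y * (F (x - y) y * \<phi> y) \<partial>lborel)"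
definition "frag_rate x = 1 / 2 * fragint (\<lambda>_. 1) x"

lemma fragint_meas:
  assumes "\<phi> \<in> borel_measurable borel"
  shows "(\<lambda>y. indicator {0<..<x} y * (F (x - y) y * \<phi> y)) \<in> borel_measurable borel"
proof -
  have "continuous_on {0<..<x} (\<lambda>y. F (x - y) y)" by (intro F_cont' continuous_intros) auto
  from borel_measurable_continuous_on_indicator[OF _ this]
  have "(\<lambda>y. (indicator {0<..<x} y * F (x - y) y) * \<phi> y) \<in> borel_measurable borel"
    using assms by (intro borel_measurable_times[of "\<lambda>y. indicator {0<..<x} y * F (x - y) y"]) simp_all
  then show ?thesis by (simp add: mult.assoc)
qed

lemma fragint_pointwise:
  assumes "x \<in> {0<..1}" "\<And>y. y \<in> {0<..1} \<Longrightarrow> \<bar>\<phi> y\<bar> \<le> B"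
  shows "norm (indicator {0<..<x} y * (F (x - y) y * \<phi> y)) \<le> indicator {0<..1} y * (2 * F0 * B)"
proof (cases "y \<in> {0<..<x}")
  case True
  have "F (x - y) y * \<bar>\<phi> y\<bar> \<le> 2 * F0 * B"
    using assms True F_le_unit[of "x-y" y] F_nonneg[of "x-y" y] F0 by (intro mult_mono) auto
  moreover have "0 \<le> F (x - y) y" using True by (intro F_nonneg) auto
  ultimately show ?thesis using True assms by (auto simp: abs_mult)
next
  case False
  have "0 \<le> B" using assms(2)[of 1] by simp
  with False show ?thesis using F0 by simp
qed

lemma fragint_integrable:
  assumes "x \<in> {0<..1}" "\<And>y. y \<in> {0<..1} \<Longrightarrow> \<bar>\<phi> y\<bar> \<le> B" "\<phi> \<in> borel_measurable borel"
  shows "integrable lborel (\<lambda>y. indicator {0<..<x} y * (F (x - y) y * \<phi> y))"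
proof (rule Bochner_Integration.integrable_bound)
  show "integrable lborel (\<lambda>y. indicator {0<..1::real} y * (2 * F0 * B))"
    by (intro integrable_mult_left integrable_real_indicator) auto
  show "AE y in lborel. norm (indicator {0<..<x} y * (F (x - y) y * \<phi> y)) \<le> norm (indicator {0<..1::real} y * (2 * F0 * B))"
    by (rule AE_I2, rule order_trans[OF fragint_pointwise[OF assms(1,2)]], assumption)
      (simp only: real_norm_def abs_ge_self)
qed (use fragint_meas[OF assms(3)] in simp)

lemma fragint_bound:
  assumes "x \<in> {0<..1}" "\<And>y. y \<in> {0<..1} \<Longrightarrow> \<bar>\<phi> y\<bar> \<le> B" "\<phi> \<in> borel_measurable borel"
  shows "\<bar>fragint \<phi> x\<bar> \<le> 2 * F0 * B"
proof -
  have "norm (fragint \<phi> x) \<le> (\<integral>y. indicator {0<..1::real} y * (2 * F0 * B) \<partial>lborel)"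
    unfolding fragint_def
  proof (rule Bochner_Integration.integral_norm_bound_integral)
    show "integrable lborel (\<lambda>y. indicator {0<..1::real} y * (2 * F0 * B))"
      by (intro integrable_mult_left integrable_real_indicator) auto
  qed (use fragint_integrable[OF assms] fragint_pointwise[OF assms(1,2)] in auto)
  then show ?thesis by simp
qed

lemma fragint_cont:
  assumes "\<And>y. y \<in> {0<..1} \<Longrightarrow> \<bar>\<phi> y\<bar> \<le> B" "\<phi> \<in> borel_measurable borel"
  shows "continuous_on {0<..1} (fragint \<phi>)"
  unfolding continuous_on_sequentially
proof (intro allI impI ballI, elim conjE)
  fix u :: "nat \<Rightarrow> real" and x
  assume x: "x \<in> {0<..1}" and u: "\<forall>n. u n \<in> {0<..1}" "u \<longlonglongrightarrow> x"
  have "(\<lambda>n. \<integral>y. indicator {0<..<u n} y * (F (u n - y) y * \<phi> y) \<partial>lborel)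
      \<longlonglongrightarrow> (\<integral>y. indicator {0<..<x} y * (F (x - y) y * \<phi> y) \<partial>lborel)"
  proof (rule integral_dominated_convergence)
    show "integrable lborel (\<lambda>y. indicator {0<..1::real} y * (2 * F0 * B))"
      by (intro integrable_mult_left integrable_real_indicator) auto
    \<comment> \<open>The endpoint of the domain of integration moves with \<open>u n\<close>; the
      indicators converge at every point other than \<open>x\<close>.\<close>
    have "AE y in lborel. y \<noteq> x" by (rule AE_lborel_singleton)
    then show "AE y in lborel. (\<lambda>n. indicator {0<..<u n} y * (F (u n - y) y * \<phi> y))
       \<longlonglongrightarrow> indicator {0<..<x} y * (F (x - y) y * \<phi> y)"
    proof eventually_elim
      case (elim y)
      consider "y \<le> 0" | "0 < y" "y < x" | "x < y" using elim by linarith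
      then show ?case
      proof cases
        case 1
        then show ?thesis by simp
      next
        case 2
        have "continuous_on {y<..} (\<lambda>x. F (x - y) y)"
          using 2 by (intro F_cont' continuous_intros) auto
        then have c: "isCont (\<lambda>x. F (x - y) y) x" using 2 by (simp add: continuous_on_eq_continuous_at)
        have "(\<lambda>n. F (u n - y) y * \<phi> y) \<longlonglongrightarrow> F (x - y) y * \<phi> y"
          using isCont_tendsto_compose[OF c u(2)] by (intro tendsto_intros) simp
        moreover have "\<forall>\<^sub>F n in sequentially. F (u n - y) y * \<phi> y
           = indicator {0<..<u n} y * (F (u n - y) y * \<phi> y)"
          using order_tendstoD(1)[OF u(2) 2(2)] by eventually_elim (use 2 in simp)
        ultimately have "(\<lambda>n. indicator {0<..<u n} y * (F (u n - y) y * \<phi> y)) \<longlonglongrightarrow> F (x - y) y * \<phi> y"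
          by (rule Lim_transform_eventually)
        then show ?thesis using 2 by simp
      next
        case 3
        have "\<forall>\<^sub>F n in sequentially. indicator {0<..<u n} y * (F (u n - y) y * \<phi> y) = 0"
          using order_tendstoD(2)[OF u(2) 3] by eventually_elim simp
        then show ?thesis using 3 by (simp add: tendsto_eventually)
      qed
    qed
    show "\<And>n. AE y in lborel. norm (indicator {0<..<u n} y * (F (u n - y) y * \<phi> y)) \<le> indicator {0<..1} y * (2 * F0 * B)"
      by (intro AE_I2 fragint_pointwise) (use u assms in auto)
  qed (use fragint_meas[OF assms(2)] in auto)
  then show "(fragint \<phi> \<circ> u) \<longlonglongrightarrow> fragint \<phi> x" by (simp add: fragint_def o_def)
qed

lemma frag_rate:
  assumes "x \<in> {0<..1}" shows "0 \<le> frag_rate x" "frag_rate x \<le> F0"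
proof -
  show "frag_rate x \<le> F0" using fragint_bound[OF assms, of "\<lambda>_. 1" 1] by (simp add: frag_rate_def)
  show "0 \<le> frag_rate x"
  proof -
    have "0 \<le> indicator {0<..<x} y * (F (x - y) y * 1)" for y
      using F_nonneg[of "x - y" y] by (simp add: indicator_def)
    then have "0 \<le> fragint (\<lambda>_. 1) x" unfolding fragint_def by (rule Bochner_Integration.integral_nonneg)
    then show ?thesis by (simp add: frag_rate_def)
  qed
qed

lemma frag_rate_cont: "continuous_on {0<..1} frag_rate"
  unfolding frag_rate_def by (intro continuous_intros fragint_cont[where B=1]) auto

text \<open>The reflection sending \<open>y\<close> to \<open>x - y\<close> exchanges the two
  fragments, and \<open>F_sym\<close> restores the kernel.\<close>

lemma fragint_symmetric:
  "fragint (\<lambda>y. \<phi> (x - y)) x = fragint \<phi> x"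
proof -
  have "fragint \<phi> x = (\<integral>y. indicator {0<..<x} (x + (-1) * y) * (F (x - (x + (-1) * y)) (x + (-1) * y) * \<phi> (x + (-1) * y)) \<partial>lborel)"
    unfolding fragint_def by (subst lborel_integral_real_affine[where c="-1" and t=x]) auto
  also have "\<dots> = fragint (\<lambda>y. \<phi> (x - y)) x"
    unfolding fragint_def
  proof (rule Bochner_Integration.integral_cong[OF refl])
    fix y
    show "indicator {0<..<x} (x + (-1) * y) * (F (x - (x + (-1) * y)) (x + (-1) * y) * \<phi> (x + (-1) * y))
      = indicator {0<..<x} y * (F (x - y) y * \<phi> (x - y))"
      using F_sym[of y "x-y"] by (auto simp: indicator_def)
  qed
  finally show ?thesis by simp
qed

lemma frag_op_eq:
  assumes "x \<in> {0<..1}" "\<And>y. \<bar>\<phi> y\<bar> \<le> B" "\<phi> \<in> borel_measurable borel"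
  shows "set_integrable lborel {0<..<x} (frag_integrand F \<phi> x)"
    "frag_op F \<phi> x = frag_rate x * \<phi> x - fragint \<phi> x"
proof -
  have m: "(\<lambda>y. \<phi> (x - y)) \<in> borel_measurable borel" using assms(3) by measurable
  note i1 = fragint_integrable[OF assms(1), of "\<lambda>_. \<phi> x" B]
  note i2 = fragint_integrable[OF assms(1), of "\<lambda>y. \<phi> (x - y)" B]
  note i3 = fragint_integrable[OF assms(1), of "\<lambda>y. \<phi> y" B]
  have eq: "indicator {0<..<x} y *\<^sub>R frag_integrand F \<phi> x y
     = indicator {0<..<x} y * (F (x - y) y * \<phi> x) - indicator {0<..<x} y * (F (x - y) y * \<phi> (x - y))
       - indicator {0<..<x} y * (F (x - y) y * \<phi> y)" for y
    by (simp add: frag_integrand_def algebra_simps)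
  show "set_integrable lborel {0<..<x} (frag_integrand F \<phi> x)"
    unfolding set_integrable_def eq using i1 i2 i3 assms m by auto
  have "(LINT y:{0<..<x}|lborel. frag_integrand F \<phi> x y)
    = fragint (\<lambda>_. \<phi> x) x - fragint (\<lambda>y. \<phi> (x - y)) x - fragint \<phi> x"
    unfolding set_lebesgue_integral_def eq fragint_def using i1 i2 i3 assms m by simp
  also have "fragint (\<lambda>_. \<phi> x) x = \<phi> x * fragint (\<lambda>_. 1) x"
    unfolding fragint_def by (subst integral_mult_right_zero[symmetric])
      (simp add: mult_ac)
  finally show "frag_op F \<phi> x = frag_rate x * \<phi> x - fragint \<phi> x"
    unfolding frag_op_def fragint_symmetric frag_rate_def by simp
qed

end

section \<open>The discrete scheme\<close>

text \<open>Index \<open>i\<close> stands for size i/n; \<open>k\<close> is the coagulation kernel,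
  \<open>d\<close> the remaining loss rate, \<open>f i l\<close> the rate at which a particle
  \<open>i\<close> releases fragments \<open>l\<close>, and \<open>r\<close> the source. Coagulation
  products beyond size 1 are placed at index \<open>n\<close>, the discrete form of
  \<open>extend_const\<close>.\<close>

definition euler_step :: "nat \<Rightarrow> real \<Rightarrow> (nat \<Rightarrow> nat \<Rightarrow> real) \<Rightarrow> (nat \<Rightarrow> real) \<Rightarrow>
    (nat \<Rightarrow> nat \<Rightarrow> real) \<Rightarrow> (nat \<Rightarrow> real) \<Rightarrow> (nat \<Rightarrow> real) \<Rightarrow> nat \<Rightarrow> real" where
  "euler_step n h k d f r c l = c l + h * (
     1/2 * (\<Sum>i=1..n. \<Sum>j=1..n. if min (i + j) n = l then k i j * c i * c j else 0)
     - c l * ((\<Sum>j=1..n. k l j * c j) + d l) + (\<Sum>i=1..n. c i * f i l) + r l)"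

text \<open>Discrete weak formulation. The gain sum collapses because each pair has exactly one
  target index; symmetry of \<open>k\<close> distributes the loss evenly over both partners, which
  produces the bracket with the common factor 1/2.\<close>

lemma euler_step_sum:
  assumes sym: "\<And>i j. i \<in> {1..n} \<Longrightarrow> j \<in> {1..n} \<Longrightarrow> k i j = k j i"
  shows "(\<Sum>l=1..n. euler_step n h k d f r c l * \<psi> l) = (\<Sum>l=1..n. c l * \<psi> l) + h * (
     1/2 * (\<Sum>i=1..n. \<Sum>j=1..n. k i j * c i * c j * (\<psi> (min (i + j) n) - \<psi> i - \<psi> j))
     - (\<Sum>l=1..n. c l * d l * \<psi> l) + (\<Sum>i=1..n. c i * (\<Sum>l=1..n. f i l * \<psi> l)) + (\<Sum>l=1..n. r l * \<psi> l))"
proof -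
  have gain: "(\<Sum>l=1..n. (\<Sum>i=1..n. \<Sum>j=1..n. if min (i + j) n = l then k i j * c i * c j else 0) * \<psi> l)
      = (\<Sum>i=1..n. \<Sum>j=1..n. k i j * c i * c j * \<psi> (min (i + j) n))"
  proof -
    have "(\<Sum>l=1..n. (\<Sum>i=1..n. \<Sum>j=1..n. if min (i + j) n = l then k i j * c i * c j else 0) * \<psi> l)
       = (\<Sum>l=1..n. \<Sum>i=1..n. \<Sum>j=1..n. if min (i + j) n = l then k i j * c i * c j * \<psi> l else 0)"
      by (intro sum.cong refl) (simp add: sum_distrib_right if_distrib[of "\<lambda>x. x * _"] cong: if_cong)
    also have "\<dots> = (\<Sum>i=1..n. \<Sum>l=1..n. \<Sum>j=1..n. if min (i + j) n = l then k i j * c i * c j * \<psi> l else 0)"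
      by (rule sum.swap)
    also have "\<dots> = (\<Sum>i=1..n. \<Sum>j=1..n. \<Sum>l=1..n. if min (i + j) n = l then k i j * c i * c j * \<psi> l else 0)"
      by (intro sum.cong refl sum.swap)
    also have "\<dots> = (\<Sum>i=1..n. \<Sum>j=1..n. k i j * c i * c j * \<psi> (min (i + j) n))"
    proof (intro sum.cong refl)
      fix i j assume "i \<in> {1..n}" "j \<in> {1..n}"
      then have "min (i + j) n \<in> {1..n}" by auto
      then show "(\<Sum>l=1..n. if min (i + j) n = l then k i j * c i * c j * \<psi> l else 0)
          = k i j * c i * c j * \<psi> (min (i + j) n)" by (simp add: sum.delta')
    qed
    finally show ?thesis .
  qed
  have swap: "(\<Sum>i=1..n. \<Sum>j=1..n. k i j * c i * c j * \<psi> j) = (\<Sum>i=1..n. \<Sum>j=1..n. k i j * c i * c j * \<psi> i)"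
    by (subst sum.swap) (intro sum.cong refl, use sym in simp)
  have loss: "(\<Sum>l=1..n. c l * (\<Sum>j=1..n. k l j * c j) * \<psi> l) = (\<Sum>i=1..n. \<Sum>j=1..n. k i j * c i * c j * \<psi> i)"
    by (intro sum.cong refl) (simp add: sum_distrib_left sum_distrib_right mult_ac)
  have frag: "(\<Sum>l=1..n. (\<Sum>i=1..n. c i * f i l) * \<psi> l) = (\<Sum>i=1..n. c i * (\<Sum>l=1..n. f i l * \<psi> l))"
    unfolding sum_distrib_right sum_distrib_left by (subst sum.swap) (simp add: mult_ac)
  have coag: "(\<Sum>i=1..n. \<Sum>j=1..n. k i j * c i * c j * (\<psi> (min (i + j) n) - \<psi> i - \<psi> j))
     = (\<Sum>i=1..n. \<Sum>j=1..n. k i j * c i * c j * \<psi> (min (i + j) n))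
       - 2 * (\<Sum>i=1..n. \<Sum>j=1..n. k i j * c i * c j * \<psi> i)"
    using swap by (simp add: right_diff_distrib sum_subtractf)
  have "euler_step n h k d f r c l * \<psi> l = c l * \<psi> l + h * (
      1/2 * ((\<Sum>i=1..n. \<Sum>j=1..n. if min (i + j) n = l then k i j * c i * c j else 0) * \<psi> l)
      - c l * (\<Sum>j=1..n. k l j * c j) * \<psi> l - c l * d l * \<psi> l + (\<Sum>i=1..n. c i * f i l) * \<psi> l + r l * \<psi> l)" for l
    unfolding euler_step_def by (simp only: ring_distribs mult_ac)
  then have "(\<Sum>l=1..n. euler_step n h k d f r c l * \<psi> l) = (\<Sum>l=1..n. c l * \<psi> l) + h * (
      1/2 * (\<Sum>l=1..n. (\<Sum>i=1..n. \<Sum>j=1..n. if min (i + j) n = l then k i j * c i * c j else 0) * \<psi> l)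
      - (\<Sum>l=1..n. c l * (\<Sum>j=1..n. k l j * c j) * \<psi> l) - (\<Sum>l=1..n. c l * d l * \<psi> l)
      + (\<Sum>l=1..n. (\<Sum>i=1..n. c i * f i l) * \<psi> l) + (\<Sum>l=1..n. r l * \<psi> l))"
    by (simp only: sum.distrib sum_subtractf sum_distrib_left[symmetric])
  then show ?thesis unfolding gain loss frag coag by simp
qed

text \<open>All losses are proportional to \<open>c l\<close> itself, so an explicit step keeps the
  sign once the time step times the loss rate is at most 1.\<close>

lemma euler_step_nonneg:
  assumes "0 \<le> h" "\<And>i. i \<in> {1..n} \<Longrightarrow> 0 \<le> c i" "\<And>i j. i \<in> {1..n} \<Longrightarrow> j \<in> {1..n} \<Longrightarrow> 0 \<le> k i j"
    "\<And>i. i \<in> {1..n} \<Longrightarrow> 0 \<le> f i l" "0 \<le> r l" "l \<in> {1..n}"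
    "h * ((\<Sum>j=1..n. k l j * c j) + d l) \<le> 1"
  shows "0 \<le> euler_step n h k d f r c l"
proof -
  have "c l * (h * ((\<Sum>j=1..n. k l j * c j) + d l)) \<le> c l * 1"
    using assms by (intro mult_left_mono) auto
  moreover have "0 \<le> h * (1/2 * (\<Sum>i=1..n. \<Sum>j=1..n. if min (i + j) n = l then k i j * c i * c j else 0)
     + (\<Sum>i=1..n. c i * f i l) + r l)"
    using assms by (intro mult_nonneg_nonneg add_nonneg_nonneg sum_nonneg) auto
  moreover have "euler_step n h k d f r c l = (c l - c l * (h * ((\<Sum>j=1..n. k l j * c j) + d l)))
     + h * (1/2 * (\<Sum>i=1..n. \<Sum>j=1..n. if min (i + j) n = l then k i j * c i * c j else 0)
     + (\<Sum>i=1..n. c i * f i l) + r l)"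
    unfolding euler_step_def by (simp only: ring_distribs mult_ac)
  ultimately show ?thesis by linarith
qed

context bvcf
begin

definition "node n l = real l / real n"

lemma node: "l \<in> {1..n} \<Longrightarrow> node n l \<in> {0<..1}" "l \<in> {1..n} \<Longrightarrow> 1 / real n \<le> node n l"
  by (auto simp: node_def field_simps)

text \<open>\<open>\<mu>in\<close> lives on the trace sigma-algebra of (0,1]; its image on the line
  can be evaluated on grid cells and paired with functions defined on the line.\<close>

definition "\<mu>0 = distr \<mu>in borel (\<lambda>x. x)"

lemma \<mu>in_sets: "sets \<mu>in = sets (restrict_space borel {0<..1})" and \<mu>in_finite: "finite_measure \<mu>in"
  using \<mu>in by (auto simp: finite_measures_def)

lemma \<mu>in_space: "space \<mu>in = {0<..1}"
  using sets_eq_imp_space_eq[OF \<mu>in_sets] by (simp add: space_restrict_space)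

lemma id_measurable_\<mu>in: "(\<lambda>x. x) \<in> \<mu>in \<rightarrow>\<^sub>M borel"
  unfolding measurable_cong_sets[OF \<mu>in_sets refl] by (intro measurable_restrict_space1) simp

lemma \<mu>0_sets [simp, measurable_cong]: "sets \<mu>0 = sets borel" by (simp add: \<mu>0_def)

lemma \<mu>0_finite: "finite_measure \<mu>0"
  unfolding \<mu>0_def using \<mu>in_finite by (intro finite_measure.finite_measure_distr id_measurable_\<mu>in)

lemma AE_\<mu>0: "AE x in \<mu>0. x \<in> {0<..1}"
  unfolding \<mu>0_def by (subst AE_distr_iff[OF id_measurable_\<mu>in]) (use AE_space in \<open>auto simp: \<mu>in_space\<close>)

lemma integral_\<mu>0: "(f :: real \<Rightarrow> real) \<in> borel_measurable borel \<Longrightarrow> integral\<^sup>L \<mu>0 f = integral\<^sup>L \<mu>in f"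
  using integral_distr[OF id_measurable_\<mu>in, of f] by (simp add: \<mu>0_def)

definition "m0 = measure \<mu>0 UNIV"

text \<open>The factor 1 stands for the constant test function, so that
  \<open>fragint_integrable\<close>, stated for a general test function, applies verbatim.\<close>

definition "frag_weight n i l = (\<integral>y. indicator (cell n l) y * (indicator {0<..<node n i} y * (F (node n i - y) y * 1)) \<partial>lborel)"
definition "source_weight n w l = (\<integral>x. indicator (cell n l) x * (indicator {0<..1} x * bint \<kappa>F w x) \<partial>lborel)"

primrec state :: "nat \<Rightarrow> real \<Rightarrow> nat \<Rightarrow> nat \<Rightarrow> real" where
  "state n h 0 = (\<lambda>l. measure \<mu>0 (cell n l))"
| "state n h (Suc k) = euler_step n h (\<lambda>i j. K (node n i) (node n j))
     (\<lambda>l. bint K (trunc n (real k * h)) (node n l) + frag_rate (node n l))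
     (frag_weight n) (source_weight n (trunc n (real k * h))) (state n h k)"

definition pairing :: "nat \<Rightarrow> (nat \<Rightarrow> real) \<Rightarrow> (real \<Rightarrow> real) \<Rightarrow> real"
  where "pairing n c \<phi> = (\<Sum>l=1..n. c l * \<phi> (node n l))"

definition "coag_sum n c \<phi> = (\<Sum>i=1..n. \<Sum>j=1..n. c i * c j * (K (node n i) (node n j) * coag_op \<phi> (node n i) (node n j)))"
definition "source_term n w \<phi> = (\<integral>x. indicator {0<..1} x * (bint \<kappa>F w x * \<phi> (round_up n x)) \<partial>lborel)"

text \<open>Rate of change of a pairing under one Euler step, in the shape of
  \<open>weak_rhs\<close>. Rounding enters only in the two gain terms, where particles appear at
  sizes off the grid.\<close>

definition "rate n w c \<phi> = 1/2 * coag_sum n c \<phi>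
   - pairing n c (\<lambda>x. (bint K w x + frag_rate x) * \<phi> x)
   + pairing n c (fragint (\<lambda>y. \<phi> (round_up n y)))
   + source_term n w \<phi>"

lemma bint_K: "bint \<kappa>K w x = x * bint K w x"
  unfolding bint_def \<kappa>K_def by (subst integral_mult_right_zero[symmetric]) (simp add: mult_ac)

lemma bint_K_nonneg: "weight w \<Longrightarrow> x \<in> {0<..1} \<Longrightarrow> 0 \<le> bint K w x"
  unfolding bint_def
proof (rule Bochner_Integration.integral_nonneg)
  fix y assume "weight w" "x \<in> {0<..1}"
  then show "0 \<le> K x y * w y" using K_nonneg[of x y] by (cases "1 < y") (auto simp: weight_def not_less)
qed

lemma bint_F_nonneg: "weight w \<Longrightarrow> x \<in> {0<..1} \<Longrightarrow> 0 \<le> bint \<kappa>F w x"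
  unfolding bint_def \<kappa>F_def
proof (rule Bochner_Integration.integral_nonneg)
  fix y assume "weight w" "x \<in> {0<..1}"
  then show "0 \<le> F (y - x) x * w y"
    using F_nonneg[of "y-x" x] by (cases "1 < y") (auto simp: weight_def not_less)
qed

lemma bint_K_le:
  assumes "weight w" "x \<in> {0<..1}" shows "x * bint K w x \<le> 4 * K0 * wnorm w"
  using bint_bound[OF bdry_kernel_K assms] by (simp add: bint_K)

lemma bint_F_integrable:
  assumes "weight w" shows "integrable lborel (\<lambda>x. indicator {0<..1} x * bint \<kappa>F w x)"
proof (rule Bochner_Integration.integrable_bound)
  show "integrable lborel (\<lambda>x. indicator {0<..1::real} x * (2 * F0 * wnorm w))"
    by (intro integrable_mult_left integrable_real_indicator) auto
  show "(\<lambda>x. indicator {0<..1} x * bint \<kappa>F w x) \<in> borel_measurable lborel"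
    using borel_measurable_continuous_on_indicator[OF _ bint_cont[OF bdry_kernel_F assms]] by simp
  show "AE x in lborel. norm (indicator {0<..1} x * bint \<kappa>F w x) \<le> norm (indicator {0<..1::real} x * (2 * F0 * wnorm w))"
  proof (rule AE_I2)
    fix x
    show "norm (indicator {0<..1} x * bint \<kappa>F w x) \<le> norm (indicator {0<..1::real} x * (2 * F0 * wnorm w))"
      using bint_bound[OF bdry_kernel_F assms, of x] by (cases "x \<in> {0<..1}") auto
  qed
qed

lemma state_step:
  assumes n: "1 \<le> n" and h: "0 \<le> h"
  shows "pairing n (state n h (Suc k)) \<phi> = pairing n (state n h k) \<phi>
    + h * rate n (trunc n (real k * h)) (state n h k) \<phi>"
proof -
  have w: "weight (trunc n (real k * h))" using h by (intro trunc_weight) auto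
  have frag: "(\<Sum>l=1..n. frag_weight n i l * \<phi> (node n l)) = fragint (\<lambda>y. \<phi> (round_up n y)) (node n i)"
    if i: "i \<in> {1..n}" for i
  proof -
    have "(\<Sum>l=1..n. frag_weight n i l * \<phi> (node n l))
      = (\<integral>y. indicator {0<..1} y * ((indicator {0<..<node n i} y * (F (node n i - y) y * 1)) * \<phi> (node n (cell_index n y))) \<partial>lborel)"
      unfolding frag_weight_def
      by (intro cell_sum[OF n] fragint_integrable[where B=1] node(1)[OF i]) auto
    also have "\<dots> = fragint (\<lambda>y. \<phi> (round_up n y)) (node n i)"
      unfolding fragint_def using node(1)[OF i]
      by (intro Bochner_Integration.integral_cong refl) (auto simp: indicator_def node_def round_up_def)
    finally show ?thesis .
  qed
  have source: "(\<Sum>l=1..n. source_weight n (trunc n (real k * h)) l * \<phi> (node n l)) = source_term n (trunc n (real k * h)) \<phi>"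
  proof -
    have "(\<Sum>l=1..n. source_weight n (trunc n (real k * h)) l * \<phi> (node n l))
      = (\<integral>x. indicator {0<..1} x * ((indicator {0<..1} x * bint \<kappa>F (trunc n (real k * h)) x) * \<phi> (node n (cell_index n x))) \<partial>lborel)"
      unfolding source_weight_def
      by (intro cell_sum[OF n] bint_F_integrable w) auto
    also have "\<dots> = source_term n (trunc n (real k * h)) \<phi>"
      unfolding source_term_def
      by (intro Bochner_Integration.integral_cong refl) (auto simp: indicator_def node_def round_up_def)
    finally show ?thesis .
  qed
  \<comment> \<open>Cutting the index at \<open>n\<close> amounts to reading the test function at 1,
    as \<open>extend_const\<close> does.\<close>
  have coag: "\<phi> (node n (min (i + j) n)) - \<phi> (node n i) - \<phi> (node n j) = coag_op \<phi> (node n i) (node n j)"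
    if "i \<in> {1..n}" "j \<in> {1..n}" for i j
    using n by (auto simp: coag_op_def extend_const_def node_def min_def add_divide_distrib[symmetric])
  let ?c = "state n h k" and ?w = "trunc n (real k * h)"
  have A: "(\<Sum>i=1..n. \<Sum>j=1..n. K (node n i) (node n j) * ?c i * ?c j *
      (\<phi> (node n (min (i + j) n)) - \<phi> (node n i) - \<phi> (node n j))) = coag_sum n ?c \<phi>"
    unfolding coag_sum_def by (intro sum.cong refl, subst coag) (auto simp: mult_ac)
  have B: "(\<Sum>i=1..n. ?c i * (\<Sum>l=1..n. frag_weight n i l * \<phi> (node n l)))
      = pairing n ?c (fragint (\<lambda>y. \<phi> (round_up n y)))"
    unfolding pairing_def by (intro sum.cong refl, subst frag) auto
  have C: "(\<Sum>l=1..n. ?c l * (bint K ?w (node n l) + frag_rate (node n l)) * \<phi> (node n l))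
      = pairing n ?c (\<lambda>x. (bint K ?w x + frag_rate x) * \<phi> x)"
    unfolding pairing_def by (simp add: mult_ac)
  have sym: "K (node n i) (node n j) = K (node n j) (node n i)" if "i \<in> {1..n}" "j \<in> {1..n}" for i j
    using node(1)[OF that(1)] node(1)[OF that(2)] by (intro K_sym) auto
  have "pairing n (state n h (Suc k)) \<phi> = (\<Sum>l=1..n. ?c l * \<phi> (node n l)) + h * (
     1/2 * coag_sum n ?c \<phi> - pairing n ?c (\<lambda>x. (bint K ?w x + frag_rate x) * \<phi> x)
     + pairing n ?c (fragint (\<lambda>y. \<phi> (round_up n y))) + source_term n ?w \<phi>)"
    using euler_step_sum[where \<psi>="\<lambda>l. \<phi> (node n l)" and k="\<lambda>i j. K (node n i) (node n j)", OF sym]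
    unfolding pairing_def[of n "state n h (Suc k)"]
    unfolding state.simps A[symmetric] B[symmetric] C[symmetric] source[symmetric]
    by blast
  then show ?thesis by (simp only: rate_def pairing_def[of n ?c \<phi>])
qed

end

section \<open>A priori bounds\<close>

text \<open>The Heine-Cantor theorem, by a Lebesgue number. The distance between two values of a
  path enters only through the real function \<open>d\<close>, hence the axioms of a pseudometric as
  hypotheses.\<close>

lemma pseudometric_uniform:
  fixes d :: "real \<Rightarrow> real \<Rightarrow> real"
  assumes S: "compact S" and e: "0 < e"
    and cont: "\<And>t. t \<in> S \<Longrightarrow> ((\<lambda>s. d s t) \<longlongrightarrow> 0) (at t within S)"
    and zero: "\<And>t. t \<in> S \<Longrightarrow> d t t = 0"
    and sym: "\<And>s t. s \<in> S \<Longrightarrow> t \<in> S \<Longrightarrow> d s t = d t s"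
    and tri: "\<And>s t u. s \<in> S \<Longrightarrow> t \<in> S \<Longrightarrow> u \<in> S \<Longrightarrow> d s u \<le> d s t + d t u"
  shows "\<exists>\<delta>>0. \<forall>s\<in>S. \<forall>t\<in>S. \<bar>s - t\<bar> < \<delta> \<longrightarrow> d s t < e"
proof -
  have "\<exists>r>0. \<forall>s\<in>S. dist s t < r \<longrightarrow> d s t < e / 2" if t: "t \<in> S" for t
  proof -
    have "\<forall>\<^sub>F s in at t within S. d s t < e / 2"
      using order_tendstoD(2)[OF cont[OF t], of "e / 2"] e by simp
    then obtain r where "r > 0" "\<And>s. s \<in> S \<Longrightarrow> s \<noteq> t \<Longrightarrow> dist s t < r \<Longrightarrow> d s t < e / 2"
      unfolding eventually_at by blast
    then have "\<forall>s\<in>S. dist s t < r \<longrightarrow> d s t < e / 2" using zero[OF t] e by (metis half_gt_zero)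
    with \<open>r > 0\<close> show ?thesis by blast
  qed
  then obtain r where r: "\<And>t. t \<in> S \<Longrightarrow> 0 < r t"
      "\<And>t s. t \<in> S \<Longrightarrow> s \<in> S \<Longrightarrow> dist s t < r t \<Longrightarrow> d s t < e / 2"
    by metis
  have "S \<subseteq> \<Union> ((\<lambda>t. ball t (r t)) ` S)" using r(1) by force
  then obtain \<delta> where \<delta>: "\<delta> > 0" "\<And>x. x \<in> S \<Longrightarrow> \<exists>G\<in>(\<lambda>t. ball t (r t)) ` S. ball x \<delta> \<subseteq> G"
    using Heine_Borel_lemma[OF S, of "(\<lambda>t. ball t (r t)) ` S"] by (metis imageE open_ball)
  show ?thesis
  proof (intro exI[of _ \<delta>] conjI ballI impI)
    fix s t assume s: "s \<in> S" and t: "t \<in> S" and st: "\<bar>s - t\<bar> < \<delta>"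
    obtain u where u: "u \<in> S" "ball s \<delta> \<subseteq> ball u (r u)" using \<delta>(2)[OF s] by auto
    have "s \<in> ball s \<delta>" "t \<in> ball s \<delta>" using \<delta>(1) st by (auto simp: dist_real_def)
    with u(2) have "s \<in> ball u (r u)" "t \<in> ball u (r u)" by blast+
    then have "dist s u < r u" "dist t u < r u" by (simp_all add: dist_commute)
    then have "d s u < e / 2" "d t u < e / 2" using r(2) u s t by auto
    then show "d s t < e" using tri[OF s u(1) t] sym[OF t u(1)] by simp
  qed (rule \<delta>)
qed

context bvcf
begin

section \<open>Uniform continuity of the boundary datum in time\<close>

definition "gdist s t = (\<integral>y. indicator {1<..} y * \<bar>g s y - g t y\<bar> \<partial>lborel)"

lemma gdist_integrable:
  assumes "0 \<le> s" "0 \<le> t"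
  shows "integrable lborel (\<lambda>y. indicator {1<..} y * \<bar>g s y - g t y\<bar>)"
proof -
  have "set_integrable lborel {1<..} (\<lambda>y. \<bar>g s y - g t y\<bar>)"
    using datum assms unfolding boundary_datum_def by (intro set_integrable_abs set_integral_diff) auto
  then show ?thesis by (simp add: set_integrable_def)
qed

lemma gdist_zero: "gdist t t = 0" and gdist_sym: "gdist s t = gdist t s"
  by (simp_all add: gdist_def abs_minus_commute)

lemma gdist_triangle:
  assumes "0 \<le> s" "0 \<le> t" "0 \<le> u" shows "gdist s u \<le> gdist s t + gdist t u"
proof -
  have "gdist s u \<le> (\<integral>y. indicator {1<..} y * \<bar>g s y - g t y\<bar> + indicator {1<..} y * \<bar>g t y - g u y\<bar> \<partial>lborel)"
    unfolding gdist_def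
  proof (rule integral_mono)
    fix y
    have "\<bar>g s y - g u y\<bar> \<le> \<bar>g s y - g t y\<bar> + \<bar>g t y - g u y\<bar>" by linarith
    then show "indicator {1<..} y * \<bar>g s y - g u y\<bar>
      \<le> indicator {1<..} y * \<bar>g s y - g t y\<bar> + indicator {1<..} y * \<bar>g t y - g u y\<bar>"
      by (cases "1 < y") auto
  qed (intro gdist_integrable Bochner_Integration.integrable_add assms)+
  also have "\<dots> = gdist s t + gdist t u"
    unfolding gdist_def by (intro Bochner_Integration.integral_add gdist_integrable assms)
  finally show ?thesis .
qed

lemma gdist_uniform:
  assumes "0 < e"
  shows "\<exists>\<delta>>0. \<forall>s\<in>{0..T}. \<forall>t\<in>{0..T}. \<bar>s - t\<bar> < \<delta> \<longrightarrow> gdist s t < e"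
proof (rule pseudometric_uniform[OF _ assms])
  fix t assume "t \<in> {0..T}"
  then have "((\<lambda>s. gdist s t) \<longlongrightarrow> 0) (at t within {0..})"
    using datum by (simp add: boundary_datum_def gdist_def set_lebesgue_integral_def)
  then show "((\<lambda>s. gdist s t) \<longlongrightarrow> 0) (at t within {0..T})"
    by (rule tendsto_within_subset) auto
qed (auto intro: gdist_zero gdist_sym gdist_triangle)

text \<open>Gronwall bound for the inequality m' <= F0 m + 2 F0 M behind \<open>rate_mass\<close>,
  in a form that also survives the explicit Euler step. The summand 1 keeps it at least 1, since it
  later serves as a divisor.\<close>

definition "mass_bound t = exp (F0 * t) * (m0 + 2 * F0 * M * t) + 1"

lemma m0_nonneg: "0 \<le> m0" by (simp add: m0_def)

lemma mass_bound_mono: "0 \<le> s \<Longrightarrow> s \<le> t \<Longrightarrow> mass_bound s \<le> mass_bound t"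
  unfolding mass_bound_def using F0 M_nonneg m0_nonneg
  by (intro add_mono mult_mono) (auto intro!: mult_left_mono mult_nonneg_nonneg)

lemma mass_bound_ge: "0 \<le> t \<Longrightarrow> 1 \<le> mass_bound t"
  unfolding mass_bound_def using F0 M_nonneg m0_nonneg by auto

lemma mass_bound_cont: "continuous_on UNIV mass_bound"
  unfolding mass_bound_def by (intro continuous_intros)

text \<open>
  The third condition keeps the Euler step nonnegative up to time \<open>n\<close>; the last one makes the
  modulus of continuity of \<open>g\<close> absorb the weight \<open>y\<^sup>\<beta> \<le> n\<close> on the support of \<^term>\<open>trunc n s\<close>.
\<close>

definition "step_ok n h \<longleftrightarrow> 0 < h \<and> h \<le> 1 / real n \<and>
  h * (4 * K0 * real n * (mass_bound (real n) + M) + F0) \<le> 1 \<and>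
  (\<forall>s\<in>{0..real n}. \<forall>t\<in>{0..real n}. \<bar>s - t\<bar> \<le> h \<longrightarrow> real n * gdist s t \<le> 1 / real n)"

lemma step_ok_exists:
  assumes n: "1 \<le> n" shows "\<exists>h. step_ok n h"
proof -
  \<comment> \<open>The square leaves 1/n after multiplication by the factor \<open>n\<close> in
    \<open>step_ok\<close>.\<close>
  obtain \<delta> where \<delta>: "\<delta> > 0"
    "\<And>s t. s\<in>{0..real n} \<Longrightarrow> t\<in>{0..real n} \<Longrightarrow> \<bar>s - t\<bar> < \<delta> \<Longrightarrow> gdist s t < 1 / (real n * real n)"
    using gdist_uniform[of "1 / (real n * real n)" "real n"] n by auto
  define C where "C = 4 * K0 * real n * (mass_bound (real n) + M) + F0"
  have C: "0 \<le> C" unfolding C_def using K0 F0 M_nonneg mass_bound_ge[of "real n"] by auto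
  \<comment> \<open>\<open>C + 1\<close> instead of \<open>C\<close> avoids a division by zero when
    \<open>K0\<close> and \<open>F0\<close> both vanish.\<close>
  define h where "h = min (1 / real n) (min (1 / (C + 1)) (\<delta> / 2))"
  have h: "0 < h" "h \<le> 1 / real n" "h \<le> 1 / (C + 1)" "h < \<delta>"
    using n C \<delta>(1) by (auto simp: h_def)
  have "h * C \<le> 1 / (C + 1) * (C + 1)" using h C by (intro mult_mono) auto
  then have hC: "h * C \<le> 1" using C by simp
  have "real n * gdist s t \<le> 1 / real n" if "s \<in> {0..real n}" "t \<in> {0..real n}" "\<bar>s - t\<bar> \<le> h" for s t
  proof -
    have "real n * gdist s t \<le> real n * (1 / (real n * real n))"
      using \<delta>(2)[OF that(1,2)] that(3) h(4) by (intro mult_left_mono) auto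
    then show ?thesis using n by simp
  qed
  with h hC show ?thesis unfolding step_ok_def C_def by blast
qed

definition "time_step n = (SOME h. step_ok n h)"

lemma step_ok_time_step: "1 \<le> n \<Longrightarrow> step_ok n (time_step n)"
  unfolding time_step_def by (rule someI_ex) (rule step_ok_exists)

lemma time_step: assumes "1 \<le> n" shows "0 < time_step n" "time_step n \<le> 1 / real n"
  using step_ok_time_step[OF assms] by (auto simp: step_ok_def)

abbreviation "mass n c \<equiv> (\<Sum>l=1..n. c l)"

section \<open>Estimates of the discrete rate\<close>

lemma pairing_bound:
  assumes "\<And>l. l \<in> {1..n} \<Longrightarrow> 0 \<le> c l" "\<And>x. x \<in> {0<..1} \<Longrightarrow> \<bar>f x\<bar> \<le> B"
  shows "\<bar>pairing n c f\<bar> \<le> B * mass n c"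
proof -
  have "\<bar>pairing n c f\<bar> \<le> (\<Sum>l=1..n. \<bar>c l * f (node n l)\<bar>)" unfolding pairing_def by (rule sum_abs)
  also have "\<dots> \<le> (\<Sum>l=1..n. B * c l)"
  proof (rule sum_mono)
    fix l assume l: "l \<in> {1..n}"
    show "\<bar>c l * f (node n l)\<bar> \<le> B * c l"
      using assms(1)[OF l] assms(2)[OF node(1)[OF l]] by (simp add: abs_mult mult_mono mult.commute[of B])
  qed
  finally show ?thesis by (simp add: sum_distrib_left)
qed

lemma pairing_mono:
  assumes "\<And>l. l \<in> {1..n} \<Longrightarrow> 0 \<le> c l" "\<And>x. x \<in> {0<..1} \<Longrightarrow> f x \<le> f' x"
  shows "pairing n c f \<le> pairing n c f'"
  unfolding pairing_def using assms node(1) by (intro sum_mono mult_left_mono) auto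

lemma pairing_const: "pairing n c (\<lambda>_. B) = B * mass n c"
  by (simp add: pairing_def sum_distrib_left mult.commute)

lemma pairing_diff: "pairing n c (\<lambda>x. f x - f' x) = pairing n c f - pairing n c f'"
  by (simp add: pairing_def sum_subtractf algebra_simps)

lemma coag_sum_bound:
  assumes c: "\<And>l. l \<in> {1..n} \<Longrightarrow> 0 \<le> c l"
    and B: "\<And>x y. x \<in> {0<..1} \<Longrightarrow> y \<in> {0<..1} \<Longrightarrow> \<bar>K x y * coag_op \<phi> x y\<bar> \<le> B"
  shows "\<bar>coag_sum n c \<phi>\<bar> \<le> B * (mass n c)\<^sup>2"
proof -
  have "\<bar>coag_sum n c \<phi>\<bar> \<le> (\<Sum>i=1..n. \<Sum>j=1..n. \<bar>c i * c j * (K (node n i) (node n j) * coag_op \<phi> (node n i) (node n j))\<bar>)"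
    unfolding coag_sum_def by (rule order_trans[OF sum_abs]) (intro sum_mono sum_abs)
  also have "\<dots> \<le> (\<Sum>i=1..n. \<Sum>j=1..n. c i * c j * B)"
  proof (intro sum_mono)
    fix i j assume "i \<in> {1..n}" "j \<in> {1..n}"
    then show "\<bar>c i * c j * (K (node n i) (node n j) * coag_op \<phi> (node n i) (node n j))\<bar> \<le> c i * c j * B"
      using c B[OF node(1) node(1)] by (simp only: abs_mult[of "c i * c j"]) (intro mult_mono, auto)
  qed
  also have "\<dots> = B * (mass n c)\<^sup>2"
    by (simp add: power2_eq_square sum_product sum_distrib_left mult_ac)
  finally show ?thesis .
qed

lemma coag_sum_nonpos:
  assumes "\<And>l. l \<in> {1..n} \<Longrightarrow> 0 \<le> c l"
    and "\<And>x y. x \<in> {0<..1} \<Longrightarrow> y \<in> {0<..1} \<Longrightarrow> coag_op \<phi> x y \<le> 0"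
  shows "coag_sum n c \<phi> \<le> 0"
  unfolding coag_sum_def
proof (intro sum_nonpos mult_nonneg_nonpos)
  fix i j assume "i \<in> {1..n}" "j \<in> {1..n}"
  then show "0 \<le> c i * c j" "0 \<le> K (node n i) (node n j)" "coag_op \<phi> (node n i) (node n j) \<le> 0"
    using assms node(1)[of i n] node(1)[of j n] K_nonneg by auto
qed

text \<open>The set \<open>A\<close> localises the source: all of (0,1] for the mass and Lipschitz
  estimates, \<open>{0<..e}\<close> for the estimate of small particles, where the length of
  \<open>A\<close> provides the smallness.\<close>

lemma source_term_bound:
  assumes w: "weight w" "wnorm w \<le> M" and \<phi>: "\<phi> \<in> borel_measurable borel"
    and A: "A \<in> sets borel" "A \<subseteq> {0<..1}"
    and B: "\<And>x. x \<in> {0<..1} \<Longrightarrow> \<bar>\<phi> (round_up n x)\<bar> \<le> B * indicator A x"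
  shows "\<bar>source_term n w \<phi>\<bar> \<le> 2 * F0 * M * B * measure lborel A"
proof -
  have fA: "emeasure lborel A < \<infinity>"
    using emeasure_mono[OF A(2), of lborel] by (auto intro: le_less_trans)
  note \<phi>[measurable]
  have m: "(\<lambda>x. indicator {0<..1} x * bint \<kappa>F w x) \<in> borel_measurable borel"
    using borel_measurable_integrable[OF bint_F_integrable[OF w(1)]] by simp
  have m2: "(\<lambda>x. (indicator {0<..1} x * bint \<kappa>F w x) * \<phi> (round_up n x)) \<in> borel_measurable borel"
    by (intro borel_measurable_times[OF m]) measurable
  have pt: "norm (indicator {0<..1} x * (bint \<kappa>F w x * \<phi> (round_up n x))) \<le> indicator A x * (2 * F0 * M * B)" for x
  proof (cases "x \<in> {0<..1}")
    case True
    have "\<bar>bint \<kappa>F w x\<bar> \<le> 2 * F0 * M"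
      using bint_bound[OF bdry_kernel_F w(1) True] mult_left_mono[OF w(2), of "2 * F0"] F0 by simp
    then have "\<bar>bint \<kappa>F w x\<bar> * \<bar>\<phi> (round_up n x)\<bar> \<le> (2 * F0 * M) * (B * indicator A x)"
      using B[OF True] F0 M_nonneg by (intro mult_mono) auto
    then show ?thesis using True by (simp add: abs_mult mult_ac)
  next
    case False
    then have "x \<notin> A" using A(2) by blast
    with False show ?thesis by simp
  qed
  have i2: "integrable lborel (\<lambda>x. indicator A x * (2 * F0 * M * B))"
    by (intro integrable_mult_left integrable_real_indicator) (use A fA in auto)
  have i1: "integrable lborel (\<lambda>x. indicator {0<..1} x * (bint \<kappa>F w x * \<phi> (round_up n x)))"
  proof (rule Bochner_Integration.integrable_bound[OF i2])
    show "AE x in lborel. norm (indicator {0<..1} x * (bint \<kappa>F w x * \<phi> (round_up n x))) \<le> norm (indicator A x * (2 * F0 * M * B))"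
      by (rule AE_I2, rule order_trans[OF pt]) (simp only: real_norm_def abs_ge_self)
  qed (use m2 in \<open>simp add: mult.assoc\<close>)
  have "norm (source_term n w \<phi>) \<le> (\<integral>x. indicator A x * (2 * F0 * M * B) \<partial>lborel)"
    unfolding source_term_def
    by (rule Bochner_Integration.integral_norm_bound_integral[OF i1 i2]) (rule pt)
  then show ?thesis using A by (simp add: mult_ac)
qed

lemma fragint_round_bound:
  assumes x: "x \<in> {0<..1}" and \<phi>: "\<phi> \<in> borel_measurable borel" and n: "1 \<le> n"
    and B: "\<And>y. y \<in> {0<..1} \<Longrightarrow> \<bar>\<phi> y\<bar> \<le> B"
  shows "\<bar>fragint (\<lambda>y. \<phi> (round_up n y)) x\<bar> \<le> 2 * F0 * B"
proof (rule fragint_bound[OF x])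
  show "\<bar>\<phi> (round_up n y)\<bar> \<le> B" if "y \<in> {0<..1}" for y
    using B[OF round_up(1)[OF n that]] .
  show "(\<lambda>y. \<phi> (round_up n y)) \<in> borel_measurable borel" using \<phi> by measurable
qed

text \<open>Rounding goes up, so a rounded size at most \<open>e\<close> forces the original size to
  be at most \<open>e\<close>; fragments are produced with density at most 2 F0 there. Rounding down
  would move the first cell to 0.\<close>

lemma fragint_indicator_bound:
  assumes x: "x \<in> {0<..1}" and n: "1 \<le> n" and e: "0 \<le> e"
  shows "fragint (\<lambda>y. indicator {..e} (round_up n y)) x \<le> 2 * F0 * e"
proof -
  have i: "integrable lborel (\<lambda>y. indicator {0<..e} y * (2 * F0))"
    by (intro integrable_mult_left integrable_real_indicator) (use e in simp_all)
  have "fragint (\<lambda>y. indicator {..e} (round_up n y)) x \<le> (\<integral>y. indicator {0<..e} y * (2 * F0) \<partial>lborel)"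
    unfolding fragint_def
  proof (rule integral_mono[OF _ i])
    show "integrable lborel (\<lambda>y. indicator {0<..<x} y * (F (x - y) y * indicator {..e} (round_up n y)))"
      by (rule fragint_integrable[OF x, where B=1]) (auto simp: indicator_def)
    fix y
    show "indicator {0<..<x} y * (F (x - y) y * indicator {..e} (round_up n y)) \<le> indicator {0<..e} y * (2 * F0)"
    proof (cases "y \<in> {0<..<x} \<and> round_up n y \<le> e")
      case True
      then have "y \<le> e" using round_up(3)[OF n, of y] x by auto
      moreover have "F (x - y) y \<le> 2 * F0" using True x by (intro F_le_unit) auto
      ultimately show ?thesis using True by simp
    next
      case False
      then have "indicator {0<..<x} y * (F (x - y) y * indicator {..e} (round_up n y)) = 0"
        by (auto simp: indicator_def)
      also have "0 \<le> indicator {0<..e} y * (2 * F0)" using F0 by simp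
      finally show ?thesis .
    qed
  qed
  also have "\<dots> = 2 * F0 * e" using e by simp
  finally show ?thesis .
qed

text \<open>For a nonnegative test function with nonpositive bracket, coagulation inside (0,1] and
  with outer particles can only lower the pairing, so both singular terms are discarded.
  Fragmentation and the source remain.\<close>

lemma rate_upper:
  assumes n: "1 \<le> n" and w: "weight w" and c: "\<And>l. l \<in> {1..n} \<Longrightarrow> 0 \<le> c l"
    and \<phi>: "\<And>x. x \<in> {0<..1} \<Longrightarrow> 0 \<le> \<phi> x"
    and coag: "\<And>x y. x \<in> {0<..1} \<Longrightarrow> y \<in> {0<..1} \<Longrightarrow> coag_op \<phi> x y \<le> 0"
  shows "rate n w c \<phi> \<le> pairing n c (\<lambda>x. fragint (\<lambda>y. \<phi> (round_up n y)) x - frag_rate x * \<phi> x)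
     + source_term n w \<phi>"
proof -
  have "pairing n c (\<lambda>x. frag_rate x * \<phi> x) \<le> pairing n c (\<lambda>x. (bint K w x + frag_rate x) * \<phi> x)"
    using bint_K_nonneg[OF w] \<phi> by (intro pairing_mono[OF c]) (auto intro!: mult_right_mono)
  then show ?thesis
    using coag_sum_nonpos[of n c \<phi>, OF c coag] unfolding rate_def pairing_diff by linarith
qed

text \<open>A break-up raises the number of particles by one, because \<open>fragint\<close> of 1 is
  twice \<open>frag_rate\<close>; the net production per particle is therefore at most
  \<open>F0\<close>.\<close>

lemma rate_mass:
  assumes n: "1 \<le> n" and w: "weight w" "wnorm w \<le> M" and c: "\<And>l. l \<in> {1..n} \<Longrightarrow> 0 \<le> c l"
  shows "rate n w c (\<lambda>_. 1) \<le> F0 * mass n c + 2 * F0 * M"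
proof -
  have "rate n w c (\<lambda>_. 1) \<le> pairing n c (\<lambda>x. fragint (\<lambda>_. 1) x - frag_rate x * 1) + source_term n w (\<lambda>_. 1)"
    by (rule rate_upper[OF n w(1) c]) (auto simp: coag_op_def extend_const_def)
  also have "\<dots> \<le> pairing n c (\<lambda>_. F0) + 2 * F0 * M"
  proof (rule add_mono)
    show "pairing n c (\<lambda>x. fragint (\<lambda>_. 1) x - frag_rate x * 1) \<le> pairing n c (\<lambda>_. F0)"
    proof (rule pairing_mono[OF c])
      show "fragint (\<lambda>_. 1) x - frag_rate x * 1 \<le> F0" if "x \<in> {0<..1}" for x
        using frag_rate(2)[OF that] unfolding frag_rate_def by simp
    qed
    show "source_term n w (\<lambda>_. 1) \<le> 2 * F0 * M"
      using source_term_bound[OF w, of "\<lambda>_. 1" "{0<..1}" n 1] by simp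
  qed
  finally show ?thesis by (simp add: pairing_const)
qed

text \<open>Both mechanisms that create particles below \<open>e\<close>, break-up and the boundary
  source, have bounded density in the size variable, hence the factor \<open>e\<close>.\<close>

lemma rate_tail:
  assumes n: "1 \<le> n" and w: "weight w" "wnorm w \<le> M" and c: "\<And>l. l \<in> {1..n} \<Longrightarrow> 0 \<le> c l"
    and e: "0 \<le> e" "e \<le> 1"
  shows "rate n w c (indicator {..e}) \<le> 2 * F0 * (mass n c + M) * e"
proof -
  have "rate n w c (indicator {..e}) \<le> pairing n c (\<lambda>x. fragint (\<lambda>y. indicator {..e} (round_up n y)) x - frag_rate x * indicator {..e} x)
     + source_term n w (indicator {..e})"
  proof (rule rate_upper[OF n w(1) c])
    show "coag_op (indicator {..e}) x y \<le> 0" if "x \<in> {0<..1}" "y \<in> {0<..1}" for x y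
      using that by (auto simp: coag_op_def extend_const_def indicator_def)
  qed auto
  also have "\<dots> \<le> pairing n c (\<lambda>_. 2 * F0 * e) + 2 * F0 * M * 1 * measure lborel {0<..e}"
  proof (rule add_mono)
    show "pairing n c (\<lambda>x. fragint (\<lambda>y. indicator {..e} (round_up n y)) x - frag_rate x * indicator {..e} x)
       \<le> pairing n c (\<lambda>_. 2 * F0 * e)"
    proof (rule pairing_mono[OF c])
      fix x :: real assume x: "x \<in> {0<..1}"
      have "0 \<le> frag_rate x * indicator {..e} x" using frag_rate(1)[OF x] by simp
      then show "fragint (\<lambda>y. indicator {..e} (round_up n y)) x - frag_rate x * indicator {..e} x \<le> 2 * F0 * e"
        using fragint_indicator_bound[OF x n e(1)] by linarith
    qed
    have "\<bar>source_term n w (indicator {..e})\<bar> \<le> 2 * F0 * M * 1 * measure lborel {0<..e}"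
    proof (rule source_term_bound[OF w])
      show "\<bar>indicator {..e} (round_up n x)\<bar> \<le> (1::real) * indicator {0<..e} x" if "x \<in> {0<..1}" for x
        using round_up(3)[OF n that] that by (auto simp: indicator_def)
    qed (use e in auto)
    then show "source_term n w (indicator {..e}) \<le> 2 * F0 * M * 1 * measure lborel {0<..e}" by simp
  qed
  also have "\<dots> = 2 * F0 * (mass n c + M) * e" using e by (simp add: pairing_const algebra_simps)
  finally show ?thesis .
qed

lemma bint_K_test:
  assumes w: "weight w" "wnorm w \<le> M" and \<phi>: "test_fun L \<phi>" and x: "x \<in> {0<..1}"
  shows "\<bar>bint K w x * \<phi> x\<bar> \<le> 4 * K0 * M * L"
proof -
  note L = test_funD(1)[OF \<phi>]
  have "\<bar>bint K w x * \<phi> x\<bar> \<le> bint K w x * (L * x)"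
    using bint_K_nonneg[OF w(1) x] test_funD(5)[OF \<phi>, of x] x by (simp add: abs_mult mult_left_mono)
  also have "\<dots> = L * (x * bint K w x)" by simp
  also have "\<dots> \<le> L * (4 * K0 * M)"
    using bint_K_le[OF w(1) x] mult_left_mono[OF w(2), of "4 * K0"] K0 L by (intro mult_left_mono) auto
  finally show ?thesis by (simp add: mult_ac)
qed

text \<open>In the order of the terms: half of the coagulation bound 8 K0, the boundary coagulation
  4 K0 M, the fragmentation loss F0 together with the gain 2 F0, and the boundary source. Each is
  proportional to the Lipschitz constant, which is factored out.\<close>

definition "rate_bound m = 4 * K0 * m\<^sup>2 + (4 * K0 * M + 3 * F0) * m + 2 * F0 * M"

lemma rate_lipschitz:
  assumes n: "1 \<le> n" and w: "weight w" "wnorm w \<le> M" and c: "\<And>l. l \<in> {1..n} \<Longrightarrow> 0 \<le> c l"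
    and \<phi>: "test_fun L \<phi>"
  shows "\<bar>rate n w c \<phi>\<bar> \<le> L * rate_bound (mass n c)"
proof -
  note L = test_funD(1)[OF \<phi>]
  have 1: "\<bar>coag_sum n c \<phi>\<bar> \<le> 8 * K0 * L * (mass n c)\<^sup>2"
    by (rule coag_sum_bound[OF c K_coag_le[OF \<phi>]])
  have 2: "\<bar>pairing n c (\<lambda>x. (bint K w x + frag_rate x) * \<phi> x)\<bar> \<le> (4 * K0 * M * L + F0 * L) * mass n c"
  proof (rule pairing_bound[OF c])
    fix x :: real assume x: "x \<in> {0<..1}"
    have "\<bar>bint K w x * \<phi> x\<bar> \<le> 4 * K0 * M * L" by (rule bint_K_test[OF w \<phi> x])
    moreover have "\<bar>frag_rate x * \<phi> x\<bar> \<le> F0 * L"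
      using frag_rate[OF x] test_funD(6)[OF \<phi>, of x] by (simp add: abs_mult mult_mono)
    ultimately show "\<bar>(bint K w x + frag_rate x) * \<phi> x\<bar> \<le> 4 * K0 * M * L + F0 * L"
      unfolding distrib_right by linarith
  qed
  have 3: "\<bar>pairing n c (fragint (\<lambda>y. \<phi> (round_up n y)))\<bar> \<le> (2 * F0 * L) * mass n c"
    by (rule pairing_bound[OF c fragint_round_bound]) (use test_funD[OF \<phi>] n in auto)
  have 4: "\<bar>source_term n w \<phi>\<bar> \<le> 2 * F0 * M * L"
    using source_term_bound[OF w test_funD(8)[OF \<phi>], of "{0<..1}" n L] test_funD(6)[OF \<phi>] by simp
  have "\<bar>rate n w c \<phi>\<bar> \<le> 1/2 * (8 * K0 * L * (mass n c)\<^sup>2) + (4 * K0 * M * L + F0 * L) * mass n c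
     + (2 * F0 * L) * mass n c + 2 * F0 * M * L"
    unfolding rate_def using 1 2 3 4 by linarith
  also have "\<dots> = L * rate_bound (mass n c)" by (simp add: rate_bound_def algebra_simps)
  finally show ?thesis .
qed

text \<open>Nodes are at least 1/n, so on the grid the singularity costs at most a factor
  \<open>n\<close>; this is the origin of the \<open>n\<close> in the stability condition of
  \<open>step_ok\<close>.\<close>

lemma K_node_le:
  assumes "i \<in> {1..n}" "j \<in> {1..n}" shows "K (node n i) (node n j) \<le> 4 * K0 * real n"
proof -
  note a = node[OF assms(1)] and b = node[OF assms(2)]
  have n: "real n > 0" using assms by auto
  have "K (node n i) (node n j) * (1 / real n) \<le> K (node n i) (node n j) * min (node n i) (node n j)"
    using a b by (intro mult_left_mono K_nonneg) auto
  also have "\<dots> \<le> 4 * K0" using a b by (intro K_min_le)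
  finally show ?thesis using n by (simp add: field_simps)
qed

lemma bint_K_node_le:
  assumes "l \<in> {1..n}" "weight w" "wnorm w \<le> M" shows "bint K w (node n l) \<le> 4 * K0 * real n * M"
proof -
  note a = node[OF assms(1)]
  have n: "real n > 0" using assms(1) by auto
  have "1 / real n * bint K w (node n l) \<le> node n l * bint K w (node n l)"
    using a bint_K_nonneg[OF assms(2) a(1)] by (intro mult_right_mono) auto
  also have "\<dots> \<le> 4 * K0 * wnorm w" using a assms by (intro bint_K_le)
  also have "\<dots> \<le> 4 * K0 * M" using assms(3) K0 by (intro mult_left_mono) auto
  finally show ?thesis using n by (simp add: field_simps)
qed

lemma frag_weight_nonneg: "0 \<le> frag_weight n i l"
  unfolding frag_weight_def
proof (rule Bochner_Integration.integral_nonneg)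
  show "0 \<le> indicator (cell n l) y * (indicator {0<..<node n i} y * (F (node n i - y) y * 1))" for y
    using F_nonneg[of "node n i - y" y] by (auto simp: indicator_def)
qed

lemma source_weight_nonneg: "weight w \<Longrightarrow> 0 \<le> source_weight n w l"
  unfolding source_weight_def
proof (rule Bochner_Integration.integral_nonneg)
  show "weight w \<Longrightarrow> 0 \<le> indicator (cell n l) x * (indicator {0<..1} x * bint \<kappa>F w x)" for x
    using bint_F_nonneg[of w x] by (auto simp: indicator_def)
qed

lemma state_init:
  assumes n: "1 \<le> n"
  shows "pairing n (state n h 0) \<phi> = (\<integral>x. indicator {0<..1} x * \<phi> (round_up n x) \<partial>\<mu>0)"
proof -
  interpret \<mu>0: finite_measure \<mu>0 by (rule \<mu>0_finite)
  have "pairing n (state n h 0) \<phi> = (\<Sum>l=1..n. (\<integral>x. indicator (cell n l) x * 1 \<partial>\<mu>0) * \<phi> (node n l))"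
    by (simp add: pairing_def)
  also have "\<dots> = (\<integral>x. indicator {0<..1} x * (1 * \<phi> (node n (cell_index n x))) \<partial>\<mu>0)"
    by (rule cell_sum[OF n]) auto
  finally show ?thesis by (simp add: round_up_def node_def)
qed

text \<open>Both claims go through one induction: the mass bound limits the loss rate and so gives
  nonnegativity of the next state, while nonnegativity enters the rate estimate behind the next mass
  bound.\<close>

lemma state_bounds:
  assumes n: "1 \<le> n" and ok: "step_ok n h" and k: "real k * h \<le> real n"
  shows "\<forall>l\<in>{1..n}. 0 \<le> state n h k l"
    and "mass n (state n h k) + 1 \<le> mass_bound (real k * h)"
  using k
proof (induction k)
  case 0
  interpret \<mu>0: finite_measure \<mu>0 by (rule \<mu>0_finite)
  {
    case 1 show ?case by simp
  next
    case 2
    have "mass n (state n h 0) = (\<integral>x. indicator {0<..1} x \<partial>\<mu>0)"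
      using state_init[OF n, of h "\<lambda>_. 1"] unfolding pairing_const by simp
    also have "\<dots> \<le> m0" unfolding m0_def by (simp add: \<mu>0.finite_measure_mono)
    finally show ?case by (simp add: mass_bound_def)
  }
next
  case (Suc k)
  have h: "0 < h" "h * (4 * K0 * real n * (mass_bound (real n) + M) + F0) \<le> 1"
    using ok by (auto simp: step_ok_def)
  let ?c = "state n h k" and ?w = "trunc n (real k * h)"
  have w: "weight ?w" "wnorm ?w \<le> M" using h by (auto intro!: trunc_weight)
  {
    case 1
    then have kn: "real k * h \<le> real n" using h by (simp add: distrib_right)
    have c: "\<And>l. l \<in> {1..n} \<Longrightarrow> 0 \<le> ?c l" and m: "mass n ?c + 1 \<le> mass_bound (real k * h)"
      using Suc.IH kn by auto
    have m': "mass n ?c \<le> mass_bound (real n)" using m mass_bound_mono[of "real k * h" "real n"] kn h by simp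
    show ?case
    proof
      fix l assume l: "l \<in> {1..n}"
      show "0 \<le> state n h (Suc k) l"
        unfolding state.simps
      proof (rule euler_step_nonneg)
        show "0 \<le> K (node n i) (node n j)" if "i \<in> {1..n}" "j \<in> {1..n}" for i j
          using node(1)[OF that(1)] node(1)[OF that(2)] by (intro K_nonneg) auto
        have "(\<Sum>j=1..n. K (node n l) (node n j) * ?c j) \<le> (\<Sum>j=1..n. 4 * K0 * real n * ?c j)"
          using c K_node_le l by (intro sum_mono mult_right_mono) auto
        also have "\<dots> = 4 * K0 * real n * mass n ?c" by (simp add: sum_distrib_left)
        also have "\<dots> \<le> 4 * K0 * real n * mass_bound (real n)" using m' K0 by (intro mult_left_mono) auto
        finally have "(\<Sum>j=1..n. K (node n l) (node n j) * ?c j) + (bint K ?w (node n l) + frag_rate (node n l))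
          \<le> 4 * K0 * real n * (mass_bound (real n) + M) + F0"
          using bint_K_node_le[OF l w] frag_rate(2)[OF node(1)[OF l]] by (simp add: distrib_left)
        then show "h * ((\<Sum>j=1..n. K (node n l) (node n j) * ?c j) + (bint K ?w (node n l) + frag_rate (node n l))) \<le> 1"
          using h mult_left_mono[of _ _ h] by (meson less_imp_le order_trans)
      qed (use h c l w frag_weight_nonneg source_weight_nonneg in auto)
    qed
  next
    case 2
    then have kn: "real k * h \<le> real n" using h by (simp add: distrib_right)
    have c: "\<And>l. l \<in> {1..n} \<Longrightarrow> 0 \<le> ?c l" and m: "mass n ?c + 1 \<le> mass_bound (real k * h)"
      using Suc.IH kn by auto
    define t where "t = real k * h"
    have t: "0 \<le> t" using h by (simp add: t_def)
    define D where "D = m0 + 2 * F0 * M * t"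
    have D: "0 \<le> D" unfolding D_def using m0_nonneg F0 M_nonneg t by auto
    have m2: "mass n ?c \<le> exp (F0 * t) * D" using m by (simp add: mass_bound_def t_def D_def)
    have "mass n (state n h (Suc k)) = mass n ?c + h * rate n ?w ?c (\<lambda>_. 1)"
      using state_step[OF n, of h k "\<lambda>_. 1"] h unfolding pairing_const by simp
    also have "\<dots> \<le> mass n ?c + h * (F0 * mass n ?c + 2 * F0 * M)"
      using rate_mass[OF n w c] h by (intro add_left_mono mult_left_mono) auto
    also have "\<dots> = (1 + F0 * h) * mass n ?c + 2 * F0 * M * h" by (simp add: algebra_simps)
    \<comment> \<open>One step of a discrete Gronwall argument: 1 + F0 h is at most exp (F0 h), and
      the new source contribution is enlarged by a factor at least 1 so that a single exponential
      can be pulled out of both terms.\<close>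
    also have "\<dots> \<le> exp (F0 * h) * (exp (F0 * t) * D) + exp (F0 * (t + h)) * (2 * F0 * M * h)"
    proof (rule add_mono)
      show "(1 + F0 * h) * mass n ?c \<le> exp (F0 * h) * (exp (F0 * t) * D)"
        using m2 h F0 c by (intro mult_mono exp_ge_add_one_self sum_nonneg) auto
      have "1 * (2 * F0 * M * h) \<le> exp (F0 * (t + h)) * (2 * F0 * M * h)"
        using F0 M_nonneg h t by (intro mult_right_mono) auto
      then show "2 * F0 * M * h \<le> exp (F0 * (t + h)) * (2 * F0 * M * h)" by simp
    qed
    also have "\<dots> = exp (F0 * (t + h)) * (m0 + 2 * F0 * M * (t + h))"
      by (simp add: D_def exp_add algebra_simps)
    also have "t + h = real (Suc k) * h" by (simp add: t_def algebra_simps)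
    finally show ?case by (simp add: mass_bound_def)
  }
qed

text \<open>The initial tail carries no correction for the grid, because rounding up cannot move
  mass from above \<open>e\<close> into the tail; afterwards the tail grows at most linearly in
  time.\<close>

lemma state_tail:
  assumes n: "1 \<le> n" and ok: "step_ok n h" and T: "T \<le> real n" and e: "0 \<le> e" "e \<le> 1"
    and k: "real k * h \<le> T"
  shows "pairing n (state n h k) (indicator {..e}) \<le> measure \<mu>0 {0<..e} + 2 * F0 * (mass_bound T + M) * e * (real k * h)"
  using k
proof (induction k)
  case 0
  interpret \<mu>0: finite_measure \<mu>0 by (rule \<mu>0_finite)
  have "pairing n (state n h 0) (indicator {..e}) \<le> (\<integral>x. indicator {0<..e} x \<partial>\<mu>0)"
    unfolding state_init[OF n]
  proof (rule integral_mono)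
    fix x :: real
    show "indicator {0<..1} x * indicator {..e} (round_up n x) \<le> (indicator {0<..e} x :: real)"
      using round_up(3)[OF n, of x] by (auto simp: indicator_def)
    show "integrable \<mu>0 (\<lambda>x. indicator {0<..1} x * indicator {..e} (round_up n x) :: real)"
      by (rule \<mu>0.integrable_const_bound[where B=1]) (auto simp: indicator_def)
  qed (auto intro!: \<mu>0.integrable_const_bound[where B=1])
  then show ?case by simp
next
  case (Suc k)
  have h: "0 < h" using ok by (auto simp: step_ok_def)
  let ?c = "state n h k" and ?w = "trunc n (real k * h)"
  have w: "weight ?w" "wnorm ?w \<le> M" using h by (auto intro!: trunc_weight)
  have kT: "real k * h \<le> T" using Suc.prems h by (simp add: distrib_right)
  have c: "\<And>l. l \<in> {1..n} \<Longrightarrow> 0 \<le> ?c l" and m: "mass n ?c + 1 \<le> mass_bound (real k * h)"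
    using state_bounds[OF n ok, of k] kT T by auto
  have m': "mass n ?c \<le> mass_bound T" using m mass_bound_mono[of "real k * h" T] kT h by simp
  have "pairing n (state n h (Suc k)) (indicator {..e})
      = pairing n ?c (indicator {..e}) + h * rate n ?w ?c (indicator {..e})"
    using h by (intro state_step[OF n]) auto
  also have "\<dots> \<le> pairing n ?c (indicator {..e}) + h * (2 * F0 * (mass_bound T + M) * e)"
  proof (intro add_left_mono mult_left_mono)
    have "2 * F0 * (mass n ?c + M) * e \<le> 2 * F0 * (mass_bound T + M) * e"
      using m' F0 e by (intro mult_right_mono mult_left_mono) auto
    moreover have "rate n ?w ?c (indicator {..e}) \<le> 2 * F0 * (mass n ?c + M) * e"
      by (rule rate_tail[OF n w c e])
    ultimately show "rate n ?w ?c (indicator {..e}) \<le> 2 * F0 * (mass_bound T + M) * e" by (rule order_trans[rotated])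
  qed (use h in auto)
  also have "\<dots> \<le> measure \<mu>0 {0<..e} + 2 * F0 * (mass_bound T + M) * e * (real k * h) + h * (2 * F0 * (mass_bound T + M) * e)"
    using Suc.IH[OF kT] by simp
  also have "\<dots> = measure \<mu>0 {0<..e} + 2 * F0 * (mass_bound T + M) * e * (real (Suc k) * h)"
    by (simp add: algebra_simps)
  finally show ?case .
qed

lemma rate_bound_mono: "0 \<le> m \<Longrightarrow> m \<le> m' \<Longrightarrow> rate_bound m \<le> rate_bound m'"
  unfolding rate_bound_def using K0 F0 M_nonneg
  by (intro add_mono mult_mono power_mono) auto

lemma state_rate_bound:
  assumes n: "1 \<le> n" and ok: "step_ok n h" and T: "T \<le> real n" and k: "real k * h \<le> T" and \<phi>: "test_fun L \<phi>"
  shows "\<bar>rate n (trunc n (real k * h)) (state n h k) \<phi>\<bar> \<le> L * rate_bound (mass_bound T)"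
proof -
  have h: "0 < h" using ok by (auto simp: step_ok_def)
  have c: "\<And>l. l \<in> {1..n} \<Longrightarrow> 0 \<le> state n h k l" and m: "mass n (state n h k) + 1 \<le> mass_bound (real k * h)"
    using state_bounds[OF n ok, of k] k T by auto
  have m': "mass n (state n h k) \<le> mass_bound T" using m mass_bound_mono[of "real k * h" T] k h by simp
  have "\<bar>rate n (trunc n (real k * h)) (state n h k) \<phi>\<bar> \<le> L * rate_bound (mass n (state n h k))"
    using h by (intro rate_lipschitz[OF n _ _ c \<phi>] trunc_weight) auto
  also have "\<dots> \<le> L * rate_bound (mass_bound T)"
    using test_funD(1)[OF \<phi>] m' c by (intro mult_left_mono rate_bound_mono sum_nonneg) auto
  finally show ?thesis .
qed

lemma state_lipschitz:
  assumes n: "1 \<le> n" and ok: "step_ok n h" and T: "T \<le> real n" and k: "real k' * h \<le> T" "k \<le> k'"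
    and \<phi>: "test_fun L \<phi>"
  shows "\<bar>pairing n (state n h k') \<phi> - pairing n (state n h k) \<phi>\<bar> \<le> L * rate_bound (mass_bound T) * (real (k' - k) * h)"
  using k(2,1)
proof (induction k' rule: dec_induct)
  case base
  then show ?case by simp
next
  case (step k')
  have h: "0 < h" using ok by (auto simp: step_ok_def)
  have kT: "real k' * h \<le> T" using step.prems h by (simp add: distrib_right)
  have "h * \<bar>rate n (trunc n (real k' * h)) (state n h k') \<phi>\<bar> \<le> h * (L * rate_bound (mass_bound T))"
    using state_rate_bound[OF n ok T kT \<phi>] h by (intro mult_left_mono) auto
  then have "\<bar>pairing n (state n h (Suc k')) \<phi> - pairing n (state n h k') \<phi>\<bar> \<le> h * (L * rate_bound (mass_bound T))"
    using state_step[OF n, of h k' \<phi>] h by (simp add: abs_mult)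
  moreover have "real (Suc k' - k) * h = real (k' - k) * h + h"
    using step(1) by (simp add: Suc_diff_le distrib_right)
  ultimately show ?case using step.IH[OF kT] by (simp add: distrib_left) (simp add: mult_ac)
qed

end

section \<open>Compactness\<close>

definition ramp :: "real \<Rightarrow> real \<Rightarrow> real" where "ramp \<delta> x = max 0 (min (x / \<delta>) 1)"

lemma ramp: "0 \<le> ramp \<delta> x" "ramp \<delta> x \<le> 1" by (auto simp: ramp_def)

lemma ramp_lipschitz: assumes "0 < \<delta>" shows "\<bar>ramp \<delta> x - ramp \<delta> y\<bar> \<le> 1 / \<delta> * \<bar>x - y\<bar>"
proof -
  have "\<bar>ramp \<delta> x - ramp \<delta> y\<bar> \<le> \<bar>x / \<delta> - y / \<delta>\<bar>" unfolding ramp_def by (simp add: max_def min_def)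
  also have "\<dots> = 1 / \<delta> * \<bar>x - y\<bar>" using assms by (simp add: abs_divide flip: diff_divide_distrib)
  finally show ?thesis .
qed

lemma ramp_zero: "0 < \<delta> \<Longrightarrow> x \<le> 0 \<Longrightarrow> ramp \<delta> x = 0" by (auto simp: ramp_def max_def zero_le_divide_iff)
lemma ramp_one: "0 < \<delta> \<Longrightarrow> \<delta> \<le> x \<Longrightarrow> ramp \<delta> x = 1" by (simp add: ramp_def)

text \<open>The ramp enforces the value 0 up to the origin and the cap at 1 makes the product
  constant beyond 1, so any bounded Lipschitz function becomes a test function. The constant is that
  of the product rule; the ramp has slope 1/\<delta>.\<close>

lemma test_fun_ramp_mult:
  assumes \<delta>: "0 < \<delta>" "\<delta> \<le> 1" and lip: "\<And>x y. \<bar>\<eta> x - \<eta> y\<bar> \<le> A * \<bar>x - y\<bar>"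
    and bdd: "\<And>x. \<bar>\<eta> x\<bar> \<le> B"
  shows "test_fun (A + B / \<delta>) (\<lambda>x. \<eta> (min x 1) * ramp \<delta> x)"
proof -
  have A: "0 \<le> A" using order_trans[OF abs_ge_zero lip[of 0 1]] by simp
  have B: "0 \<le> B" using bdd[of 0] by linarith
  have "\<bar>\<eta> (min x 1) * ramp \<delta> x - \<eta> (min y 1) * ramp \<delta> y\<bar> \<le> (A + B / \<delta>) * \<bar>x - y\<bar>" for x y
  proof -
    have "\<bar>\<eta> (min x 1) - \<eta> (min y 1)\<bar> \<le> A * \<bar>min x 1 - min y 1\<bar>" by (rule lip)
    also have "\<dots> \<le> A * \<bar>x - y\<bar>" by (intro mult_left_mono A) (simp add: min_def)
    finally have 1: "\<bar>\<eta> (min x 1) - \<eta> (min y 1)\<bar> \<le> A * \<bar>x - y\<bar>" .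
    have eq: "\<eta> (min x 1) * ramp \<delta> x - \<eta> (min y 1) * ramp \<delta> y
      = (\<eta> (min x 1) - \<eta> (min y 1)) * ramp \<delta> x + \<eta> (min y 1) * (ramp \<delta> x - ramp \<delta> y)"
      by (simp add: algebra_simps)
    have "\<bar>\<eta> (min x 1) * ramp \<delta> x - \<eta> (min y 1) * ramp \<delta> y\<bar>
      \<le> \<bar>\<eta> (min x 1) - \<eta> (min y 1)\<bar> * \<bar>ramp \<delta> x\<bar> + \<bar>\<eta> (min y 1)\<bar> * \<bar>ramp \<delta> x - ramp \<delta> y\<bar>"
      unfolding eq abs_mult[symmetric] by (rule abs_triangle_ineq)
    also have "\<dots> \<le> (A * \<bar>x - y\<bar>) * 1 + B * (1 / \<delta> * \<bar>x - y\<bar>)"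
      using 1 bdd ramp_lipschitz[OF \<delta>(1)] A B ramp[of \<delta> x] by (intro add_mono mult_mono) auto
    finally show ?thesis by (simp add: algebra_simps)
  qed
  then have "(A + B / \<delta>)-lipschitz_on UNIV (\<lambda>x. \<eta> (min x 1) * ramp \<delta> x)"
    using A B \<delta> by (intro lipschitz_onI) (auto simp: dist_real_def)
  moreover have "\<eta> (min x 1) * ramp \<delta> x = \<eta> (min 1 1) * ramp \<delta> 1" if "1 \<le> x" for x
    using that \<delta> by (simp add: ramp_one)
  ultimately show ?thesis unfolding test_fun_def using ramp_zero[OF \<delta>(1)] by simp
qed

lemma test_fun_ramp: "0 < \<delta> \<Longrightarrow> \<delta> \<le> 1 \<Longrightarrow> test_fun (1 / \<delta>) (ramp \<delta>)"
  using test_fun_ramp_mult[of \<delta> "\<lambda>_. 1" 0 1] by simp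

text \<open>The function is a reflected and shifted ramp of width \<open>b - a\<close>.\<close>

lemma cts_step_lipschitz:
  assumes "a < b" shows "\<bar>cts_step a b x - cts_step a b y\<bar> \<le> 1 / (b - a) * \<bar>x - y\<bar>"
proof -
  have eq: "cts_step a b x = 1 - ramp (b - a) (x - a)" for x
  proof -
    have "(b - x) / (b - a) = 1 - (x - a) / (b - a)" using assms by (simp add: field_simps)
    then show ?thesis using assms
      by (auto simp: cts_step_def ramp_def max_def min_def divide_le_0_iff divide_le_eq le_divide_eq)
  qed
  show ?thesis using ramp_lipschitz[of "b - a" "x - a" "y - a"] assms unfolding eq by (simp add: abs_minus_commute)
qed

context bvcf
begin

section \<open>Piecewise constant interpolation of the scheme in time\<close>

definition "stepnum n t = nat \<lfloor>t / time_step n\<rfloor>"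
definition "grid_time n t = real (stepnum n t) * time_step n"
definition "st n t = state n (time_step n) (stepnum n t)"

lemma grid_time:
  assumes n: "1 \<le> n" and t: "0 \<le> t"
  shows "0 \<le> grid_time n t" "grid_time n t \<le> t" "t < grid_time n t + time_step n"
proof -
  have h: "0 < time_step n" using time_step[OF n] by simp
  have r: "real (stepnum n t) = of_int \<lfloor>t / time_step n\<rfloor>" using t h by (simp add: stepnum_def)
  have "of_int \<lfloor>t / time_step n\<rfloor> \<le> t / time_step n" "t / time_step n < of_int \<lfloor>t / time_step n\<rfloor> + 1" by linarith+
  then show "grid_time n t \<le> t" "t < grid_time n t + time_step n"
    unfolding grid_time_def r pos_le_divide_eq[OF h] pos_divide_less_eq[OF h] by (simp_all add: distrib_right)
  show "0 \<le> grid_time n t" using h by (simp add: grid_time_def)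
qed

lemma stepnum_mono: assumes "1 \<le> n" "0 \<le> s" "s \<le> t" shows "stepnum n s \<le> stepnum n t"
  unfolding stepnum_def using assms time_step[of n] by (intro nat_mono floor_mono divide_right_mono) auto

lemma st_bounds:
  assumes n: "1 \<le> n" and t: "0 \<le> t" "t \<le> real n"
  shows "\<And>l. l \<in> {1..n} \<Longrightarrow> 0 \<le> st n t l" "mass n (st n t) \<le> mass_bound t"
proof -
  have k: "real (stepnum n t) * time_step n \<le> real n" using grid_time(2)[OF n t(1)] t by (simp add: grid_time_def)
  note * = state_bounds[OF n step_ok_time_step[OF n] k]
  show "\<And>l. l \<in> {1..n} \<Longrightarrow> 0 \<le> st n t l" using *(1) by (simp add: st_def)
  show "mass n (st n t) \<le> mass_bound t"
    using *(2) mass_bound_mono[of "grid_time n t" t] grid_time[OF n t(1)] by (simp add: st_def grid_time_def)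
qed

text \<open>The extra \<open>time_step n\<close> pays for a jump: arbitrarily close times may lie in
  different steps.\<close>

lemma st_lipschitz:
  assumes n: "1 \<le> n" and t: "0 \<le> s" "s \<le> t" "t \<le> T" "T \<le> real n" and \<phi>: "test_fun L \<phi>"
  shows "\<bar>pairing n (st n t) \<phi> - pairing n (st n s) \<phi>\<bar> \<le> L * rate_bound (mass_bound T) * (t - s + time_step n)"
proof -
  have k: "stepnum n s \<le> stepnum n t" using stepnum_mono[OF n t(1,2)] .
  have kT: "real (stepnum n t) * time_step n \<le> T" using grid_time(2)[OF n, of t] t by (simp add: grid_time_def)
  have "\<bar>pairing n (st n t) \<phi> - pairing n (st n s) \<phi>\<bar>
      \<le> L * rate_bound (mass_bound T) * (real (stepnum n t - stepnum n s) * time_step n)"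
    unfolding st_def by (rule state_lipschitz[OF n step_ok_time_step[OF n] t(4) kT k \<phi>])
  also have "real (stepnum n t - stepnum n s) * time_step n = grid_time n t - grid_time n s"
    using k by (simp add: grid_time_def of_nat_diff algebra_simps)
  also have "L * rate_bound (mass_bound T) * (grid_time n t - grid_time n s) \<le> L * rate_bound (mass_bound T) * (t - s + time_step n)"
  proof (rule mult_left_mono)
    show "grid_time n t - grid_time n s \<le> t - s + time_step n"
      using grid_time[OF n, of t] grid_time[OF n, of s] t by simp
    have "0 \<le> mass_bound T" using mass_bound_ge[of T] t by simp
    then show "0 \<le> L * rate_bound (mass_bound T)"
      using test_funD(1)[OF \<phi>] K0 F0 M_nonneg by (simp add: rate_bound_def)
  qed
  finally show ?thesis .
qed

lemma st_tail:
  assumes n: "1 \<le> n" and t: "0 \<le> t" "t \<le> T" "T \<le> real n" and e: "0 \<le> e" "e \<le> 1"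
  shows "pairing n (st n t) (indicator {..e}) \<le> measure \<mu>0 {0<..e} + 2 * F0 * (mass_bound T + M) * e * T"
proof -
  have k: "real (stepnum n t) * time_step n \<le> T" using grid_time(2)[OF n t(1)] t by (simp add: grid_time_def)
  have "pairing n (st n t) (indicator {..e}) \<le> measure \<mu>0 {0<..e} + 2 * F0 * (mass_bound T + M) * e * (real (stepnum n t) * time_step n)"
    unfolding st_def by (rule state_tail[OF n step_ok_time_step[OF n] t(3) e k])
  also have "\<dots> \<le> measure \<mu>0 {0<..e} + 2 * F0 * (mass_bound T + M) * e * T"
    using k F0 M_nonneg e mass_bound_ge[of T] t by (intro add_left_mono mult_left_mono) auto
  finally show ?thesis .
qed

text \<open>\<open>\<mu>0\<close> gives small mass to (0,1/k] because these sets decrease to the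
  empty set; the linear term accommodates the growth of the tail found in
  \<open>state_tail\<close>.\<close>

lemma tail_small:
  assumes "0 < \<epsilon>"
  shows "\<exists>\<delta>>0. \<delta> \<le> 1 \<and> measure \<mu>0 {0<..\<delta>} + C * \<delta> < \<epsilon>"
proof -
  interpret \<mu>0: finite_measure \<mu>0 by (rule \<mu>0_finite)
  let ?d = "\<lambda>k. 1 / real (Suc k)"
  have "(\<lambda>k. measure \<mu>0 {0<..?d k}) \<longlonglongrightarrow> measure \<mu>0 (\<Inter>k. {0<..?d k})"
  proof (rule \<mu>0.finite_Lim_measure_decseq)
    show "decseq (\<lambda>k. {0<..?d k})"
      unfolding decseq_def
    proof (intro allI impI)
      fix m n :: nat assume "m \<le> n"
      then have "?d n \<le> ?d m" by (intro frac_le) auto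
      then show "{0<..?d n} \<subseteq> {0<..?d m}" by auto
    qed
  qed auto
  moreover have "(\<Inter>k. {0<..?d k}) = {}"
  proof (intro equals0I)
    fix x assume "x \<in> (\<Inter>k. {0<..?d k})"
    then have x: "0 < x" "\<And>k. x \<le> ?d k" by auto
    obtain k where "?d k < x" using reals_Archimedean[OF x(1)] by (auto simp: inverse_eq_divide)
    with x(2)[of k] show False by simp
  qed
  ultimately have "(\<lambda>k. measure \<mu>0 {0<..?d k}) \<longlonglongrightarrow> 0" by simp
  moreover have "(\<lambda>k. C * ?d k) \<longlonglongrightarrow> C * 0"
    by (intro tendsto_mult tendsto_const LIMSEQ_Suc[OF lim_1_over_n])
  ultimately have "(\<lambda>k. measure \<mu>0 {0<..?d k} + C * ?d k) \<longlonglongrightarrow> 0 + C * 0" by (rule tendsto_add)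
  then have "\<forall>\<^sub>F k in sequentially. measure \<mu>0 {0<..?d k} + C * ?d k < \<epsilon>"
    using assms by (intro order_tendstoD(2)) auto
  then obtain k where "measure \<mu>0 {0<..?d k} + C * ?d k < \<epsilon>"
    by (auto simp: eventually_sequentially)
  then show ?thesis by (intro exI[of _ "?d k"]) auto
qed

text \<open>
  The measures are normalised by \<^term>\<open>mass_bound t\<close>. The missing mass is put at \<open>-1\<close>, away from
  \<open>[0,1]\<close>, where it cannot be confused with mass that escapes to \<open>0\<close>.
\<close>

definition "atom_weight n t i = (if 1 \<le> n \<and> 0 \<le> t \<and> t \<le> real n
  then if i = 0 then 1 - mass n (st n t) / mass_bound t else st n t i / mass_bound t
  else if i = 0 then 1 else 0)"
definition "atom_loc n i = (if i = 0 then -1 else node n i)"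

text \<open>Outside the range where the mass bound is available, in particular for times beyond
  \<open>n\<close>, the default weights put everything at \<open>-1\<close>. So \<open>P n t\<close>
  is a probability distribution for all arguments, as the compactness lemmas ask, and each fixed
  nonnegative time enters the range for large \<open>n\<close>.\<close>

definition "P n t = distr (point_measure {0..n} (\<lambda>i. ennreal (atom_weight n t i))) borel (atom_loc n)"

lemma atom_weight_nonneg: "i \<in> {0..n} \<Longrightarrow> 0 \<le> atom_weight n t i"
  using st_bounds[of n t] mass_bound_ge[of t] by (auto simp: atom_weight_def)

lemma sum_atom_weight:
  assumes "1 \<le> n" "0 \<le> t" "t \<le> real n"
  shows "(\<Sum>i\<in>{0..n}. atom_weight n t i * f i) = (1 - mass n (st n t) / mass_bound t) * f 0
   + (\<Sum>l=1..n. st n t l * f l) / mass_bound t"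
proof -
  have "{0..n} = insert 0 {1..n}" by auto
  then show ?thesis using assms by (simp add: atom_weight_def sum_divide_distrib)
qed

lemma sum_atom_weight_1: "(\<Sum>i\<in>{0..n}. atom_weight n t i) = 1"
proof (cases "1 \<le> n \<and> 0 \<le> t \<and> t \<le> real n")
  case True
  then show ?thesis using sum_atom_weight[of n t "\<lambda>_. 1"] by simp
next
  case False
  then have "(\<Sum>i\<in>{0..n}. atom_weight n t i) = (\<Sum>i\<in>{0..n}. if i = 0 then 1 else 0)"
    by (intro sum.cong) (auto simp: atom_weight_def)
  then show ?thesis by simp
qed

lemma P_distribution: "real_distribution (P n t)"
proof -
  have "(\<Sum>i\<in>{0..n}. ennreal (atom_weight n t i)) = 1"
    using atom_weight_nonneg sum_atom_weight_1 by (subst sum_ennreal) auto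
  then interpret prob_space "point_measure {0..n} (\<lambda>i. ennreal (atom_weight n t i))"
    by (intro prob_spaceI) (simp add: space_point_measure emeasure_point_measure_finite)
  show ?thesis unfolding P_def by (rule real_distribution_distr) simp
qed

lemma P_AE: "AE x in P n t. x = -1 \<or> 0 < x \<and> x \<le> 1"
  unfolding P_def using node(1)[of _ n]
  by (subst AE_distr_iff) (auto simp: atom_loc_def space_point_measure intro!: AE_I2)

lemma P_supp: "measure (P n t) {-2<..1} = 1"
proof -
  interpret real_distribution "P n t" by (rule P_distribution)
  have "AE x in P n t. x \<in> {-2<..1}" using P_AE[of n t] by eventually_elim auto
  then show ?thesis by (subst prob_eq_1) auto
qed

lemma P_integral:
  assumes n: "1 \<le> n" and t: "0 \<le> t" "t \<le> real n" and f: "f \<in> borel_measurable borel"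
  shows "integral\<^sup>L (P n t) f = (1 - mass n (st n t) / mass_bound t) * f (-1) + pairing n (st n t) f / mass_bound t"
proof -
  have "integral\<^sup>L (P n t) f = (\<integral>i. f (atom_loc n i) \<partial>point_measure {0..n} (\<lambda>i. ennreal (atom_weight n t i)))"
    unfolding P_def using f by (intro integral_distr) simp_all
  also have "\<dots> = (\<Sum>i\<in>{0..n}. atom_weight n t i * f (atom_loc n i))"
    using atom_weight_nonneg by (subst lebesgue_integral_point_measure_finite) auto
  also have "\<dots> = (1 - mass n (st n t) / mass_bound t) * f (-1) + pairing n (st n t) f / mass_bound t"
    unfolding sum_atom_weight[OF n t] by (simp add: atom_loc_def pairing_def)
  finally show ?thesis .
qed

lemma P_integral_0:
  assumes "1 \<le> n" "0 \<le> t" "t \<le> real n" "f \<in> borel_measurable borel" "f (-1) = 0"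
  shows "integral\<^sup>L (P n t) f = pairing n (st n t) f / mass_bound t"
  using P_integral[OF assms(1-4)] assms(5) by simp

lemma P_tail:
  assumes t: "0 \<le> t" and e: "0 < e"
  shows "\<exists>d>0. \<forall>\<^sub>F n in sequentially. measure (P n t) {0<..d} \<le> e"
proof -
  obtain d where d: "0 < d" "d \<le> 1" "measure \<mu>0 {0<..d} + 2 * F0 * (mass_bound t + M) * t * d < e"
    using tail_small[OF e] by blast
  have "measure (P n t) {0<..d} \<le> e" if n: "max 1 (nat \<lceil>t\<rceil>) \<le> n" for n
  proof -
    have n': "1 \<le> n" "t \<le> real n" using n by linarith+
    interpret real_distribution "P n t" by (rule P_distribution)
    have "measure (P n t) {0<..d} = (\<integral>x. indicator {0<..d} x \<partial>P n t)" by simp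
    also have "\<dots> = pairing n (st n t) (indicator {0<..d}) / mass_bound t"
      by (rule P_integral_0[OF n'(1) t n'(2)]) auto
    also have "\<dots> \<le> pairing n (st n t) (indicator {0<..d}) / 1"
    proof (rule divide_left_mono)
      show "0 \<le> pairing n (st n t) (indicator {0<..d})"
        unfolding pairing_def using st_bounds(1)[OF n'(1) t n'(2)] by (intro sum_nonneg) auto
    qed (use mass_bound_ge[OF t] in auto)
    also have "\<dots> \<le> pairing n (st n t) (indicator {..d})"
      using pairing_mono[of n "st n t" "indicator {0<..d}" "indicator {..d}", OF st_bounds(1)[OF n'(1) t n'(2)]]
      by (auto simp: indicator_def)
    also have "\<dots> \<le> measure \<mu>0 {0<..d} + 2 * F0 * (mass_bound t + M) * d * t"
      using d by (intro st_tail[OF n'(1) t order_refl n'(2)]) auto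
    also have "\<dots> \<le> e" using d(3) by (simp add: mult_ac)
    finally show ?thesis .
  qed
  then show ?thesis using d(1) unfolding eventually_sequentially by blast
qed

lemma pairing_abs_diff:
  assumes "\<And>l. l \<in> {1..n} \<Longrightarrow> 0 \<le> c l"
  shows "\<bar>pairing n c f - pairing n c f'\<bar> \<le> pairing n c (\<lambda>x. \<bar>f x - f' x\<bar>)"
proof -
  have "\<bar>pairing n c (\<lambda>x. f x - f' x)\<bar> \<le> (\<Sum>l=1..n. \<bar>c l * (f (node n l) - f' (node n l))\<bar>)"
    unfolding pairing_def by (rule sum_abs)
  also have "\<dots> = pairing n c (\<lambda>x. \<bar>f x - f' x\<bar>)"
    unfolding pairing_def using assms by (intro sum.cong) (auto simp: abs_mult)
  finally show ?thesis unfolding pairing_diff .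
qed

text \<open>\<open>cts_step\<close> need not vanish at 0 and is then no test function, so it is cut
  off near 0 at the price of the tail estimate. The cut-offs at the two times, the Lipschitz bound
  and the jump cost e/8 each, the change of the normalisation costs e/4.\<close>

lemma P_equicontinuous:
  assumes t: "0 \<le> t" and ab: "a < b" and e: "0 < e"
  shows "\<exists>d>0. \<forall>q\<ge>0. \<bar>q - t\<bar> < d \<longrightarrow> (\<forall>\<^sub>F n in sequentially.
        \<bar>integral\<^sup>L (P n t) (cts_step a b) - integral\<^sup>L (P n q) (cts_step a b)\<bar> < e)"
proof -
  define T where "T = t + 1"
  define BT where "BT = mass_bound T"
  have BT: "1 \<le> BT" unfolding BT_def T_def using t by (intro mass_bound_ge) auto
  define \<psi> where "\<psi> = cts_step a b"
  have \<psi>m[measurable]: "\<psi> \<in> borel_measurable borel" unfolding \<psi>_def cts_step_def by measurable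
  \<comment> \<open>Subtracting the value at \<open>-1\<close> removes the auxiliary atom: only the
    pairing with the state, divided by \<open>mass_bound\<close>, depends on time.\<close>
  define \<eta> where "\<eta> x = \<psi> x - \<psi> (-1)" for x
  have \<psi>01: "0 \<le> \<psi> x" "\<psi> x \<le> 1" for x using ab by (auto simp: \<psi>_def cts_step_def)
  have \<eta>1: "\<bar>\<eta> x\<bar> \<le> 1" for x using \<psi>01[of x] \<psi>01[of "-1"] by (simp add: \<eta>_def)
  have \<eta>L: "\<bar>\<eta> x - \<eta> y\<bar> \<le> 1 / (b - a) * \<bar>x - y\<bar>" for x y
    using cts_step_lipschitz[OF ab] by (simp add: \<eta>_def \<psi>_def)
  obtain \<delta> where \<delta>: "0 < \<delta>" "\<delta> \<le> 1" "measure \<mu>0 {0<..\<delta>} + 2 * F0 * (BT + M) * T * \<delta> < e / 8"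
    using tail_small[of "e / 8" "2 * F0 * (BT + M) * T"] half_gt_zero_iff by (meson e divide_pos_pos zero_less_numeral)
  define \<phi> where "\<phi> x = \<eta> (min x 1) * ramp \<delta> x" for x
  define L where "L = 1 / (b - a) + 1 / \<delta>"
  have \<phi>: "test_fun L \<phi>" unfolding L_def \<phi>_def by (rule test_fun_ramp_mult[OF \<delta>(1,2) \<eta>L \<eta>1])
  define R where "R = L * rate_bound BT"
  have R: "0 \<le> R" unfolding R_def using test_funD(1)[OF \<phi>] BT K0 F0 M_nonneg by (simp add: rate_bound_def)
  have "isCont mass_bound t" using mass_bound_cont by (simp add: continuous_on_eq_continuous_at)
  then obtain d1 where d1: "d1 > 0" "\<And>q. \<bar>q - t\<bar> < d1 \<Longrightarrow> \<bar>mass_bound q - mass_bound t\<bar> < e / (4 * BT)"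
    using e BT unfolding continuous_at_eps_delta dist_real_def by (metis divide_pos_pos less_le_trans mult_pos_pos zero_less_numeral zero_less_one)
  define d where "d = min (min d1 1) (e / (8 * (R + 1)))"
  have d: "0 < d" "d \<le> d1" "d \<le> 1" "R * d \<le> e / 8"
  proof -
    show "0 < d" "d \<le> d1" "d \<le> 1" using d1 e R by (auto simp: d_def)
    have "R * d \<le> (R + 1) * (e / (8 * (R + 1)))" using R d1 e by (intro mult_mono) (auto simp: d_def)
    also have "\<dots> = e / 8"
    proof -
      have "R + 1 \<noteq> 0" using R by simp
      then show ?thesis by (metis nonzero_mult_divide_mult_cancel_left times_divide_eq_right mult.commute)
    qed
    finally show "R * d \<le> e / 8" .
  qed
  obtain N :: nat where N: "1 \<le> N" "T \<le> real N" "R / real N \<le> e / 8"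
  proof -
    obtain N0 where N0: "max T (8 * R / e) < real N0" using reals_Archimedean2 by blast
    then have "0 < real N0" using t by (simp add: T_def)
    moreover have "8 * R / e < real N0" using N0 by simp
    ultimately show ?thesis using that[of N0] N0 e by (auto simp: field_simps)
  qed
  have app: "\<bar>pairing n (st n q) \<eta> - pairing n (st n q) \<phi>\<bar> \<le> e / 8" if n: "N \<le> n" and q: "0 \<le> q" "q \<le> T" for n q
  proof -
    have n': "1 \<le> n" "T \<le> real n" "q \<le> real n" using n N q by linarith+
    have pt: "\<bar>\<eta> x - \<phi> x\<bar> \<le> indicator {..\<delta>} x" if "x \<in> {0<..1}" for x
    proof (cases "x \<le> \<delta>")
      case True
      have "\<eta> x - \<phi> x = \<eta> x * (1 - ramp \<delta> x)" using that by (simp add: \<phi>_def min_def algebra_simps)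
      then have "\<bar>\<eta> x - \<phi> x\<bar> \<le> 1 * 1" unfolding abs_mult using \<eta>1[of x] ramp[of \<delta> x]
        by (simp only: abs_mult) (intro mult_mono, auto)
      with True show ?thesis by simp
    next
      case False
      then show ?thesis using that \<delta>(1) by (simp add: \<phi>_def min_def ramp_one)
    qed
    have "\<bar>pairing n (st n q) \<eta> - pairing n (st n q) \<phi>\<bar> \<le> pairing n (st n q) (\<lambda>x. \<bar>\<eta> x - \<phi> x\<bar>)"
      by (rule pairing_abs_diff[OF st_bounds(1)[OF n'(1) q(1) n'(3)]])
    also have "\<dots> \<le> pairing n (st n q) (indicator {..\<delta>})"
      by (rule pairing_mono[OF st_bounds(1)[OF n'(1) q(1) n'(3)] pt])
    also have "\<dots> \<le> measure \<mu>0 {0<..\<delta>} + 2 * F0 * (mass_bound T + M) * \<delta> * T"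
      using \<delta> by (intro st_tail[OF n'(1) q n'(2)]) auto
    also have "\<dots> \<le> e / 8" using \<delta>(3) by (simp add: BT_def mult_ac)
    finally show ?thesis .
  qed
  have main: "\<bar>integral\<^sup>L (P n t) \<psi> - integral\<^sup>L (P n q) \<psi>\<bar> < e"
    if n: "N \<le> n" and q: "0 \<le> q" "\<bar>q - t\<bar> < d" for n q
  proof -
    have qT: "q \<le> T" "t \<le> T" using q d by (auto simp: T_def)
    have n': "1 \<le> n" "T \<le> real n" "q \<le> real n" "t \<le> real n" using n N q qT by linarith+
    define X where "X s = pairing n (st n s) \<eta>" for s
    have rep: "integral\<^sup>L (P n s) \<psi> = \<psi> (-1) + X s / mass_bound s" if "0 \<le> s" "s \<le> T" for s
    proof -
      have s: "s \<le> real n" using that n' by simp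
      have Xs: "X s = pairing n (st n s) \<psi> - \<psi> (-1) * mass n (st n s)"
        unfolding X_def \<eta>_def pairing_diff pairing_const ..
      show ?thesis unfolding P_integral[OF n'(1) that(1) s \<psi>m] Xs
        by (simp add: algebra_simps diff_divide_distrib)
    qed
    have hN: "time_step n \<le> 1 / real N"
      using time_step(2)[OF n'(1)] frac_le[of 1 1 "real N" "real n"] n N(1) by simp
    have lip: "\<bar>pairing n (st n t) \<phi> - pairing n (st n q) \<phi>\<bar> \<le> R * (\<bar>q - t\<bar> + time_step n)"
    proof (cases "q \<le> t")
      case True
      then show ?thesis using st_lipschitz[OF n'(1) q(1) True qT(2) n'(2) \<phi>] by (simp add: R_def BT_def)
    next
      case False
      then show ?thesis using st_lipschitz[OF n'(1) t _ qT(1) n'(2) \<phi>] by (simp add: R_def BT_def abs_minus_commute)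
    qed
    have "R * (\<bar>q - t\<bar> + time_step n) \<le> R * (d + 1 / real N)"
      using q(2) hN R by (intro mult_left_mono) auto
    also have "\<dots> \<le> e / 8 + e / 8" using add_mono[OF d(4) N(3)] by (simp only: distrib_left times_divide_eq_right mult_1_right)
    finally have "\<bar>pairing n (st n t) \<phi> - pairing n (st n q) \<phi>\<bar> \<le> e / 8 + e / 8" using lip by linarith
    with app[OF n t qT(2)] app[OF n q(1) qT(1)] have XX: "\<bar>X t - X q\<bar> \<le> e / 2"
      unfolding X_def by linarith
    have Bt: "1 \<le> mass_bound t" "1 \<le> mass_bound q" using mass_bound_ge t q by auto
    have Xq: "\<bar>X q\<bar> \<le> mass_bound q"
    proof -
      have "\<bar>X q\<bar> \<le> 1 * mass n (st n q)"
        unfolding X_def by (rule pairing_bound[OF st_bounds(1)[OF n'(1) q(1) n'(3)] \<eta>1])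
      with st_bounds(2)[OF n'(1) q(1) n'(3)] show ?thesis by linarith
    qed
    \<comment> \<open>The two summands separate the change of the state from the change of the
      normalisation; \<open>X q / mass_bound q\<close> is at most 1 in modulus.\<close>
    have eq: "X t / mass_bound t - X q / mass_bound q
        = (X t - X q) / mass_bound t + (X q / mass_bound q) * ((mass_bound q - mass_bound t) / mass_bound t)"
      using Bt by (simp add: diff_divide_distrib right_diff_distrib)
    have "\<bar>X t / mass_bound t - X q / mass_bound q\<bar>
        \<le> \<bar>(X t - X q) / mass_bound t\<bar> + \<bar>X q / mass_bound q\<bar> * \<bar>(mass_bound q - mass_bound t) / mass_bound t\<bar>"
      unfolding eq abs_mult[symmetric] by (rule abs_triangle_ineq)
    also have "\<dots> \<le> e / 2 + 1 * (e / 4)"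
    proof (rule add_mono[OF _ mult_mono])
      have "\<bar>(X t - X q) / mass_bound t\<bar> \<le> \<bar>X t - X q\<bar> / 1"
        unfolding abs_divide using Bt by (intro frac_le) auto
      also have "\<dots> \<le> e / 2" using XX by simp
      finally show "\<bar>(X t - X q) / mass_bound t\<bar> \<le> e / 2" .
      show "\<bar>X q / mass_bound q\<bar> \<le> 1" using Xq Bt by (simp add: abs_divide)
      have "\<bar>mass_bound q - mass_bound t\<bar> \<le> e / (4 * BT)" using d1(2)[of q] q d by simp
      also have "\<dots> \<le> e / 4" using e BT by (simp add: field_simps)
      finally have "\<bar>mass_bound q - mass_bound t\<bar> / mass_bound t \<le> (e / 4) / 1"
        using Bt e by (intro frac_le) auto
      then show "\<bar>(mass_bound q - mass_bound t) / mass_bound t\<bar> \<le> e / 4" using Bt by (simp add: abs_divide)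
    qed auto
    finally show ?thesis using rep[OF t qT(2)] rep[OF q(1) qT(1)] e by simp
  qed
  show ?thesis
    using d(1) main unfolding \<psi>_def eventually_sequentially by blast
qed

lemma weak_limit_exists:
  obtains s Q where "strict_mono s"
    "\<And>t. 0 \<le> t \<Longrightarrow> real_distribution (Q t)"
    "\<And>t. 0 \<le> t \<Longrightarrow> weak_conv_m (\<lambda>n. P (s n) t) (Q t)"
  using weakly_convergent_paths[of P, OF P_distribution P_supp P_equicontinuous] by blast

end

section \<open>Passage to the limit\<close>

text \<open>Turns the telescoped Euler sum into a time integral: \<open>m\<close> counts the
  complete steps before \<open>t\<close>, and the second term is the incomplete last step.\<close>

lemma step_function_integral:
  fixes r :: "nat \<Rightarrow> real"
  assumes h: "0 < h" and t: "0 \<le> t"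
  defines "m \<equiv> nat \<lfloor>t / h\<rfloor>"
  shows "has_bochner_integral lborel (\<lambda>u. indicator {0..t} u * r (nat \<lfloor>u / h\<rfloor>))
    (h * (\<Sum>k<m. r k) + (t - real m * h) * r m)"
proof -
  have val: "nat \<lfloor>u / h\<rfloor> = k" if "real k * h \<le> u" "u < real (Suc k) * h" for u k
  proof -
    have "real k \<le> u / h" "u / h < real k + 1" using that h by (auto simp: field_simps)
    then have "\<lfloor>u / h\<rfloor> = int k" by (intro floor_unique) auto
    then show ?thesis by simp
  qed
  have A: "has_bochner_integral lborel (\<lambda>u. indicator {0..<real m * h} u * r (nat \<lfloor>u / h\<rfloor>)) (h * (\<Sum>k<m. r k))" for m
  proof (induction m)
    case (Suc m)
    have i: "has_bochner_integral lborel (\<lambda>u. indicator {real m * h..<real (Suc m) * h} u *\<^sub>R r m) (measure lborel {real m * h..<real (Suc m) * h} *\<^sub>R r m)"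
      by (rule has_bochner_integral_indicator) (use h in \<open>auto simp: distrib_right\<close>)
    have "has_bochner_integral lborel (\<lambda>u. indicator {0..<real m * h} u * r (nat \<lfloor>u / h\<rfloor>) + indicator {real m * h..<real (Suc m) * h} u *\<^sub>R r m)
       (h * (\<Sum>k<m. r k) + measure lborel {real m * h..<real (Suc m) * h} *\<^sub>R r m)"
      by (intro has_bochner_integral_add Suc i)
    moreover have "indicator {0..<real m * h} u * r (nat \<lfloor>u / h\<rfloor>) + indicator {real m * h..<real (Suc m) * h} u *\<^sub>R r m
       = indicator {0..<real (Suc m) * h} u * r (nat \<lfloor>u / h\<rfloor>)" for u
    proof -
      have "0 \<le> real m * h" "real m * h \<le> real (Suc m) * h" using h by (auto simp: distrib_right)
      then show ?thesis using val[of m u] by (auto simp: indicator_def)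
    qed
    moreover have "measure lborel {real m * h..<real (Suc m) * h} = h"
    proof -
      have "real m * h \<le> real (Suc m) * h" using h by (simp add: distrib_right)
      then show ?thesis by (simp add: distrib_right)
    qed
    ultimately show ?case by (simp add: distrib_left)
  qed (simp add: has_bochner_integral_zero)
  have mt: "real m * h \<le> t" "t < real (Suc m) * h"
  proof -
    have r: "real m = of_int \<lfloor>t / h\<rfloor>" using t h by (simp add: m_def)
    have "of_int \<lfloor>t / h\<rfloor> \<le> t / h" "t / h < of_int \<lfloor>t / h\<rfloor> + 1" by linarith+
    then show "real m * h \<le> t" "t < real (Suc m) * h"
      unfolding of_nat_Suc r pos_le_divide_eq[OF h] pos_divide_less_eq[OF h] by (simp_all add: add.commute)
  qed
  have i: "has_bochner_integral lborel (\<lambda>u. indicator {real m * h..t} u *\<^sub>R r m) (measure lborel {real m * h..t} *\<^sub>R r m)"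
    by (rule has_bochner_integral_indicator) (use mt in auto)
  have "has_bochner_integral lborel (\<lambda>u. indicator {0..<real m * h} u * r (nat \<lfloor>u / h\<rfloor>) + indicator {real m * h..t} u *\<^sub>R r m)
     (h * (\<Sum>k<m. r k) + measure lborel {real m * h..t} *\<^sub>R r m)"
    by (intro has_bochner_integral_add A i)
  moreover have "indicator {0..<real m * h} u * r (nat \<lfloor>u / h\<rfloor>) + indicator {real m * h..t} u *\<^sub>R r m
     = indicator {0..t} u * r (nat \<lfloor>u / h\<rfloor>)" for u
  proof -
    have "0 \<le> real m * h" using h by simp
    then show ?thesis using val[of m u] mt by (auto simp: indicator_def)
  qed
  ultimately show ?thesis using mt by simp
qed

lemma continuous_on_unit_measurable:
  fixes f :: "real \<Rightarrow> real"
  assumes "continuous_on {0<..1} f"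
  shows "f \<in> borel_measurable (restrict_space borel {0<..1})"
    "(\<lambda>x. if x \<in> {0<..1} then f x else 0) \<in> borel_measurable borel"
proof -
  have "(\<lambda>x. if x \<in> {0<..1} then f x else 0) = (\<lambda>x. indicator {0<..1} x *\<^sub>R f x)" by auto
  then show "(\<lambda>x. if x \<in> {0<..1} then f x else 0) \<in> borel_measurable borel"
    using borel_measurable_continuous_on_indicator[OF _ assms] by simp
  show "f \<in> borel_measurable (restrict_space borel {0<..1})"
    by (rule borel_measurable_continuous_on_restrict[OF assms])
qed

lemma continuous_on_unit_square_measurable:
  fixes H :: "real \<Rightarrow> real \<Rightarrow> real"
  assumes "continuous_on ({0<..1} \<times> {0<..1}) (\<lambda>(x,y). H x y)"
  shows "(\<lambda>(x,y). H x y) \<in> borel_measurable (restrict_space borel {0<..1} \<Otimes>\<^sub>M restrict_space borel {0<..1})"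
proof -
  define E where "E = {0::real<..1} \<times> {0::real<..1}"
  have E: "E \<in> sets borel" unfolding E_def by (simp add: borel_prod[symmetric])
  have "(\<lambda>p. indicator E p *\<^sub>R (case p of (x,y) \<Rightarrow> H x y)) \<in> borel_measurable (borel \<Otimes>\<^sub>M borel)"
    using borel_measurable_continuous_on_indicator[OF E, of "\<lambda>(x,y). H x y"] assms
    by (simp add: borel_prod E_def)
  moreover have "(\<lambda>p. (fst p, snd p)) \<in> (restrict_space borel {0<..1} \<Otimes>\<^sub>M restrict_space borel {0<..1}) \<rightarrow>\<^sub>M (borel \<Otimes>\<^sub>M (borel::real measure))"
    by (intro measurable_Pair measurable_compose[OF measurable_fst] measurable_compose[OF measurable_snd]
      measurable_restrict_space1) auto
  ultimately have "(\<lambda>p. indicator E p *\<^sub>R (case p of (x,y) \<Rightarrow> H x y)) \<in> borel_measurable (restrict_space borel {0<..1} \<Otimes>\<^sub>M restrict_space borel {0<..1})"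
    by (auto dest: measurable_compose)
  then show ?thesis
    by (rule measurable_cong[THEN iffD1, rotated]) (auto simp: E_def space_pair_measure space_restrict_space)
qed

lemma continuous_on_slices:
  fixes H :: "real \<Rightarrow> real \<Rightarrow> real"
  assumes H: "continuous_on (A \<times> A) (\<lambda>(x,y). H x y)" and x: "x \<in> A"
  shows "continuous_on A (H x)" "continuous_on A (\<lambda>y. H y x)"
proof -
  have "continuous_on A (\<lambda>y. case (x, y) of (a,b) \<Rightarrow> H a b)"
    by (rule continuous_on_compose2[OF H]) (intro continuous_on_Pair continuous_on_const continuous_on_id, use x in auto)
  then show "continuous_on A (H x)" by simp
  have "continuous_on A (\<lambda>y. case (y, x) of (a,b) \<Rightarrow> H a b)"
    by (rule continuous_on_compose2[OF H]) (intro continuous_on_Pair continuous_on_const continuous_on_id, use x in auto)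
  then show "continuous_on A (\<lambda>y. H y x)" by simp
qed

locale bvcf_limit = bvcf +
  fixes s :: "nat \<Rightarrow> nat" and Q :: "real \<Rightarrow> real measure"
  assumes s: "strict_mono s"
    and Q: "\<And>t. 0 \<le> t \<Longrightarrow> real_distribution (Q t)"
    and Q_lim: "\<And>t. 0 \<le> t \<Longrightarrow> weak_conv_m (\<lambda>n. P (s n) t) (Q t)"
begin

text \<open>This undoes the normalisation. Restriction to (0,1] discards the auxiliary atom at
  \<open>-1\<close>, and no mass is lost at 0 by \<open>weak_limit_no_atom\<close>.\<close>

definition "\<mu> t = density (restrict_space (Q t) {0<..1}) (\<lambda>_. ennreal (mass_bound t))"

lemma s_large: "\<forall>\<^sub>F k in sequentially. n \<le> s k"
  using filterlim_subseq[OF s] by (auto simp: filterlim_at_top)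

lemma s_large_real: "\<forall>\<^sub>F k in sequentially. 1 \<le> s k \<and> t \<le> real (s k)"
  using s_large[of "max 1 (nat \<lceil>t\<rceil>)"] by eventually_elim linarith

lemma P_tail_s:
  assumes "0 \<le> t" "0 < e" shows "\<exists>d>0. \<forall>\<^sub>F n in sequentially. measure (P (s n) t) {0<..d} \<le> e"
  using P_tail[OF assms] eventually_compose_filterlim[OF _ filterlim_subseq[OF s]] by blast

lemma \<mu>_sets [measurable_cong]: "0 \<le> t \<Longrightarrow> sets (\<mu> t) = sets (restrict_space borel {0<..1})"
proof -
  assume t: "0 \<le> t"
  interpret Q: real_distribution "Q t" by (rule Q[OF t])
  show ?thesis unfolding \<mu>_def sets_density by (rule sets_restrict_space_cong) simp
qed

lemma \<mu>_space: "0 \<le> t \<Longrightarrow> space (\<mu> t) = {0<..1}"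
  using sets_eq_imp_space_eq[OF \<mu>_sets] by (simp add: space_restrict_space)

lemma \<mu>_measurable: "0 \<le> t \<Longrightarrow> borel_measurable (\<mu> t) = borel_measurable (restrict_space borel {0<..1})"
  by (rule measurable_cong_sets[OF \<mu>_sets refl])

lemma \<mu>_integral:
  fixes f :: "real \<Rightarrow> real"
  assumes t: "0 \<le> t" and f: "f \<in> borel_measurable (restrict_space borel {0<..1})"
  shows "integral\<^sup>L (\<mu> t) f = mass_bound t * (\<integral>x. (if x \<in> {0<..1} then f x else 0) \<partial>Q t)"
proof -
  interpret Q: real_distribution "Q t" by (rule Q[OF t])
  have f': "f \<in> borel_measurable (restrict_space (Q t) {0<..1})"
    using f by (subst measurable_cong_sets[OF sets_restrict_space_cong refl]) auto
  have "integral\<^sup>L (\<mu> t) f = integral\<^sup>L (restrict_space (Q t) {0<..1}) (\<lambda>x. mass_bound t *\<^sub>R f x)"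
    unfolding \<mu>_def using mass_bound_ge[OF t] by (intro integral_density f') auto
  also have "\<dots> = mass_bound t * integral\<^sup>L (restrict_space (Q t) {0<..1}) f" by simp
  also have "integral\<^sup>L (restrict_space (Q t) {0<..1}) f = (\<integral>x. indicator {0<..1} x *\<^sub>R f x \<partial>Q t)"
    by (rule integral_restrict_space) simp
  also have "(\<lambda>x. indicator {0<..1} x *\<^sub>R f x) = (\<lambda>x. if x \<in> {0<..1} then f x else 0)" by auto
  finally show ?thesis .
qed

lemma \<mu>_finite: assumes t: "0 \<le> t" shows "finite_measure (\<mu> t)"
proof (rule finite_measureI)
  interpret Q: real_distribution "Q t" by (rule Q[OF t])
  have sp: "space (\<mu> t) = space (restrict_space (Q t) {0<..1})" by (simp add: \<mu>_def)
  have "emeasure (\<mu> t) (space (\<mu> t)) = ennreal (mass_bound t) * emeasure (restrict_space (Q t) {0<..1}) (space (restrict_space (Q t) {0<..1}))"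
    unfolding sp unfolding \<mu>_def by (rule emeasure_density_const) (rule sets.top)
  also have "\<dots> = ennreal (mass_bound t) * emeasure (Q t) {0<..1}"
    by (simp add: emeasure_restrict_space space_restrict_space)
  also have "\<dots> < \<infinity>" by (simp add: ennreal_mult_less_top Q.emeasure_eq_measure)
  finally show "emeasure (\<mu> t) (space (\<mu> t)) \<noteq> \<infinity>" by simp
qed

text \<open>The function may oscillate at 0; boundedness suffices there because no mass of the
  approximations accumulates at 0.\<close>

lemma conv_single:
  assumes t: "0 \<le> t" and f: "continuous_on {0<..1} f" and B: "\<And>x. x \<in> {0<..1} \<Longrightarrow> \<bar>f x\<bar> \<le> B"
  shows "(\<lambda>k. pairing (s k) (st (s k) t) f) \<longlonglongrightarrow> integral\<^sup>L (\<mu> t) f"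
proof -
  let ?f = "\<lambda>x. if x \<in> {0<..1} then f x else 0"
  have "(\<lambda>k. integral\<^sup>L (P (s k) t) ?f) \<longlonglongrightarrow> integral\<^sup>L (Q t) ?f"
    by (rule weak_conv_unit_single[OF P_distribution Q[OF t] Q_lim[OF t] P_AE P_tail_s[OF t] f B])
  then have "(\<lambda>k. mass_bound t * integral\<^sup>L (P (s k) t) ?f) \<longlonglongrightarrow> integral\<^sup>L (\<mu> t) f"
    unfolding \<mu>_integral[OF t continuous_on_unit_measurable(1)[OF f]] by (intro tendsto_intros)
  then show ?thesis
  proof (rule Lim_transform_eventually)
    show "\<forall>\<^sub>F k in sequentially. mass_bound t * integral\<^sup>L (P (s k) t) ?f = pairing (s k) (st (s k) t) f"
      using s_large_real[of t]
    proof eventually_elim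
      case (elim k)
      have "integral\<^sup>L (P (s k) t) ?f = pairing (s k) (st (s k) t) ?f / mass_bound t"
        using elim t by (intro P_integral_0 continuous_on_unit_measurable(2)[OF f]) auto
      moreover have "pairing (s k) (st (s k) t) ?f = pairing (s k) (st (s k) t) f"
        unfolding pairing_def using node(1) by (intro sum.cong) auto
      ultimately show ?case using mass_bound_ge[OF t] by simp
    qed
  qed
qed

lemma pair_integral:
  assumes t: "0 \<le> t" and H: "continuous_on ({0<..1} \<times> {0<..1}) (\<lambda>(x,y). H x y)"
    and B: "\<And>x y. x \<in> {0<..1} \<Longrightarrow> y \<in> {0<..1} \<Longrightarrow> \<bar>H x y\<bar> \<le> B"
  shows "integrable (\<mu> t \<Otimes>\<^sub>M \<mu> t) (\<lambda>(x,y). H x y)"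
    "integral\<^sup>L (\<mu> t \<Otimes>\<^sub>M \<mu> t) (\<lambda>(x,y). H x y)
      = (mass_bound t)\<^sup>2 * (\<integral>x. (\<integral>y. (if x \<in> {0<..1} \<and> y \<in> {0<..1} then H x y else 0) \<partial>Q t) \<partial>Q t)"
proof -
  interpret \<mu>: finite_measure "\<mu> t" by (rule \<mu>_finite[OF t])
  interpret \<mu>\<mu>: finite_measure "\<mu> t \<Otimes>\<^sub>M \<mu> t" by (rule finite_measure_pair_measure) (rule \<mu>_finite[OF t])+
  interpret pair_sigma_finite "\<mu> t" "\<mu> t" ..
  have m: "(\<lambda>(x,y). H x y) \<in> borel_measurable (\<mu> t \<Otimes>\<^sub>M \<mu> t)"
    using continuous_on_unit_square_measurable[OF H]
    by (subst measurable_cong_sets[OF sets_pair_measure_cong[OF \<mu>_sets[OF t] \<mu>_sets[OF t]] refl])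
  show int: "integrable (\<mu> t \<Otimes>\<^sub>M \<mu> t) (\<lambda>(x,y). H x y)"
    by (rule \<mu>\<mu>.integrable_const_bound[where B=B])
      (use m B in \<open>auto simp: space_pair_measure \<mu>_space[OF t] intro!: AE_I2\<close>)
  have c: "continuous_on {0<..1} (H x)" if "x \<in> {0<..1}" for x
    by (rule continuous_on_slices(1)[OF H that])
  have "integral\<^sup>L (\<mu> t \<Otimes>\<^sub>M \<mu> t) (\<lambda>(x,y). H x y) = (\<integral>x. (\<integral>y. H x y \<partial>\<mu> t) \<partial>\<mu> t)"
    using integral_fst'[OF int] by simp
  also have "\<dots> = mass_bound t * (\<integral>x. (if x \<in> {0<..1} then (\<integral>y. H x y \<partial>\<mu> t) else 0) \<partial>Q t)"
  proof (rule \<mu>_integral[OF t])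
    have "(\<lambda>x. \<integral>y. H x y \<partial>\<mu> t) \<in> borel_measurable (\<mu> t)"
      by (rule \<mu>.borel_measurable_lebesgue_integral[OF m])
    then show "(\<lambda>x. \<integral>y. H x y \<partial>\<mu> t) \<in> borel_measurable (restrict_space borel {0<..1})"
      by (simp add: \<mu>_measurable[OF t])
  qed
  also have "(\<lambda>x. if x \<in> {0<..1} then (\<integral>y. H x y \<partial>\<mu> t) else 0)
     = (\<lambda>x. mass_bound t * (\<integral>y. (if x \<in> {0<..1} \<and> y \<in> {0<..1} then H x y else 0) \<partial>Q t))"
  proof (rule ext)
    fix x
    show "(if x \<in> {0<..1} then (\<integral>y. H x y \<partial>\<mu> t) else 0)
      = mass_bound t * (\<integral>y. (if x \<in> {0<..1} \<and> y \<in> {0<..1} then H x y else 0) \<partial>Q t)"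
    proof (cases "x \<in> {0<..1}")
      case True
      then show ?thesis using \<mu>_integral[OF t continuous_on_unit_measurable(1)[OF c[OF True]]] by simp
    next
      case False
      show ?thesis unfolding if_not_P[OF False] by (simp only: False simp_thms if_False) simp
    qed
  qed
  finally show "integral\<^sup>L (\<mu> t \<Otimes>\<^sub>M \<mu> t) (\<lambda>(x,y). H x y)
      = (mass_bound t)\<^sup>2 * (\<integral>x. (\<integral>y. (if x \<in> {0<..1} \<and> y \<in> {0<..1} then H x y else 0) \<partial>Q t) \<partial>Q t)"
    by (simp add: power2_eq_square mult.assoc)
qed

lemma conv_double:
  assumes t: "0 \<le> t" and H: "continuous_on ({0<..1} \<times> {0<..1}) (\<lambda>(x,y). H x y)"
    and B: "\<And>x y. x \<in> {0<..1} \<Longrightarrow> y \<in> {0<..1} \<Longrightarrow> \<bar>H x y\<bar> \<le> B"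
  shows "(\<lambda>k. \<Sum>i=1..s k. \<Sum>j=1..s k. st (s k) t i * st (s k) t j * H (node (s k) i) (node (s k) j))
     \<longlonglongrightarrow> integral\<^sup>L (\<mu> t \<Otimes>\<^sub>M \<mu> t) (\<lambda>(x,y). H x y)"
proof -
  let ?I = "\<lambda>R. \<integral>x. (\<integral>y. (if x \<in> {0<..1} \<and> y \<in> {0<..1} then H x y else 0) \<partial>R) \<partial>R"
  have c: "continuous_on {0<..1} (H x)" if "x \<in> {0<..1}" for x
    by (rule continuous_on_slices(1)[OF H that])
  have c': "continuous_on {0<..1} (\<lambda>x. H x y)" if "y \<in> {0<..1}" for y
    by (rule continuous_on_slices(2)[OF H that])
  have "(\<lambda>k. ?I (P (s k) t)) \<longlonglongrightarrow> ?I (Q t)"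
    by (rule weak_conv_unit_double[OF P_distribution Q[OF t] Q_lim[OF t] P_AE P_tail_s[OF t] H B])
  then have "(\<lambda>k. (mass_bound t)\<^sup>2 * ?I (P (s k) t)) \<longlonglongrightarrow> (mass_bound t)\<^sup>2 * ?I (Q t)"
    by (intro tendsto_intros)
  also have "(mass_bound t)\<^sup>2 * ?I (Q t) = integral\<^sup>L (\<mu> t \<Otimes>\<^sub>M \<mu> t) (\<lambda>(x,y). H x y)"
    by (rule pair_integral(2)[OF t H B, symmetric])
  finally have "(\<lambda>k. (mass_bound t)\<^sup>2 * ?I (P (s k) t)) \<longlonglongrightarrow> integral\<^sup>L (\<mu> t \<Otimes>\<^sub>M \<mu> t) (\<lambda>(x,y). H x y)" .
  then show ?thesis
  proof (rule Lim_transform_eventually)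
    show "\<forall>\<^sub>F k in sequentially. (mass_bound t)\<^sup>2 * ?I (P (s k) t)
       = (\<Sum>i=1..s k. \<Sum>j=1..s k. st (s k) t i * st (s k) t j * H (node (s k) i) (node (s k) j))"
      using s_large_real[of t]
    proof eventually_elim
      case (elim k)
      let ?n = "s k" and ?c = "st (s k) t"
      have inner: "(\<integral>y. (if x \<in> {0<..1} \<and> y \<in> {0<..1} then H x y else 0) \<partial>P ?n t)
         = (if x \<in> {0<..1} then pairing ?n ?c (H x) / mass_bound t else 0)" for x
      proof (cases "x \<in> {0<..1}")
        case True
        have "(\<integral>y. (if y \<in> {0<..1} then H x y else 0) \<partial>P ?n t) = pairing ?n ?c (\<lambda>y. if y \<in> {0<..1} then H x y else 0) / mass_bound t"
          using elim t by (intro P_integral_0 continuous_on_unit_measurable(2)[OF c[OF True]]) auto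
        moreover have "pairing ?n ?c (\<lambda>y. if y \<in> {0<..1} then H x y else 0) = pairing ?n ?c (H x)"
          unfolding pairing_def using node(1) by (intro sum.cong) auto
        ultimately show ?thesis using True by simp
      next
        case False
        show ?thesis unfolding if_not_P[OF False] by (simp only: False simp_thms if_False) simp
      qed
      have cp: "continuous_on {0<..1} (\<lambda>x. pairing ?n ?c (H x) / mass_bound t)"
        unfolding pairing_def using node(1) mass_bound_ge[OF t] by (intro continuous_intros c') auto
      have "?I (P ?n t) = pairing ?n ?c (\<lambda>x. if x \<in> {0<..1} then pairing ?n ?c (H x) / mass_bound t else 0) / mass_bound t"
        unfolding inner using elim t by (intro P_integral_0 continuous_on_unit_measurable(2)[OF cp]) auto
      also have "pairing ?n ?c (\<lambda>x. if x \<in> {0<..1} then pairing ?n ?c (H x) / mass_bound t else 0)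
         = (\<Sum>i=1..?n. ?c i * (pairing ?n ?c (H (node ?n i)) / mass_bound t))"
        unfolding pairing_def[of ?n ?c "\<lambda>x. if x \<in> {0<..1} then _ x else 0"] using node(1)[of _ ?n]
        by (intro sum.cong) auto
      also have "\<dots> = (\<Sum>i=1..?n. ?c i * pairing ?n ?c (H (node ?n i))) / mass_bound t"
        by (simp add: sum_divide_distrib)
      finally have "?I (P ?n t) = (\<Sum>i=1..?n. ?c i * pairing ?n ?c (H (node ?n i))) / mass_bound t / mass_bound t" .
      then have "(mass_bound t)\<^sup>2 * ?I (P ?n t) = (\<Sum>i=1..?n. ?c i * pairing ?n ?c (H (node ?n i)))"
        using mass_bound_ge[OF t] by (simp add: power2_eq_square)
      then show ?case by (simp add: pairing_def sum_distrib_left mult_ac)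
    qed
  qed
qed

section \<open>Convergence of the truncated datum\<close>

lemma datum_pos_tail:
  assumes t: "0 \<le> t"
  shows "(\<lambda>n::nat. \<integral>y. y powr mx * (if y \<le> real n then 0 else datum_pos t y) \<partial>lborel) \<longlonglongrightarrow> 0"
proof -
  have w: "weight (datum_pos t)" by (rule datum_pos_weight(1)[OF t])
  have i: "integrable lborel (\<lambda>y. y powr mx * \<bar>datum_pos t y\<bar>)" by (rule weight_integrable[OF w])
  have m: "datum_pos t \<in> borel_measurable borel" by (rule datum_pos_meas[OF t])
  have "(\<lambda>n::nat. \<integral>y. y powr mx * (if y \<le> real n then 0 else datum_pos t y) \<partial>lborel) \<longlonglongrightarrow> (\<integral>y. 0 \<partial>(lborel :: real measure))"
  proof (rule integral_dominated_convergence[OF _ _ i])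
    show "AE y in lborel. (\<lambda>n::nat. y powr mx * (if y \<le> real n then 0 else datum_pos t y)) \<longlonglongrightarrow> 0"
    proof (rule AE_I2)
      fix y :: real
      have "\<forall>\<^sub>F n in sequentially. y \<le> real n"
        using eventually_ge_at_top[of "nat \<lceil>y\<rceil>"] by eventually_elim linarith
      then have "\<forall>\<^sub>F n in sequentially. y powr mx * (if y \<le> real n then 0 else datum_pos t y) = 0"
        by eventually_elim simp
      then show "(\<lambda>n::nat. y powr mx * (if y \<le> real n then 0 else datum_pos t y)) \<longlonglongrightarrow> 0"
        by (rule tendsto_eventually)
    qed
    show "\<And>n. AE y in lborel. norm (y powr mx * (if y \<le> real n then 0 else datum_pos t y)) \<le> y powr mx * \<bar>datum_pos t y\<bar>"
      by (auto simp: abs_mult)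
  qed (use m in measurable)
  then show ?thesis by simp
qed

text \<open>Up to \<open>n\<close> the weight \<open>y powr mx\<close> is at most \<open>n\<close>,
  and the last condition of \<open>step_ok\<close> controls the error in time. Beyond
  \<open>n\<close> the truncation vanishes, and the error is the tail of the moment at the fixed
  time \<open>t\<close>.\<close>

lemma wnorm_trunc:
  assumes n: "1 \<le> n" and t: "0 \<le> t" "t \<le> real n"
  shows "wnorm (\<lambda>y. trunc n (grid_time n t) y - datum_pos t y)
    \<le> 1 / real n + (\<integral>y. y powr mx * (if y \<le> real n then 0 else datum_pos t y) \<partial>lborel)"
proof -
  define r where "r = grid_time n t"
  have r: "0 \<le> r" "r \<le> t" "t < r + time_step n" unfolding r_def using grid_time[OF n t(1)] by auto
  have w: "weight (datum_pos t)" "weight (datum_pos r)" using datum_pos_weight(1) t r by auto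
  have gd: "real n * gdist r t \<le> 1 / real n"
    using step_ok_time_step[OF n] r t by (auto simp: step_ok_def)
  have m: "datum_pos t \<in> borel_measurable borel" "datum_pos r \<in> borel_measurable borel" using datum_pos_meas t r by auto
  have i1: "integrable lborel (\<lambda>y. real n * (indicator {1<..} y * \<bar>g r y - g t y\<bar>))"
    using gdist_integrable[OF r(1) t(1)] by simp
  have i2: "integrable lborel (\<lambda>y. y powr mx * (if y \<le> real n then 0 else datum_pos t y))"
    by (rule Bochner_Integration.integrable_bound[OF weight_integrable[OF w(1)]]) (use m in \<open>auto simp: abs_mult\<close>)
  have pt: "y powr mx * \<bar>trunc n r y - datum_pos t y\<bar>
    \<le> real n * (indicator {1<..} y * \<bar>g r y - g t y\<bar>) + y powr mx * (if y \<le> real n then 0 else datum_pos t y)" for y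
  proof (cases "1 < y")
    case y: True
    show ?thesis
    proof (cases "y \<le> real n")
      case True
      have "y powr mx \<le> real n" using powr_mx(4)[OF y] True by simp
      moreover have "\<bar>datum_pos r y - datum_pos t y\<bar> \<le> \<bar>g r y - g t y\<bar>" by (simp add: datum_pos_def max_def)
      ultimately show ?thesis using True y by (simp add: trunc_def mult_mono)
    next
      case False
      then show ?thesis using w y by (simp add: trunc_def weight_def)
    qed
  next
    case False
    then show ?thesis by (simp add: trunc_def datum_pos_def)
  qed
  have "wnorm (\<lambda>y. trunc n r y - datum_pos t y) \<le> (\<integral>y. real n * (indicator {1<..} y * \<bar>g r y - g t y\<bar>) + y powr mx * (if y \<le> real n then 0 else datum_pos t y) \<partial>lborel)"
    unfolding wnorm_def
  proof (rule integral_mono[OF _ Bochner_Integration.integrable_add[OF i1 i2] pt])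
    have "(\<lambda>y. y powr mx * \<bar>trunc n r y - datum_pos t y\<bar>) \<in> borel_measurable lborel"
      using m unfolding trunc_def by measurable
    then show "integrable lborel (\<lambda>y. y powr mx * \<bar>trunc n r y - datum_pos t y\<bar>)"
    proof (rule Bochner_Integration.integrable_bound[OF Bochner_Integration.integrable_add[OF i1 i2]])
      show "AE y in lborel. norm (y powr mx * \<bar>trunc n r y - datum_pos t y\<bar>) \<le> norm (real n * (indicator {1<..} y * \<bar>g r y - g t y\<bar>) + y powr mx * (if y \<le> real n then 0 else datum_pos t y))"
      proof (rule AE_I2)
        fix y
        have "norm (y powr mx * \<bar>trunc n r y - datum_pos t y\<bar>) = y powr mx * \<bar>trunc n r y - datum_pos t y\<bar>" by (simp add: abs_mult)
        also note pt
        finally show "norm (y powr mx * \<bar>trunc n r y - datum_pos t y\<bar>) \<le> norm (real n * (indicator {1<..} y * \<bar>g r y - g t y\<bar>) + y powr mx * (if y \<le> real n then 0 else datum_pos t y))"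
          by (simp only: real_norm_def)
      qed
    qed
  qed
  also have "\<dots> = real n * gdist r t + (\<integral>y. y powr mx * (if y \<le> real n then 0 else datum_pos t y) \<partial>lborel)"
    unfolding Bochner_Integration.integral_add[OF i1 i2] gdist_def by simp
  finally show ?thesis using gd by (simp add: r_def)
qed

definition "datum_approx k t = trunc (s k) (grid_time (s k) t)"

lemma datum_approx_weight: "1 \<le> s k \<Longrightarrow> 0 \<le> t \<Longrightarrow> weight (datum_approx k t)" "1 \<le> s k \<Longrightarrow> 0 \<le> t \<Longrightarrow> wnorm (datum_approx k t) \<le> M"
  unfolding datum_approx_def using grid_time(1) by (auto intro: trunc_weight)

lemma datum_approx_conv:
  assumes t: "0 \<le> t" shows "(\<lambda>k. wnorm (\<lambda>y. datum_approx k t y - datum_pos t y)) \<longlonglongrightarrow> 0"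
proof -
  have "(\<lambda>n. 1 / real n + (\<integral>y. y powr mx * (if y \<le> real n then 0 else datum_pos t y) \<partial>lborel)) \<longlonglongrightarrow> 0 + 0"
    by (intro tendsto_add lim_1_over_n datum_pos_tail t)
  then have lim: "(\<lambda>k. 1 / real (s k) + (\<integral>y. y powr mx * (if y \<le> real (s k) then 0 else datum_pos t y) \<partial>lborel)) \<longlonglongrightarrow> 0"
    using filterlim_compose[OF _ filterlim_subseq[OF s]] by fastforce
  show ?thesis
  proof (rule tendsto_sandwich[OF _ _ tendsto_const lim])
    show "\<forall>\<^sub>F k in sequentially. wnorm (\<lambda>y. datum_approx k t y - datum_pos t y) \<le> 1 / real (s k) + (\<integral>y. y powr mx * (if y \<le> real (s k) then 0 else datum_pos t y) \<partial>lborel)"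
      using s_large_real[of t] by eventually_elim (use wnorm_trunc t in \<open>auto simp: datum_approx_def\<close>)
  qed (simp add: wnorm_nonneg)
qed

definition "rate_lim \<phi> t = 1/2 * integral\<^sup>L (\<mu> t \<Otimes>\<^sub>M \<mu> t) (\<lambda>(x,y). K x y * coag_op \<phi> x y)
   - (\<integral>x. (bint K (datum_pos t) x + frag_rate x) * \<phi> x \<partial>\<mu> t) + (\<integral>x. fragint \<phi> x \<partial>\<mu> t)
   + (\<integral>x. indicator {0<..1} x * (bint \<kappa>F (datum_pos t) x * \<phi> x) \<partial>lborel)"

lemma bint_K_cont: "weight w \<Longrightarrow> continuous_on {0<..1} (bint K w)"
proof -
  assume w: "weight w"
  have "continuous_on {0<..1} (\<lambda>x. bint \<kappa>K w x / x)"
    by (intro continuous_intros bint_cont[OF bdry_kernel_K w]) auto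
  then show ?thesis by (rule continuous_on_eq) (auto simp: bint_K)
qed

lemma coag_sum_conv:
  assumes t: "0 \<le> t" and \<phi>: "test_fun L \<phi>"
  shows "(\<lambda>k. coag_sum (s k) (st (s k) t) \<phi>) \<longlonglongrightarrow> integral\<^sup>L (\<mu> t \<Otimes>\<^sub>M \<mu> t) (\<lambda>(x,y). K x y * coag_op \<phi> x y)"
  unfolding coag_sum_def by (rule conv_double[OF t K_coag_cont[OF \<phi>] K_coag_le[OF \<phi>]])

text \<open>The coefficient varies with \<open>k\<close> through the datum. Its distance from the
  limit coefficient is estimated by \<open>bint_diff\<close> for \<open>\<kappa>K\<close>, the
  factor \<open>x\<close> coming from the test function; the limit coefficient is handled by
  \<open>conv_single\<close>. The additional rate \<open>a\<close> lets the lemma serve both the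
  full loss and the boundary loss alone.\<close>

lemma loss_conv:
  assumes t: "0 \<le> t" and \<phi>: "test_fun L \<phi>" and a: "continuous_on {0<..1} a" "\<And>x. x \<in> {0<..1} \<Longrightarrow> \<bar>a x\<bar> \<le> A"
  shows "(\<lambda>k. pairing (s k) (st (s k) t) (\<lambda>x. (bint K (datum_approx k t) x + a x) * \<phi> x))
     \<longlonglongrightarrow> (\<integral>x. (bint K (datum_pos t) x + a x) * \<phi> x \<partial>\<mu> t)"
proof -
  note gw = datum_pos_weight[OF t]
  note L = test_funD(1)[OF \<phi>]
  have cph: "continuous_on {0<..1} \<phi>" using test_funD(7)[OF \<phi>] by (rule continuous_on_subset) auto
  have lim: "(\<lambda>k. pairing (s k) (st (s k) t) (\<lambda>x. (bint K (datum_pos t) x + a x) * \<phi> x)) \<longlonglongrightarrow> (\<integral>x. (bint K (datum_pos t) x + a x) * \<phi> x \<partial>\<mu> t)"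
  proof (rule conv_single[OF t])
    show "continuous_on {0<..1} (\<lambda>x. (bint K (datum_pos t) x + a x) * \<phi> x)"
      by (intro continuous_intros bint_K_cont gw a cph)
    show "\<bar>(bint K (datum_pos t) x + a x) * \<phi> x\<bar> \<le> 4 * K0 * M * L + A * L" if x: "x \<in> {0<..1}" for x
    proof -
      have "\<bar>a x\<bar> * \<bar>\<phi> x\<bar> \<le> A * L" using a(2)[OF x] test_funD(6)[OF \<phi>] by (intro mult_mono) auto
      then show ?thesis using bint_K_test[OF gw \<phi> x] abs_triangle_ineq[of "bint K (datum_pos t) x * \<phi> x" "a x * \<phi> x"]
        unfolding distrib_right abs_mult[of "a x"] by linarith
    qed
  qed
  have "(\<lambda>k. L * (4 * K0 * wnorm (\<lambda>y. datum_approx k t y - datum_pos t y)) * mass_bound t) \<longlonglongrightarrow> L * (4 * K0 * 0) * mass_bound t"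
    by (intro tendsto_intros datum_approx_conv t)
  then have err: "(\<lambda>k. L * (4 * K0 * wnorm (\<lambda>y. datum_approx k t y - datum_pos t y)) * mass_bound t) \<longlonglongrightarrow> 0" by simp
  have "(\<lambda>k. pairing (s k) (st (s k) t) (\<lambda>x. (bint K (datum_approx k t) x + a x) * \<phi> x)
      - pairing (s k) (st (s k) t) (\<lambda>x. (bint K (datum_pos t) x + a x) * \<phi> x)) \<longlonglongrightarrow> 0"
  proof (rule tendsto_0_le[OF err, where K=1])
    show "\<forall>\<^sub>F k in sequentially. norm (pairing (s k) (st (s k) t) (\<lambda>x. (bint K (datum_approx k t) x + a x) * \<phi> x)
      - pairing (s k) (st (s k) t) (\<lambda>x. (bint K (datum_pos t) x + a x) * \<phi> x))
      \<le> norm (L * (4 * K0 * wnorm (\<lambda>y. datum_approx k t y - datum_pos t y)) * mass_bound t) * 1"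
      using s_large_real[of t]
    proof eventually_elim
      case (elim k)
      note b = st_bounds[OF conjunct1[OF elim] t conjunct2[OF elim]]
      note aw = datum_approx_weight[OF conjunct1[OF elim] t]
      let ?e = "L * (4 * K0 * wnorm (\<lambda>y. datum_approx k t y - datum_pos t y))"
      have e: "0 \<le> ?e" using L K0 wnorm_nonneg by auto
      have "\<bar>pairing (s k) (st (s k) t) (\<lambda>x. (bint K (datum_approx k t) x + a x) * \<phi> x - (bint K (datum_pos t) x + a x) * \<phi> x)\<bar>
        \<le> ?e * mass (s k) (st (s k) t)"
      proof (rule pairing_bound[OF b(1)])
        fix x :: real assume x: "x \<in> {0<..1}"
        have eq: "(bint K (datum_approx k t) x + a x) * \<phi> x - (bint K (datum_pos t) x + a x) * \<phi> x = (bint K (datum_approx k t) x - bint K (datum_pos t) x) * \<phi> x"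
          by (simp add: algebra_simps)
        have "\<bar>(bint K (datum_approx k t) x - bint K (datum_pos t) x) * \<phi> x\<bar> \<le> \<bar>bint K (datum_approx k t) x - bint K (datum_pos t) x\<bar> * (L * x)"
          unfolding abs_mult using test_funD(5)[OF \<phi>, of x] x by (intro mult_left_mono) auto
        also have "\<dots> = L * \<bar>bint \<kappa>K (datum_approx k t) x - bint \<kappa>K (datum_pos t) x\<bar>"
          using x unfolding bint_K right_diff_distrib[symmetric] abs_mult by simp
        also have "\<dots> \<le> ?e"
          using bint_diff[OF bdry_kernel_K aw(1) gw(1) x] L by (intro mult_left_mono) auto
        finally show "\<bar>(bint K (datum_approx k t) x + a x) * \<phi> x - (bint K (datum_pos t) x + a x) * \<phi> x\<bar> \<le> ?e"
          unfolding eq .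
      qed
      also have "\<dots> \<le> ?e * mass_bound t" using b(2) e by (rule mult_left_mono)
      finally show ?case
        unfolding pairing_diff real_norm_def mult_1_right using abs_ge_self[of "?e * mass_bound t"] by linarith
    qed
  qed
  from tendsto_add[OF this lim] show ?thesis by simp
qed

lemma fragint_conv:
  assumes t: "0 \<le> t" and \<phi>: "test_fun L \<phi>"
  shows "(\<lambda>k. pairing (s k) (st (s k) t) (fragint (\<lambda>y. \<phi> (round_up (s k) y)))) \<longlonglongrightarrow> (\<integral>x. fragint \<phi> x \<partial>\<mu> t)"
proof -
  note L = test_funD(1)[OF \<phi>] and m = test_funD(8)[OF \<phi>]
  have lim: "(\<lambda>k. pairing (s k) (st (s k) t) (fragint \<phi>)) \<longlonglongrightarrow> (\<integral>x. fragint \<phi> x \<partial>\<mu> t)"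
    by (rule conv_single[OF t fragint_cont[OF _ m] fragint_bound[OF _ _ m]]) (use test_funD(6)[OF \<phi>] in auto)
  have "(\<lambda>n. 2 * F0 * (L * (1 / real n)) * mass_bound t) \<longlonglongrightarrow> 2 * F0 * (L * 0) * mass_bound t"
    by (intro tendsto_intros lim_1_over_n)
  then have err: "(\<lambda>k. 2 * F0 * (L * (1 / real (s k))) * mass_bound t) \<longlonglongrightarrow> 0"
    using filterlim_compose[OF _ filterlim_subseq[OF s]] by fastforce
  have "(\<lambda>k. pairing (s k) (st (s k) t) (fragint (\<lambda>y. \<phi> (round_up (s k) y))) - pairing (s k) (st (s k) t) (fragint \<phi>)) \<longlonglongrightarrow> 0"
  proof (rule tendsto_0_le[OF err, where K=1])
    show "\<forall>\<^sub>F k in sequentially. norm (pairing (s k) (st (s k) t) (fragint (\<lambda>y. \<phi> (round_up (s k) y))) - pairing (s k) (st (s k) t) (fragint \<phi>))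
      \<le> norm (2 * F0 * (L * (1 / real (s k))) * mass_bound t) * 1"
      using s_large_real[of t]
    proof eventually_elim
      case (elim k)
      note b = st_bounds[OF conjunct1[OF elim] t conjunct2[OF elim]]
      let ?e = "2 * F0 * (L * (1 / real (s k)))"
      have e: "0 \<le> ?e" using L F0 by auto
      have m': "(\<lambda>y. \<phi> (round_up (s k) y)) \<in> borel_measurable borel" using m by measurable
      have "\<bar>pairing (s k) (st (s k) t) (\<lambda>x. fragint (\<lambda>y. \<phi> (round_up (s k) y)) x - fragint \<phi> x)\<bar>
        \<le> ?e * mass (s k) (st (s k) t)"
      proof (rule pairing_bound[OF b(1)])
        fix x :: real assume x: "x \<in> {0<..1}"
        have eq: "fragint (\<lambda>y. \<phi> (round_up (s k) y)) x - fragint \<phi> x = fragint (\<lambda>y. \<phi> (round_up (s k) y) - \<phi> y) x"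
          unfolding fragint_def right_diff_distrib
          by (intro Bochner_Integration.integral_diff[symmetric] fragint_integrable[OF x, where B=L] m m')
            (use test_funD(6)[OF \<phi>] in auto)
        show "\<bar>fragint (\<lambda>y. \<phi> (round_up (s k) y)) x - fragint \<phi> x\<bar> \<le> ?e"
          unfolding eq
        proof (rule fragint_bound[OF x])
          fix y :: real assume y: "y \<in> {0<..1}"
          have "\<bar>\<phi> (round_up (s k) y) - \<phi> y\<bar> \<le> L * \<bar>round_up (s k) y - y\<bar>" by (rule test_funD(2)[OF \<phi>])
          also have "\<dots> \<le> L * (1 / real (s k))"
            using round_up(2)[OF conjunct1[OF elim] y] L by (rule mult_left_mono)
          finally show "\<bar>\<phi> (round_up (s k) y) - \<phi> y\<bar> \<le> L * (1 / real (s k))" .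
        qed (use m m' in measurable)
      qed
      also have "\<dots> \<le> ?e * mass_bound t" using b(2) e by (rule mult_left_mono)
      finally show ?case
        unfolding pairing_diff real_norm_def mult_1_right using abs_ge_self[of "?e * mass_bound t"] by linarith
    qed
  qed
  from tendsto_add[OF this lim] show ?thesis by simp
qed

lemma round_up_conv:
  assumes \<phi>: "test_fun L \<phi>" and x: "x \<in> {0<..1}"
  shows "(\<lambda>n. \<phi> (round_up n x)) \<longlonglongrightarrow> \<phi> x"
proof (rule LIM_zero_cancel, rule tendsto_0_le[where K=1])
  have "(\<lambda>n. L * (1 / real n)) \<longlonglongrightarrow> L * 0" by (intro tendsto_intros lim_1_over_n)
  then show "(\<lambda>n. L * (1 / real n)) \<longlonglongrightarrow> 0" by simp
  show "\<forall>\<^sub>F n in sequentially. norm (\<phi> (round_up n x) - \<phi> x) \<le> norm (L * (1 / real n)) * 1"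
    using eventually_ge_at_top[of 1]
  proof eventually_elim
    case (elim n)
    have "\<bar>\<phi> (round_up n x) - \<phi> x\<bar> \<le> L * \<bar>round_up n x - x\<bar>" by (rule test_funD(2)[OF \<phi>])
    also have "\<dots> \<le> L * (1 / real n)" using round_up(2)[OF elim x] test_funD(1)[OF \<phi>] by (rule mult_left_mono)
    finally show ?case using test_funD(1)[OF \<phi>] by simp
  qed
qed

lemma source_conv:
  assumes t: "0 \<le> t" and \<phi>: "test_fun L \<phi>"
  shows "(\<lambda>k. source_term (s k) (datum_approx k t) \<phi>) \<longlonglongrightarrow> (\<integral>x. indicator {0<..1} x * (bint \<kappa>F (datum_pos t) x * \<phi> x) \<partial>lborel)"
proof -
  note L = test_funD(1)[OF \<phi>] and m = test_funD(8)[OF \<phi>] and gw = datum_pos_weight[OF t]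
  \<comment> \<open>Dominated convergence asks for a bound at every index, but the weights are
    controlled only when \<open>s k\<close> is at least 1; hence the shifted sequence.\<close>
  define k0 where "k0 = (SOME k0. \<forall>k\<ge>k0. 1 \<le> s k)"
  have k0: "1 \<le> s k" if "k0 \<le> k" for k
    using someI_ex[of "\<lambda>k0. \<forall>k\<ge>k0. 1 \<le> s k"] s_large[of 1] that unfolding k0_def eventually_sequentially by blast
  have ind_meas: "(\<lambda>x. indicator {0<..1} x * (bint \<kappa>F w x * f x)) \<in> borel_measurable lborel"
    if "weight w" "f \<in> borel_measurable borel" for w f
  proof -
    have "(\<lambda>x. (indicator {0<..1} x * bint \<kappa>F w x) * f x) \<in> borel_measurable lborel"
      using borel_measurable_integrable[OF bint_F_integrable[OF that(1)]] that(2)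
      by (intro borel_measurable_times[of "\<lambda>x. indicator {0<..1} x * bint \<kappa>F w x"]) auto
    then show ?thesis by (simp add: mult.assoc)
  qed
  have bF: "\<bar>bint \<kappa>F w x\<bar> \<le> 2 * F0 * M" if "weight w" "wnorm w \<le> M" "x \<in> {0<..1}" for w x
    using bint_bound[OF bdry_kernel_F that(1,3)] mult_left_mono[OF that(2), of "2 * F0"] F0 by simp
  have "(\<lambda>k. source_term (s (k + k0)) (datum_approx (k + k0) t) \<phi>) \<longlonglongrightarrow> (\<integral>x. indicator {0<..1} x * (bint \<kappa>F (datum_pos t) x * \<phi> x) \<partial>lborel)"
    unfolding source_term_def
  proof (rule integral_dominated_convergence)
    show "integrable lborel (\<lambda>x. indicator {0<..1::real} x * (2 * F0 * M * L))"
      by (intro integrable_mult_left integrable_real_indicator) auto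
    show "(\<lambda>x. indicator {0<..1} x * (bint \<kappa>F (datum_pos t) x * \<phi> x)) \<in> borel_measurable lborel"
      by (rule ind_meas[OF gw(1) m])
    show "(\<lambda>x. indicator {0<..1} x * (bint \<kappa>F (datum_approx (k + k0) t) x * \<phi> (round_up (s (k + k0)) x))) \<in> borel_measurable lborel" for k
      by (rule ind_meas[OF datum_approx_weight(1)[OF k0 t]]) (use m in \<open>simp, measurable\<close>)
    show "AE x in lborel. norm (indicator {0<..1} x * (bint \<kappa>F (datum_approx (k + k0) t) x * \<phi> (round_up (s (k + k0)) x)))
      \<le> indicator {0<..1} x * (2 * F0 * M * L)" for k
    proof (rule AE_I2)
      fix x :: real
      show "norm (indicator {0<..1} x * (bint \<kappa>F (datum_approx (k + k0) t) x * \<phi> (round_up (s (k + k0)) x)))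
        \<le> indicator {0<..1} x * (2 * F0 * M * L)"
      proof (cases "x \<in> {0<..1}")
        case True
        have "\<bar>bint \<kappa>F (datum_approx (k + k0) t) x\<bar> * \<bar>\<phi> (round_up (s (k + k0)) x)\<bar> \<le> 2 * F0 * M * L"
          by (intro mult_mono bF[OF datum_approx_weight[OF k0 t] True] test_funD(6)[OF \<phi>]) (use F0 M_nonneg in auto)
        then show ?thesis using True by (simp add: abs_mult)
      qed simp
    qed
    show "AE x in lborel. (\<lambda>k. indicator {0<..1} x * (bint \<kappa>F (datum_approx (k + k0) t) x * \<phi> (round_up (s (k + k0)) x)))
       \<longlonglongrightarrow> indicator {0<..1} x * (bint \<kappa>F (datum_pos t) x * \<phi> x)"
    proof (rule AE_I2)
      fix x :: real
      show "(\<lambda>k. indicator {0<..1} x * (bint \<kappa>F (datum_approx (k + k0) t) x * \<phi> (round_up (s (k + k0)) x)))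
        \<longlonglongrightarrow> indicator {0<..1} x * (bint \<kappa>F (datum_pos t) x * \<phi> x)"
      proof (cases "x \<in> {0<..1}")
        case True
        have a: "(\<lambda>k. 2 * F0 * wnorm (\<lambda>y. datum_approx k t y - datum_pos t y)) \<longlonglongrightarrow> 2 * F0 * 0"
          by (intro tendsto_intros datum_approx_conv t)
        have "(\<lambda>k. bint \<kappa>F (datum_approx k t) x - bint \<kappa>F (datum_pos t) x) \<longlonglongrightarrow> 0"
        proof (rule tendsto_0_le[where K=1])
          show "(\<lambda>k. 2 * F0 * wnorm (\<lambda>y. datum_approx k t y - datum_pos t y)) \<longlonglongrightarrow> 0" using a by simp
          show "\<forall>\<^sub>F k in sequentially. norm (bint \<kappa>F (datum_approx k t) x - bint \<kappa>F (datum_pos t) x)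
              \<le> norm (2 * F0 * wnorm (\<lambda>y. datum_approx k t y - datum_pos t y)) * 1"
            using s_large[of 1]
          proof eventually_elim
            case (elim k)
            show ?case using bint_diff[OF bdry_kernel_F datum_approx_weight(1)[OF elim t] gw(1) True] F0 wnorm_nonneg by simp
          qed
        qed
        then have 1: "(\<lambda>k. bint \<kappa>F (datum_approx k t) x) \<longlonglongrightarrow> bint \<kappa>F (datum_pos t) x" by (rule LIM_zero_cancel)
        have 2: "(\<lambda>k. \<phi> (round_up (s k) x)) \<longlonglongrightarrow> \<phi> x"
          by (rule filterlim_compose[OF round_up_conv[OF \<phi> True] filterlim_subseq[OF s]])
        show ?thesis by (intro tendsto_intros LIMSEQ_ignore_initial_segment[OF 1] LIMSEQ_ignore_initial_segment[OF 2])
      qed simp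
    qed
  qed
  then show ?thesis by (rule LIMSEQ_offset)
qed

lemma rate_conv:
  assumes t: "0 \<le> t" and \<phi>: "test_fun L \<phi>"
  shows "(\<lambda>k. rate (s k) (datum_approx k t) (st (s k) t) \<phi>) \<longlonglongrightarrow> rate_lim \<phi> t"
  unfolding rate_def rate_lim_def
  by (intro tendsto_intros coag_sum_conv[OF t \<phi>] fragint_conv[OF t \<phi>] source_conv[OF t \<phi>]
      loss_conv[OF t \<phi> frag_rate_cont, where A=F0])
    (use frag_rate in auto)

section \<open>Measurability and bounds of the limit rates in time\<close>

lemma stepnum_measurable: "stepnum n \<in> borel \<rightarrow>\<^sub>M count_space UNIV"
  unfolding stepnum_def by measurable

lemma step_measurable:
  fixes f :: "nat \<Rightarrow> real" shows "(\<lambda>t. f (stepnum n t)) \<in> borel_measurable borel"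
  by (rule measurable_compose[OF stepnum_measurable]) simp

text \<open>The limits \<open>Q t\<close> are selected separately for each \<open>t\<close>, which
  says nothing about measurability in time. It is recovered because the rates are pointwise limits
  of functions that depend on \<open>t\<close> only through the step number.\<close>

lemma limit_measurable:
  fixes f :: "nat \<Rightarrow> nat \<Rightarrow> real"
  assumes "\<And>t. 0 \<le> t \<Longrightarrow> (\<lambda>k. f k (stepnum (s k) t)) \<longlonglongrightarrow> l t"
  shows "(\<lambda>t. indicator {0..T} t * l t) \<in> borel_measurable borel"
proof (rule borel_measurable_LIMSEQ_real)
  show "(\<lambda>k. indicator {0..T} t * f k (stepnum (s k) t)) \<longlonglongrightarrow> indicator {0..T} t * l t" for t
    using assms[of t] by (cases "t \<in> {0..T}") (auto intro!: tendsto_intros)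
  show "(\<lambda>t. indicator {0..T} t * f k (stepnum (s k) t)) \<in> borel_measurable borel" for k
    by (intro borel_measurable_times step_measurable borel_measurable_indicator) simp
qed

text \<open>The two singular parts of the rate get names of their own, because the other parts admit
  bounds independent of the Lipschitz constant of the test function.\<close>

definition "coag_lim \<phi> t = integral\<^sup>L (\<mu> t \<Otimes>\<^sub>M \<mu> t) (\<lambda>(x,y). K x y * coag_op \<phi> x y)"
definition "bdry_lim \<phi> t = (\<integral>x. bint K (datum_pos t) x * \<phi> x \<partial>\<mu> t)"

lemma coag_lim_measurable:
  assumes "test_fun L \<phi>" shows "(\<lambda>t. indicator {0..T} t * coag_lim \<phi> t) \<in> borel_measurable borel"
  by (rule limit_measurable[where f="\<lambda>k j. coag_sum (s k) (state (s k) (time_step (s k)) j) \<phi>"])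
    (use coag_sum_conv[OF _ assms] in \<open>simp add: coag_lim_def st_def\<close>)

lemma bdry_lim_measurable:
  assumes "test_fun L \<phi>" shows "(\<lambda>t. indicator {0..T} t * bdry_lim \<phi> t) \<in> borel_measurable borel"
proof (rule limit_measurable[where f="\<lambda>k j. pairing (s k) (state (s k) (time_step (s k)) j)
    (\<lambda>x. bint K (trunc (s k) (real j * time_step (s k))) x * \<phi> x)"])
  fix t :: real assume "0 \<le> t"
  from loss_conv[OF this assms, of "\<lambda>_. 0" 0]
  show "(\<lambda>k. pairing (s k) (state (s k) (time_step (s k)) (stepnum (s k) t))
       (\<lambda>x. bint K (trunc (s k) (real (stepnum (s k) t) * time_step (s k))) x * \<phi> x)) \<longlonglongrightarrow> bdry_lim \<phi> t"
    by (simp add: bdry_lim_def st_def datum_approx_def grid_time_def)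
qed

definition "step_rate \<phi> n j = rate n (trunc n (real j * time_step n)) (state n (time_step n) j) \<phi>"

lemma step_rate_conv:
  assumes "0 \<le> t" "test_fun L \<phi>" shows "(\<lambda>k. step_rate \<phi> (s k) (stepnum (s k) t)) \<longlonglongrightarrow> rate_lim \<phi> t"
  using rate_conv[OF assms] by (simp add: step_rate_def datum_approx_def grid_time_def st_def)

lemma rate_lim_measurable:
  assumes "test_fun L \<phi>" shows "(\<lambda>t. indicator {0..T} t * rate_lim \<phi> t) \<in> borel_measurable borel"
  by (rule limit_measurable[where f="\<lambda>k. step_rate \<phi> (s k)"]) (rule step_rate_conv[OF _ assms])

lemma step_rate_bound:
  assumes n: "1 \<le> n" "T \<le> real n" and t: "0 \<le> t" "t \<le> T" and \<phi>: "test_fun L \<phi>"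
  shows "\<bar>step_rate \<phi> n (stepnum n t)\<bar> \<le> L * rate_bound (mass_bound T)"
  unfolding step_rate_def using grid_time(2)[OF n(1) t(1)] t
  by (intro state_rate_bound[OF n(1) step_ok_time_step[OF n(1)] n(2) _ \<phi>]) (simp add: grid_time_def)

lemma rate_lim_bound:
  assumes t: "0 \<le> t" "t \<le> T" and \<phi>: "test_fun L \<phi>"
  shows "\<bar>rate_lim \<phi> t\<bar> \<le> L * rate_bound (mass_bound T)"
proof (rule tendsto_upperbound)
  show "(\<lambda>k. \<bar>step_rate \<phi> (s k) (stepnum (s k) t)\<bar>) \<longlonglongrightarrow> \<bar>rate_lim \<phi> t\<bar>"
    by (intro tendsto_rabs step_rate_conv[OF t(1) \<phi>])
  show "\<forall>\<^sub>F k in sequentially. \<bar>step_rate \<phi> (s k) (stepnum (s k) t)\<bar> \<le> L * rate_bound (mass_bound T)"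
    using s_large_real[of T] by eventually_elim (use step_rate_bound t \<phi> in blast)
qed simp

lemma rate_lim_integrable:
  assumes T: "0 \<le> T" and \<phi>: "test_fun L \<phi>"
  shows "integrable lborel (\<lambda>t. indicator {0..T} t * rate_lim \<phi> t)"
proof (rule Bochner_Integration.integrable_bound)
  show "integrable lborel (\<lambda>t. indicator {0..T} t * (L * rate_bound (mass_bound T)))"
    by (intro integrable_mult_left integrable_real_indicator) (use T in auto)
  show "AE t in lborel. norm (indicator {0..T} t * rate_lim \<phi> t) \<le> norm (indicator {0..T} t * (L * rate_bound (mass_bound T)))"
    using rate_lim_bound[OF _ _ \<phi>, of _ T] by (intro AE_I2) (auto simp: indicator_def intro: order_trans[OF _ abs_ge_self])
qed (use rate_lim_measurable[OF \<phi>] in simp)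

lemma init_conv:
  assumes \<phi>: "test_fun L \<phi>"
  shows "(\<lambda>k. pairing (s k) (state (s k) (time_step (s k)) 0) \<phi>) \<longlonglongrightarrow> integral\<^sup>L \<mu>in \<phi>"
proof -
  interpret \<mu>0: finite_measure \<mu>0 by (rule \<mu>0_finite)
  note m[measurable] = test_funD(8)[OF \<phi>]
  have "(\<lambda>n. \<integral>x. indicator {0<..1} x * \<phi> (round_up n x) \<partial>\<mu>0) \<longlonglongrightarrow> (\<integral>x. indicator {0<..1} x * \<phi> x \<partial>\<mu>0)"
  proof (rule integral_dominated_convergence[where w="\<lambda>_. L"])
    show "AE x in \<mu>0. (\<lambda>n. indicator {0<..1} x * \<phi> (round_up n x)) \<longlonglongrightarrow> indicator {0<..1} x * \<phi> x"
    proof (rule AE_I2)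
      fix x :: real
      show "(\<lambda>n. indicator {0<..1} x * \<phi> (round_up n x)) \<longlonglongrightarrow> indicator {0<..1} x * \<phi> x"
        using round_up_conv[OF \<phi>, of x] by (cases "x \<in> {0<..1}") (auto intro!: tendsto_intros)
    qed
    show "AE x in \<mu>0. norm (indicator {0<..1} x * \<phi> (round_up n x)) \<le> L" for n
      using test_funD(6)[OF \<phi>] test_funD(1)[OF \<phi>] by (intro AE_I2) (auto simp: indicator_def)
  qed (simp_all, measurable)
  also have "(\<integral>x. indicator {0<..1} x * \<phi> x \<partial>\<mu>0) = integral\<^sup>L \<mu>0 \<phi>"
    by (rule integral_cong_AE) (use AE_\<mu>0 in \<open>simp_all, eventually_elim, auto\<close>)
  also have "\<dots> = integral\<^sup>L \<mu>in \<phi>" by (rule integral_\<mu>0[OF m])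
  finally have "(\<lambda>k. \<integral>x. indicator {0<..1} x * \<phi> (round_up (s k) x) \<partial>\<mu>0) \<longlonglongrightarrow> integral\<^sup>L \<mu>in \<phi>"
    by (rule filterlim_compose[OF _ filterlim_subseq[OF s]])
  then show ?thesis
  proof (rule Lim_transform_eventually)
    show "\<forall>\<^sub>F k in sequentially. (\<integral>x. indicator {0<..1} x * \<phi> (round_up (s k) x) \<partial>\<mu>0) = pairing (s k) (state (s k) (time_step (s k)) 0) \<phi>"
      using s_large[of 1] by eventually_elim (simp only: state_init)
  qed
qed

lemma state_telescope:
  assumes "1 \<le> n"
  shows "pairing n (state n (time_step n) m) \<phi> = pairing n (state n (time_step n) 0) \<phi> + time_step n * (\<Sum>k<m. step_rate \<phi> n k)"
proof (induction m)
  case (Suc m)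
  then show ?case using state_step[OF assms, of "time_step n" m \<phi>] time_step[OF assms] by (simp add: step_rate_def distrib_left)
qed simp

lemma limit_equation:
  assumes t: "0 \<le> t" and \<phi>: "test_fun L \<phi>"
  shows "integral\<^sup>L (\<mu> t) \<phi> = integral\<^sup>L \<mu>in \<phi> + (\<integral>u. indicator {0..t} u * rate_lim \<phi> u \<partial>lborel)"
proof -
  define C where "C = L * rate_bound (mass_bound t)"
  have cph: "continuous_on {0<..1} \<phi>" using test_funD(7)[OF \<phi>] by (rule continuous_on_subset) auto
  obtain k0 where k0: "\<And>k. k0 \<le> k \<Longrightarrow> 1 \<le> s k \<and> t \<le> real (s k)"
    using s_large_real[of t] unfolding eventually_sequentially by blast
  let ?I = "\<lambda>k. \<integral>u. indicator {0..t} u * step_rate \<phi> (s k) (stepnum (s k) u) \<partial>lborel"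
  have "(\<lambda>k. ?I (k + k0)) \<longlonglongrightarrow> (\<integral>u. indicator {0..t} u * rate_lim \<phi> u \<partial>lborel)"
  proof (rule integral_dominated_convergence[where w="\<lambda>u. indicator {0..t} u * C"])
    show "(\<lambda>u. indicator {0..t} u * rate_lim \<phi> u) \<in> borel_measurable lborel"
      using rate_lim_measurable[OF \<phi>] by simp
    show "(\<lambda>u. indicator {0..t} u * step_rate \<phi> (s (k + k0)) (stepnum (s (k + k0)) u)) \<in> borel_measurable lborel" for k
      using step_measurable[of "step_rate \<phi> (s (k + k0))"] by (intro borel_measurable_times) auto
    show "integrable lborel (\<lambda>u. indicator {0..t} u * C)"
      by (intro integrable_mult_left integrable_real_indicator) (use t in auto)
    show "AE u in lborel. (\<lambda>k. indicator {0..t} u * step_rate \<phi> (s (k + k0)) (stepnum (s (k + k0)) u)) \<longlonglongrightarrow> indicator {0..t} u * rate_lim \<phi> u"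
    proof (rule AE_I2)
      fix u :: real
      show "(\<lambda>k. indicator {0..t} u * step_rate \<phi> (s (k + k0)) (stepnum (s (k + k0)) u)) \<longlonglongrightarrow> indicator {0..t} u * rate_lim \<phi> u"
      proof (cases "u \<in> {0..t}")
        case True
        then have "(\<lambda>k. step_rate \<phi> (s k) (stepnum (s k) u)) \<longlonglongrightarrow> rate_lim \<phi> u" using step_rate_conv[OF _ \<phi>] by simp
        from LIMSEQ_ignore_initial_segment[OF this, of k0] show ?thesis by (intro tendsto_intros)
      qed simp
    qed
    show "AE u in lborel. norm (indicator {0..t} u * step_rate \<phi> (s (k + k0)) (stepnum (s (k + k0)) u)) \<le> indicator {0..t} u * C" for k
    proof (rule AE_I2)
      fix u :: real
      show "norm (indicator {0..t} u * step_rate \<phi> (s (k + k0)) (stepnum (s (k + k0)) u)) \<le> indicator {0..t} u * C"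
      proof (cases "u \<in> {0..t}")
        case True
        then show ?thesis using step_rate_bound[of "s (k + k0)" t u L \<phi>] k0[of "k + k0"] \<phi> by (simp add: C_def)
      qed simp
    qed
  qed
  then have I: "?I \<longlonglongrightarrow> (\<integral>u. indicator {0..t} u * rate_lim \<phi> u \<partial>lborel)" by (rule LIMSEQ_offset)
  have "(\<lambda>n. \<bar>C\<bar> * (1 / real n)) \<longlonglongrightarrow> \<bar>C\<bar> * 0" by (intro tendsto_intros lim_1_over_n)
  then have "(\<lambda>n. \<bar>C\<bar> * (1 / real n)) \<longlonglongrightarrow> 0" by simp
  from filterlim_compose[OF this filterlim_subseq[OF s]]
  have err: "(\<lambda>k. \<bar>C\<bar> * (1 / real (s k))) \<longlonglongrightarrow> 0" .
  \<comment> \<open>The Euler identity is exact for the state itself; against the integral up to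
    \<open>t\<close> the only error is the incomplete last step, of length at most
    \<open>1 / real n\<close>.\<close>
  have "(\<lambda>k. pairing (s k) (st (s k) t) \<phi> - (pairing (s k) (state (s k) (time_step (s k)) 0) \<phi> + ?I k)) \<longlonglongrightarrow> 0"
  proof (rule tendsto_0_le[OF err, where K=1])
    show "\<forall>\<^sub>F k in sequentially. norm (pairing (s k) (st (s k) t) \<phi> - (pairing (s k) (state (s k) (time_step (s k)) 0) \<phi> + ?I k))
      \<le> norm (\<bar>C\<bar> * (1 / real (s k))) * 1"
      using s_large_real[of t]
    proof eventually_elim
      case (elim k)
      define n where "n = s k"
      have n: "1 \<le> n" "t \<le> real n" using elim by (auto simp: n_def)
      define m where "m = stepnum n t"
      have "?I k = time_step n * (\<Sum>j<m. step_rate \<phi> n j) + (t - real m * time_step n) * step_rate \<phi> n m"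
        using has_bochner_integral_integral_eq[OF step_function_integral[OF time_step(1)[OF n(1)] t, of "step_rate \<phi> n"]]
        by (simp add: stepnum_def n_def m_def)
      then have "pairing n (st n t) \<phi> - (pairing n (state n (time_step n) 0) \<phi> + ?I k) = - ((t - grid_time n t) * step_rate \<phi> n m)"
        using state_telescope[OF n(1), of m \<phi>] by (simp add: st_def m_def grid_time_def)
      moreover have "\<bar>(t - grid_time n t) * step_rate \<phi> n m\<bar> \<le> (1 / real n) * \<bar>C\<bar>"
        unfolding abs_mult
      proof (rule mult_mono)
        show "\<bar>t - grid_time n t\<bar> \<le> 1 / real n" using grid_time[OF n(1) t] time_step(2)[OF n(1)] by simp
        show "\<bar>step_rate \<phi> n m\<bar> \<le> \<bar>C\<bar>" using step_rate_bound[OF n t order_refl \<phi>] by (simp add: C_def m_def)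
      qed auto
      ultimately show ?case by (simp add: n_def mult.commute)
    qed
  qed
  moreover have "(\<lambda>k. pairing (s k) (st (s k) t) \<phi> - (pairing (s k) (state (s k) (time_step (s k)) 0) \<phi> + ?I k))
     \<longlonglongrightarrow> integral\<^sup>L (\<mu> t) \<phi> - (integral\<^sup>L \<mu>in \<phi> + (\<integral>u. indicator {0..t} u * rate_lim \<phi> u \<partial>lborel))"
    by (intro tendsto_diff tendsto_add init_conv[OF \<phi>] I conv_single[OF t cph test_funD(6)[OF \<phi>]])
  ultimately show ?thesis using LIMSEQ_unique by fastforce
qed

lemma rate_lim_eq:
  assumes t: "0 \<le> t" and \<phi>: "test_fun L \<phi>"
  shows "rate_lim \<phi> t = 1/2 * coag_lim \<phi> t - bdry_lim \<phi> t
    + (\<integral>x. fragint \<phi> x - frag_rate x * \<phi> x \<partial>\<mu> t)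
    + (\<integral>x. indicator {0<..1} x * (bint \<kappa>F (datum_pos t) x * \<phi> x) \<partial>lborel)"
proof -
  interpret \<mu>: finite_measure "\<mu> t" by (rule \<mu>_finite[OF t])
  note gw = datum_pos_weight[OF t] and m = test_funD(8)[OF \<phi>]
  have cph: "continuous_on {0<..1} \<phi>" using test_funD(7)[OF \<phi>] by (rule continuous_on_subset) auto
  have int: "integrable (\<mu> t) f" if "continuous_on {0<..1} f" "\<And>x. x \<in> {0<..1} \<Longrightarrow> \<bar>f x\<bar> \<le> B" for f :: "real \<Rightarrow> real" and B
  proof (rule \<mu>.integrable_const_bound[where B=B])
    show "f \<in> borel_measurable (\<mu> t)"
      unfolding \<mu>_measurable[OF t] by (rule continuous_on_unit_measurable(1)[OF that(1)])
  qed (use that in \<open>auto simp: \<mu>_space[OF t] intro!: AE_I2\<close>)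
  have i1: "integrable (\<mu> t) (\<lambda>x. bint K (datum_pos t) x * \<phi> x)"
    by (rule int[OF _ bint_K_test[OF gw \<phi>]]) (intro continuous_intros bint_K_cont gw cph)
  have i2: "integrable (\<mu> t) (\<lambda>x. frag_rate x * \<phi> x)"
  proof (rule int)
    show "\<bar>frag_rate x * \<phi> x\<bar> \<le> F0 * L" if "x \<in> {0<..1}" for x
      using frag_rate[OF that] test_funD(6)[OF \<phi>, of x] by (simp add: abs_mult mult_mono)
  qed (intro continuous_intros frag_rate_cont cph)
  have i3: "integrable (\<mu> t) (fragint \<phi>)"
    by (rule int[OF fragint_cont[OF _ m] fragint_bound[OF _ _ m]]) (use test_funD(6)[OF \<phi>] in auto)
  show ?thesis
    unfolding rate_lim_def coag_lim_def bdry_lim_def distrib_right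
    using i1 i2 i3 by simp
qed

end

section \<open>Continuity in total variation\<close>

text \<open>On the half-line the ramp is concave with value 0 at 0, hence subadditive. Once both
  sizes have passed the threshold it counts particles, and a coagulation removes one.\<close>

lemma ramp_coag_op:
  assumes d: "0 < d" "d \<le> 1" and x: "0 \<le> x" "0 \<le> y"
  shows "coag_op (ramp d) x y \<le> 0" "d \<le> x \<Longrightarrow> d \<le> y \<Longrightarrow> coag_op (ramp d) x y = -1"
proof -
  note [simp] = test_fun_coag_op[OF test_fun_ramp[OF d]]
  have sub: "max 0 (min (a + b) 1) \<le> max 0 (min a 1) + max 0 (min b (1::real))" if "0 \<le> a" "0 \<le> b" for a b
    using that by (auto simp: min_def max_def)
  show "coag_op (ramp d) x y \<le> 0"
  proof -
    have "ramp d (x + y) \<le> ramp d x + ramp d y"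
      unfolding ramp_def add_divide_distrib using d x by (intro sub) auto
    then show ?thesis by simp
  qed
  show "d \<le> x \<Longrightarrow> d \<le> y \<Longrightarrow> coag_op (ramp d) x y = -1"
    using d by (simp add: ramp_one)
qed

lemma coag_op_unit:
  assumes "test_fun L \<phi>" "\<And>x. 0 \<le> \<phi> x" "\<And>x. \<phi> x \<le> 1" shows "\<bar>coag_op \<phi> x y\<bar> \<le> 2"
  unfolding test_fun_coag_op[OF assms(1)]
  using assms(2)[of x] assms(2)[of y] assms(2)[of "x+y"] assms(3)[of x] assms(3)[of y] assms(3)[of "x+y"] by linarith

context bvcf_limit
begin

abbreviation "rmp k \<equiv> ramp (1 / (1 + real k))"

lemma rmp_test: "test_fun (1 + real k) (rmp k)"
  using test_fun_ramp[of "1 / (1 + real k)"] by simp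

lemma rmp_coag_op:
  assumes "x \<in> {0<..1}" "y \<in> {0<..1}"
  shows "coag_op (rmp k) x y \<le> 0" "\<forall>\<^sub>F k in sequentially. coag_op (rmp k) x y = -1"
    "\<forall>\<^sub>F k in sequentially. rmp k x = 1"
proof -
  show "coag_op (rmp k) x y \<le> 0" using assms by (intro ramp_coag_op) auto
  have ev: "\<forall>\<^sub>F k in sequentially. 1 / (1 + real k) \<le> x" if "0 < x" for x :: real
  proof -
    have "(\<lambda>k. 1 / (1 + real k)) \<longlonglongrightarrow> 0" using LIMSEQ_Suc[OF lim_1_over_n] by simp
    from order_tendstoD(2)[OF this that] show ?thesis by eventually_elim simp
  qed
  have evx: "\<forall>\<^sub>F k in sequentially. 1 / (1 + real k) \<le> x" and evy: "\<forall>\<^sub>F k in sequentially. 1 / (1 + real k) \<le> y"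
    using ev assms by auto
  show "\<forall>\<^sub>F k in sequentially. coag_op (rmp k) x y = -1"
    using evx evy by eventually_elim (use assms in \<open>auto intro!: ramp_coag_op\<close>)
  show "\<forall>\<^sub>F k in sequentially. rmp k x = 1"
    using evx by eventually_elim (rule ramp_one, auto)
qed

lemma \<mu>_integrable:
  fixes f :: "real \<Rightarrow> real"
  assumes t: "0 \<le> t" and f: "continuous_on {0<..1} f" "\<And>x. x \<in> {0<..1} \<Longrightarrow> \<bar>f x\<bar> \<le> B"
  shows "integrable (\<mu> t) f"
proof -
  interpret \<mu>: finite_measure "\<mu> t" by (rule \<mu>_finite[OF t])
  show ?thesis
  proof (rule \<mu>.integrable_const_bound[where B=B])
    show "f \<in> borel_measurable (\<mu> t)"
      unfolding \<mu>_measurable[OF t] by (rule continuous_on_unit_measurable(1)[OF f(1)])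
  qed (use f(2) in \<open>auto simp: \<mu>_space[OF t] intro!: AE_I2\<close>)
qed

lemma \<mu>_mass: assumes t: "0 \<le> t" shows "measure (\<mu> t) {0<..1} \<le> mass_bound t"
proof -
  interpret \<mu>: finite_measure "\<mu> t" by (rule \<mu>_finite[OF t])
  interpret Q: real_distribution "Q t" by (rule Q[OF t])
  have "measure (\<mu> t) {0<..1} = integral\<^sup>L (\<mu> t) (\<lambda>_. 1)" using \<mu>_space[OF t] by simp
  also have "\<dots> = mass_bound t * (\<integral>x. indicator {0<..1} x \<partial>Q t)"
    unfolding \<mu>_integral[OF t borel_measurable_const] indicator_def of_bool_def ..
  also have "\<dots> \<le> mass_bound t * 1"
    using mass_bound_ge[OF t] by (intro mult_left_mono) (auto intro: Q.prob_le_1)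
  finally show ?thesis by simp
qed

lemma \<mu>_integral_bound:
  fixes f :: "real \<Rightarrow> real"
  assumes t: "0 \<le> t" and f: "continuous_on {0<..1} f" "\<And>x. x \<in> {0<..1} \<Longrightarrow> \<bar>f x\<bar> \<le> B"
  shows "\<bar>integral\<^sup>L (\<mu> t) f\<bar> \<le> B * mass_bound t"
proof -
  interpret \<mu>: finite_measure "\<mu> t" by (rule \<mu>_finite[OF t])
  have B: "0 \<le> B" using f(2)[of 1] by simp
  have "norm (integral\<^sup>L (\<mu> t) f) \<le> (\<integral>x. B \<partial>\<mu> t)"
    by (rule Bochner_Integration.integral_norm_bound_integral[OF \<mu>_integrable[OF t f]])
      (use f(2) in \<open>auto simp: \<mu>_space[OF t]\<close>)
  also have "\<dots> = B * measure (\<mu> t) {0<..1}" using \<mu>_space[OF t] by simp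
  also have "\<dots> \<le> B * mass_bound t" using \<mu>_mass[OF t] B by (rule mult_left_mono)
  finally show ?thesis by simp
qed

lemma source_lim:
  assumes t: "0 \<le> t" and f: "f \<in> borel_measurable borel" "\<And>x. x \<in> {0<..1} \<Longrightarrow> \<bar>f x\<bar> \<le> B"
  shows "integrable lborel (\<lambda>x. indicator {0<..1} x * (bint \<kappa>F (datum_pos t) x * f x))"
    "\<bar>\<integral>x. indicator {0<..1} x * (bint \<kappa>F (datum_pos t) x * f x) \<partial>lborel\<bar> \<le> 2 * F0 * M * B"
proof -
  note gw = datum_pos_weight[OF t]
  have m: "(\<lambda>x. indicator {0<..1} x * (bint \<kappa>F (datum_pos t) x * f x)) \<in> borel_measurable lborel"
  proof -
    have "(\<lambda>x. (indicator {0<..1} x * bint \<kappa>F (datum_pos t) x) * f x) \<in> borel_measurable lborel"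
      using borel_measurable_integrable[OF bint_F_integrable[OF gw(1)]] f(1)
      by (intro borel_measurable_times[of "\<lambda>x. indicator {0<..1} x * bint \<kappa>F (datum_pos t) x"]) auto
    then show ?thesis by (simp add: mult.assoc)
  qed
  have pt: "norm (indicator {0<..1} x * (bint \<kappa>F (datum_pos t) x * f x)) \<le> indicator {0<..1} x * (2 * F0 * M * B)" for x
  proof (cases "x \<in> {0<..1}")
    case True
    have "\<bar>bint \<kappa>F (datum_pos t) x\<bar> \<le> 2 * F0 * M"
      using bint_bound[OF bdry_kernel_F gw(1) True] mult_left_mono[OF gw(2), of "2 * F0"] F0 by simp
    then have "\<bar>bint \<kappa>F (datum_pos t) x\<bar> * \<bar>f x\<bar> \<le> 2 * F0 * M * B"
      using f(2)[OF True] F0 M_nonneg by (intro mult_mono) auto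
    then show ?thesis using True by (simp add: abs_mult)
  qed simp
  have i2: "integrable lborel (\<lambda>x. indicator {0<..1::real} x * (2 * F0 * M * B))"
    by (intro integrable_mult_left integrable_real_indicator) auto
  show i1: "integrable lborel (\<lambda>x. indicator {0<..1} x * (bint \<kappa>F (datum_pos t) x * f x))"
    by (rule Bochner_Integration.integrable_bound[OF i2 m])
      (rule AE_I2, rule order_trans[OF pt], simp only: real_norm_def abs_ge_self)
  have "norm (\<integral>x. indicator {0<..1} x * (bint \<kappa>F (datum_pos t) x * f x) \<partial>lborel) \<le> (\<integral>x. indicator {0<..1::real} x * (2 * F0 * M * B) \<partial>lborel)"
    by (rule Bochner_Integration.integral_norm_bound_integral[OF i1 i2 pt])
  then show "\<bar>\<integral>x. indicator {0<..1} x * (bint \<kappa>F (datum_pos t) x * f x) \<partial>lborel\<bar> \<le> 2 * F0 * M * B" by simp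
qed

text \<open>Collects fragmentation and the boundary source: gain 2 F0 and loss F0 per particle, and
  2 F0 M from the source. For test functions with values in [0,1] no Lipschitz constant
  enters.\<close>

definition "rem_bound T = 3 * F0 * mass_bound T + 2 * F0 * M"

lemma rem_bound:
  assumes t: "0 \<le> t" "t \<le> T" and \<phi>: "test_fun L \<phi>" "\<And>x. 0 \<le> \<phi> x" "\<And>x. \<phi> x \<le> 1"
  shows "\<bar>rate_lim \<phi> t - (1/2 * coag_lim \<phi> t - bdry_lim \<phi> t)\<bar> \<le> rem_bound T"
proof -
  note m = test_funD(8)[OF \<phi>(1)]
  have \<phi>1: "\<bar>\<phi> x\<bar> \<le> 1" for x using \<phi>(2,3)[of x] by simp
  have cph: "continuous_on {0<..1} \<phi>" using test_funD(7)[OF \<phi>(1)] by (rule continuous_on_subset) auto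
  have "\<bar>\<integral>x. fragint \<phi> x - frag_rate x * \<phi> x \<partial>\<mu> t\<bar> \<le> (3 * F0) * mass_bound t"
  proof (rule \<mu>_integral_bound[OF t(1)])
    show "continuous_on {0<..1} (\<lambda>x. fragint \<phi> x - frag_rate x * \<phi> x)"
      by (intro continuous_intros fragint_cont[OF _ m] frag_rate_cont cph) (rule \<phi>1)
    show "\<bar>fragint \<phi> x - frag_rate x * \<phi> x\<bar> \<le> 3 * F0" if x: "x \<in> {0<..1}" for x
    proof -
      have "\<bar>frag_rate x * \<phi> x\<bar> \<le> F0 * 1" unfolding abs_mult using frag_rate[OF x] \<phi>1 F0 by (intro mult_mono) auto
      then show ?thesis using fragint_bound[OF x \<phi>1 m] by simp
    qed
  qed
  also have "\<dots> \<le> 3 * F0 * mass_bound T" using mass_bound_mono[OF t] F0 by (intro mult_left_mono) auto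
  finally show ?thesis using source_lim(2)[OF t(1) m \<phi>1] unfolding rate_lim_eq[OF t(1) \<phi>(1)] rem_bound_def by simp
qed

lemma bdry_lim_nonneg: "0 \<le> t \<Longrightarrow> (\<And>x. 0 \<le> \<phi> x) \<Longrightarrow> 0 \<le> bdry_lim \<phi> t"
  unfolding bdry_lim_def
  by (rule integral_nonneg_AE) (auto simp: \<mu>_space intro!: AE_I2 mult_nonneg_nonneg bint_K_nonneg datum_pos_weight)

lemma coag_lim_rmp:
  assumes t: "0 \<le> t" shows "coag_lim (rmp k) t \<le> 0"
proof -
  have "0 \<le> integral\<^sup>L (\<mu> t \<Otimes>\<^sub>M \<mu> t) (\<lambda>p. - (case p of (x,y) \<Rightarrow> K x y * coag_op (rmp k) x y))"
  proof (rule integral_nonneg_AE, rule AE_I2)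
    fix p assume "p \<in> space (\<mu> t \<Otimes>\<^sub>M \<mu> t)"
    then obtain x y where p: "p = (x,y)" "x \<in> {0<..1}" "y \<in> {0<..1}" by (auto simp: space_pair_measure \<mu>_space[OF t])
    then show "0 \<le> - (case p of (x,y) \<Rightarrow> K x y * coag_op (rmp k) x y)"
      using K_nonneg[of x y] rmp_coag_op(1)[of x y k] by (simp add: mult_nonneg_nonpos)
  qed
  then show ?thesis by (simp add: coag_lim_def)
qed

lemma pair_integrable:
  assumes t: "0 \<le> t" and \<phi>: "test_fun L \<phi>"
  shows "integrable (\<mu> t \<Otimes>\<^sub>M \<mu> t) (\<lambda>(x,y). K x y * coag_op \<phi> x y)"
  by (rule pair_integral(1)[OF t K_coag_cont[OF \<phi>] K_coag_le[OF \<phi>]])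

lemma bdry_integrable:
  assumes t: "0 \<le> t" and \<phi>: "test_fun L \<phi>"
  shows "integrable (\<mu> t) (\<lambda>x. bint K (datum_pos t) x * \<phi> x)"
proof -
  have cph: "continuous_on {0<..1} \<phi>" using test_funD(7)[OF \<phi>] by (rule continuous_on_subset) auto
  show ?thesis
    by (rule \<mu>_integrable[OF t _ bint_K_test[OF datum_pos_weight[OF t] \<phi>]]) (intro continuous_intros bint_K_cont datum_pos_weight t cph)
qed

text \<open>By Fatou's lemma along \<open>rmp k\<close>, for which the coagulation bracket tends to \<open>-1\<close>.\<close>

lemma coag_lim_le:
  assumes t: "0 \<le> t" and \<phi>: "test_fun L \<phi>" "\<And>x. 0 \<le> \<phi> x" "\<And>x. \<phi> x \<le> 1"
  shows "ennreal \<bar>1/2 * coag_lim \<phi> t\<bar> \<le> liminf (\<lambda>k. ennreal (- coag_lim (rmp k) t))"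
proof -
  let ?N = "\<mu> t \<Otimes>\<^sub>M \<mu> t"
  let ?f = "\<lambda>\<phi> p. case p of (x,y) \<Rightarrow> K x y * coag_op \<phi> x y"
  have int: "integrable ?N (?f \<phi>)" "integrable ?N (?f (rmp k))" for k
    using pair_integrable[OF t \<phi>(1)] pair_integrable[OF t rmp_test] by auto
  have meas: "?f (rmp k) \<in> borel_measurable ?N" for k by (rule borel_measurable_integrable[OF int(2)])
  have "\<bar>1/2 * coag_lim \<phi> t\<bar> \<le> (\<integral>p. 1/2 * \<bar>?f \<phi> p\<bar> \<partial>?N)"
    using integral_abs_bound[of ?N "?f \<phi>"] by (simp add: coag_lim_def abs_mult)
  then have "ennreal \<bar>1/2 * coag_lim \<phi> t\<bar> \<le> ennreal (\<integral>p. 1/2 * \<bar>?f \<phi> p\<bar> \<partial>?N)" by (rule ennreal_leI)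
  also have "\<dots> = (\<integral>\<^sup>+p. ennreal (1/2 * \<bar>?f \<phi> p\<bar>) \<partial>?N)"
    using int(1) by (intro nn_integral_eq_integral[symmetric]) auto
  also have "\<dots> \<le> (\<integral>\<^sup>+p. liminf (\<lambda>k. ennreal (- ?f (rmp k) p)) \<partial>?N)"
  proof (rule nn_integral_mono)
    fix p assume "p \<in> space ?N"
    then obtain x y where p: "p = (x,y)" "x \<in> {0<..1}" "y \<in> {0<..1}" by (auto simp: space_pair_measure \<mu>_space[OF t])
    have Kn: "0 \<le> K x y" using p by (intro K_nonneg) auto
    have "\<forall>\<^sub>F k in sequentially. ennreal (- ?f (rmp k) p) = ennreal (K x y)"
      using rmp_coag_op(2)[OF p(2,3)] by eventually_elim (simp add: p(1))
    then have "(\<lambda>k. ennreal (- ?f (rmp k) p)) \<longlonglongrightarrow> ennreal (K x y)" by (rule tendsto_eventually)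
    then have "liminf (\<lambda>k. ennreal (- ?f (rmp k) p)) = ennreal (K x y)" by (intro lim_imp_Liminf) auto
    moreover have "1/2 * \<bar>?f \<phi> p\<bar> \<le> K x y"
      using coag_op_unit[OF \<phi>, of x y] mult_left_mono[of "\<bar>coag_op \<phi> x y\<bar>" 2 "K x y"] Kn by (simp add: p(1) abs_mult)
    ultimately show "ennreal (1/2 * \<bar>?f \<phi> p\<bar>) \<le> liminf (\<lambda>k. ennreal (- ?f (rmp k) p))"
      by (simp add: ennreal_leI)
  qed
  also have "\<dots> \<le> liminf (\<lambda>k. \<integral>\<^sup>+p. ennreal (- ?f (rmp k) p) \<partial>?N)"
    by (rule nn_integral_liminf) (intro measurable_compose[OF _ measurable_ennreal] borel_measurable_uminus meas)
  also have "(\<lambda>k. \<integral>\<^sup>+p. ennreal (- ?f (rmp k) p) \<partial>?N) = (\<lambda>k. ennreal (- coag_lim (rmp k) t))"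
  proof (rule ext)
    fix k
    have "(\<integral>\<^sup>+p. ennreal (- ?f (rmp k) p) \<partial>?N) = ennreal (\<integral>p. - ?f (rmp k) p \<partial>?N)"
    proof (rule nn_integral_eq_integral)
      show "integrable ?N (\<lambda>p. - ?f (rmp k) p)" using int(2) by (rule integrable_minus)
      show "AE p in ?N. 0 \<le> - ?f (rmp k) p"
      proof (rule AE_I2)
        fix p assume "p \<in> space ?N"
        then obtain x y where p: "p = (x,y)" "x \<in> {0<..1}" "y \<in> {0<..1}" by (auto simp: space_pair_measure \<mu>_space[OF t])
        then show "0 \<le> - ?f (rmp k) p"
          using K_nonneg[of x y] rmp_coag_op(1)[of x y k] by (simp add: mult_nonneg_nonpos)
      qed
    qed
    then show "(\<integral>\<^sup>+p. ennreal (- ?f (rmp k) p) \<partial>?N) = ennreal (- coag_lim (rmp k) t)"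
      by (simp add: coag_lim_def)
  qed
  finally show ?thesis .
qed

text \<open>Fatou's lemma once more: here \<open>rmp k\<close> tends to 1, so the integrands tend to
  the full loss to outer particles, which dominates the loss seen by \<open>\<phi>\<close>.\<close>

lemma bdry_lim_le:
  assumes t: "0 \<le> t" and \<phi>: "test_fun L \<phi>" "\<And>x. 0 \<le> \<phi> x" "\<And>x. \<phi> x \<le> 1"
  shows "ennreal \<bar>bdry_lim \<phi> t\<bar> \<le> liminf (\<lambda>k. ennreal (bdry_lim (rmp k) t))"
proof -
  let ?b = "bint K (datum_pos t)"
  have b: "0 \<le> ?b x" if "x \<in> {0<..1}" for x using bint_K_nonneg[OF datum_pos_weight(1)[OF t] that] .
  have eq: "ennreal (bdry_lim \<psi> t) = (\<integral>\<^sup>+x. ennreal (?b x * \<psi> x) \<partial>\<mu> t)"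
    if "test_fun L' \<psi>" "\<And>x. 0 \<le> \<psi> x" for \<psi> L'
    unfolding bdry_lim_def using bdry_integrable[OF t that(1)] b that(2)
    by (intro nn_integral_eq_integral[symmetric]) (auto simp: \<mu>_space[OF t] intro!: AE_I2)
  have "ennreal \<bar>bdry_lim \<phi> t\<bar> = (\<integral>\<^sup>+x. ennreal (?b x * \<phi> x) \<partial>\<mu> t)"
    using bdry_lim_nonneg[OF t \<phi>(2)] eq[OF \<phi>(1,2)] by simp
  also have "\<dots> \<le> (\<integral>\<^sup>+x. liminf (\<lambda>k. ennreal (?b x * rmp k x)) \<partial>\<mu> t)"
  proof (rule nn_integral_mono)
    fix x assume "x \<in> space (\<mu> t)"
    then have x: "x \<in> {0<..1}" by (simp add: \<mu>_space[OF t])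
    have "\<forall>\<^sub>F k in sequentially. ennreal (?b x * rmp k x) = ennreal (?b x)"
      using rmp_coag_op(3)[OF x x] by eventually_elim simp
    then have "(\<lambda>k. ennreal (?b x * rmp k x)) \<longlonglongrightarrow> ennreal (?b x)" by (rule tendsto_eventually)
    then have "liminf (\<lambda>k. ennreal (?b x * rmp k x)) = ennreal (?b x)" by (intro lim_imp_Liminf) auto
    moreover have "?b x * \<phi> x \<le> ?b x" using mult_left_mono[OF \<phi>(3) b[OF x], of x] by simp
    ultimately show "ennreal (?b x * \<phi> x) \<le> liminf (\<lambda>k. ennreal (?b x * rmp k x))" by (simp add: ennreal_leI)
  qed
  also have "\<dots> \<le> liminf (\<lambda>k. \<integral>\<^sup>+x. ennreal (?b x * rmp k x) \<partial>\<mu> t)"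
    by (rule nn_integral_liminf)
      (intro measurable_compose[OF _ measurable_ennreal] borel_measurable_integrable[OF bdry_integrable[OF t rmp_test]])
  also have "(\<lambda>k. \<integral>\<^sup>+x. ennreal (?b x * rmp k x) \<partial>\<mu> t) = (\<lambda>k. ennreal (bdry_lim (rmp k) t))"
    using eq[OF rmp_test ramp(1)] by simp
  finally show ?thesis .
qed

text \<open>The pairing with \<open>rmp k\<close> starts at most at \<open>m0\<close> and never
  becomes negative, so the losses up to \<open>T\<close> cannot exceed the initial mass plus the
  gains. The bound is independent of \<open>k\<close>, although the Lipschitz constant of
  \<open>rmp k\<close> grows.\<close>

lemma rmp_budget:
  assumes T: "0 \<le> T"
  shows "(\<integral>\<^sup>+t. ennreal (indicator {0..T} t * (rem_bound T - rate_lim (rmp k) t)) \<partial>lborel) \<le> ennreal (rem_bound T * T + m0)"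
    and "t \<in> {0..T} \<Longrightarrow> - (1/2 * coag_lim (rmp k) t) \<le> rem_bound T - rate_lim (rmp k) t"
    and "t \<in> {0..T} \<Longrightarrow> bdry_lim (rmp k) t \<le> rem_bound T - rate_lim (rmp k) t"
proof -
  have rb: "- (1/2 * coag_lim (rmp k) t) + bdry_lim (rmp k) t \<le> rem_bound T - rate_lim (rmp k) t" if "t \<in> {0..T}" for t
  proof -
    have "\<bar>rate_lim (rmp k) t - (1/2 * coag_lim (rmp k) t - bdry_lim (rmp k) t)\<bar> \<le> rem_bound T"
      by (rule rem_bound[OF _ _ rmp_test ramp]) (use that in auto)
    then show ?thesis by linarith
  qed
  show b1: "t \<in> {0..T} \<Longrightarrow> - (1/2 * coag_lim (rmp k) t) \<le> rem_bound T - rate_lim (rmp k) t" for t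
    using rb[of t] bdry_lim_nonneg[of t "rmp k", OF _ ramp(1)] by simp
  show "t \<in> {0..T} \<Longrightarrow> bdry_lim (rmp k) t \<le> rem_bound T - rate_lim (rmp k) t" for t
    using rb[of t] coag_lim_rmp[of t k] by simp
  have i: "integrable lborel (\<lambda>t. indicator {0..T} t * rem_bound T - indicator {0..T} t * rate_lim (rmp k) t)"
    by (intro Bochner_Integration.integrable_diff rate_lim_integrable[OF T rmp_test] integrable_mult_left integrable_real_indicator)
      (use T in auto)
  have nn: "0 \<le> indicator {0..T} t * rem_bound T - indicator {0..T} t * rate_lim (rmp k) t" for t
    using b1[of t] coag_lim_rmp[of t k] by (cases "t \<in> {0..T}") auto
  have "(\<integral>\<^sup>+t. ennreal (indicator {0..T} t * (rem_bound T - rate_lim (rmp k) t)) \<partial>lborel)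
    = ennreal (\<integral>t. indicator {0..T} t * rem_bound T - indicator {0..T} t * rate_lim (rmp k) t \<partial>lborel)"
    unfolding right_diff_distrib using i nn by (intro nn_integral_eq_integral) auto
  also have "(\<integral>t. indicator {0..T} t * rem_bound T - indicator {0..T} t * rate_lim (rmp k) t \<partial>lborel)
    = rem_bound T * T - (integral\<^sup>L (\<mu> T) (rmp k) - integral\<^sup>L \<mu>in (rmp k))"
    unfolding limit_equation[OF T rmp_test]
    by (subst Bochner_Integration.integral_diff)
      (use T in \<open>auto intro!: rate_lim_integrable[OF T rmp_test] integrable_real_indicator\<close>)
  also have "ennreal \<dots> \<le> ennreal (rem_bound T * T + m0)"
  proof (rule ennreal_leI)
    interpret \<mu>0: finite_measure \<mu>0 by (rule \<mu>0_finite)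
    have "integral\<^sup>L \<mu>in (rmp k) = integral\<^sup>L \<mu>0 (rmp k)"
      using test_funD(8)[OF rmp_test] by (simp add: integral_\<mu>0)
    also have "\<dots> \<le> integral\<^sup>L \<mu>0 (\<lambda>_. 1)"
      using ramp test_funD(8)[OF rmp_test] by (intro integral_mono \<mu>0.integrable_const_bound[where B=1]) auto
    also have "\<dots> = m0" using sets_eq_imp_space_eq[OF \<mu>0_sets] by (simp add: m0_def)
    finally have "integral\<^sup>L \<mu>in (rmp k) \<le> m0" .
    moreover have "0 \<le> integral\<^sup>L (\<mu> T) (rmp k)" by (intro Bochner_Integration.integral_nonneg ramp)
    ultimately show "rem_bound T * T - (integral\<^sup>L (\<mu> T) (rmp k) - integral\<^sup>L \<mu>in (rmp k)) \<le> rem_bound T * T + m0" by linarith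
  qed
  finally show "(\<integral>\<^sup>+t. ennreal (indicator {0..T} t * (rem_bound T - rate_lim (rmp k) t)) \<partial>lborel) \<le> ennreal (rem_bound T * T + m0)" .
qed

text \<open>The limit inferior is measurable in time by construction, and Fatou's lemma bounds its
  integral. Where it is infinite, \<open>enn2real\<close> returns 0; the second claim confines this
  default to a null set.\<close>

lemma liminf_integrable:
  fixes f :: "nat \<Rightarrow> real \<Rightarrow> real"
  assumes m: "\<And>k. f k \<in> borel_measurable borel" and b: "\<And>k. (\<integral>\<^sup>+t. ennreal (f k t) \<partial>lborel) \<le> ennreal D"
  shows "integrable lborel (\<lambda>t. enn2real (liminf (\<lambda>k. ennreal (f k t))))"
    "AE t in lborel. ennreal (enn2real (liminf (\<lambda>k. ennreal (f k t)))) = liminf (\<lambda>k. ennreal (f k t))"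
proof -
  note m[measurable]
  have Z[measurable]: "(\<lambda>t. liminf (\<lambda>k. ennreal (f k t))) \<in> borel_measurable lborel" by measurable
  have "(\<integral>\<^sup>+t. liminf (\<lambda>k. ennreal (f k t)) \<partial>lborel) \<le> liminf (\<lambda>k. \<integral>\<^sup>+t. ennreal (f k t) \<partial>lborel)"
    by (rule nn_integral_liminf) measurable
  also have "\<dots> \<le> ennreal D" using b by (intro Liminf_le) auto
  finally have le: "(\<integral>\<^sup>+t. liminf (\<lambda>k. ennreal (f k t)) \<partial>lborel) \<le> ennreal D" .
  then have "(\<integral>\<^sup>+t. liminf (\<lambda>k. ennreal (f k t)) \<partial>lborel) \<noteq> \<infinity>" by (auto simp: top_unique)
  from nn_integral_PInf_AE[OF Z this]
  show ae: "AE t in lborel. ennreal (enn2real (liminf (\<lambda>k. ennreal (f k t)))) = liminf (\<lambda>k. ennreal (f k t))"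
    by eventually_elim (simp add: less_top)
  have "(\<integral>\<^sup>+t. ennreal (enn2real (liminf (\<lambda>k. ennreal (f k t)))) \<partial>lborel) = (\<integral>\<^sup>+t. liminf (\<lambda>k. ennreal (f k t)) \<partial>lborel)"
    by (rule nn_integral_cong_AE[OF ae])
  also note le
  finally show "integrable lborel (\<lambda>t. enn2real (liminf (\<lambda>k. ennreal (f k t))))"
    by (intro integrableI_nonneg) (auto intro: le_less_trans[OF _ ennreal_less_top])
qed

text \<open>The function \<open>z\<close> is chosen before the test function and its Lipschitz
  constant; this uniformity is the gain over \<open>rate_lim_bound\<close>. It adds the limits
  inferior of the two tested losses and the bounded remainder.\<close>

lemma rate_lim_dominated:
  assumes T: "0 \<le> T"
  shows "\<exists>z. integrable lborel z \<and> (\<forall>t. 0 \<le> z t) \<and>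
    (\<forall>L \<phi>. test_fun L \<phi> \<longrightarrow> (\<forall>x. 0 \<le> \<phi> x) \<longrightarrow> (\<forall>x. \<phi> x \<le> 1) \<longrightarrow>
      (AE t in lborel. t \<in> {0..T} \<longrightarrow> \<bar>rate_lim \<phi> t\<bar> \<le> z t))"
proof -
  define f1 where "f1 k t = - (indicator {0..T} t * coag_lim (rmp k) t)" for k t
  define f2 where "f2 k t = indicator {0..T} t * bdry_lim (rmp k) t" for k t
  define Z1 where "Z1 t = liminf (\<lambda>k. ennreal (f1 k t))" for t
  define Z2 where "Z2 t = liminf (\<lambda>k. ennreal (f2 k t))" for t
  define D where "D = rem_bound T * T + m0"
  have m1: "f1 k \<in> borel_measurable borel" and m2: "f2 k \<in> borel_measurable borel" for k
    unfolding f1_def f2_def using coag_lim_measurable[OF rmp_test] bdry_lim_measurable[OF rmp_test]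
    by (auto intro!: borel_measurable_uminus)
  have rm: "(\<lambda>t. indicator {0..T} t * (rem_bound T - rate_lim (rmp k) t)) \<in> borel_measurable lborel" for k
  proof -
    have "(\<lambda>t. indicator {0..T} t * rem_bound T - indicator {0..T} t * rate_lim (rmp k) t) \<in> borel_measurable borel"
      by (rule borel_measurable_diff[OF _ rate_lim_measurable[OF rmp_test]]) simp
    then show ?thesis by (simp add: right_diff_distrib)
  qed
  \<comment> \<open>The factor 2 undoes the 1/2 in front of the coagulation term.\<close>
  have b1: "(\<integral>\<^sup>+t. ennreal (f1 k t) \<partial>lborel) \<le> ennreal (2 * D)" for k
  proof -
    have "(\<integral>\<^sup>+t. ennreal (f1 k t) \<partial>lborel) \<le> (\<integral>\<^sup>+t. 2 * ennreal (indicator {0..T} t * (rem_bound T - rate_lim (rmp k) t)) \<partial>lborel)"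
    proof (rule nn_integral_mono)
      fix t
      have "f1 k t \<le> 2 * (indicator {0..T} t * (rem_bound T - rate_lim (rmp k) t))"
        using rmp_budget(2)[OF T, of t k] by (cases "t \<in> {0..T}") (auto simp: f1_def)
      then have "ennreal (f1 k t) \<le> ennreal (2 * (indicator {0..T} t * (rem_bound T - rate_lim (rmp k) t)))"
        by (rule ennreal_leI)
      then show "ennreal (f1 k t) \<le> 2 * ennreal (indicator {0..T} t * (rem_bound T - rate_lim (rmp k) t))"
        by (simp add: ennreal_mult')
    qed
    also have "\<dots> = 2 * (\<integral>\<^sup>+t. ennreal (indicator {0..T} t * (rem_bound T - rate_lim (rmp k) t)) \<partial>lborel)"
      by (rule nn_integral_cmult) (use rm in measurable)
    also have "\<dots> \<le> 2 * ennreal D" unfolding D_def by (intro mult_left_mono rmp_budget(1)[OF T]) auto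
    finally show ?thesis by (simp add: ennreal_mult')
  qed
  have b2: "(\<integral>\<^sup>+t. ennreal (f2 k t) \<partial>lborel) \<le> ennreal D" for k
  proof -
    have "(\<integral>\<^sup>+t. ennreal (f2 k t) \<partial>lborel) \<le> (\<integral>\<^sup>+t. ennreal (indicator {0..T} t * (rem_bound T - rate_lim (rmp k) t)) \<partial>lborel)"
    proof (rule nn_integral_mono, rule ennreal_leI)
      fix t
      show "f2 k t \<le> indicator {0..T} t * (rem_bound T - rate_lim (rmp k) t)"
        using rmp_budget(3)[OF T, of t k] by (cases "t \<in> {0..T}") (auto simp: f2_def)
    qed
    also have "\<dots> \<le> ennreal D" unfolding D_def by (rule rmp_budget(1)[OF T])
    finally show ?thesis .
  qed
  have i1: "integrable lborel (\<lambda>t. enn2real (Z1 t))" "AE t in lborel. ennreal (enn2real (Z1 t)) = Z1 t"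
    unfolding Z1_def by (rule liminf_integrable[OF m1 b1])+
  have i2: "integrable lborel (\<lambda>t. enn2real (Z2 t))" "AE t in lborel. ennreal (enn2real (Z2 t)) = Z2 t"
    unfolding Z2_def by (rule liminf_integrable[OF m2 b2])+
  define C where "C = rem_bound T"
  have C: "0 \<le> C" unfolding C_def rem_bound_def using F0 M_nonneg mass_bound_ge[OF T] by simp
  define z where "z t = enn2real (Z1 t) + enn2real (Z2 t) + indicator {0..T} t * C" for t
  show ?thesis
  proof (intro exI[of _ z] conjI allI impI)
    show "integrable lborel z" unfolding z_def
      by (intro Bochner_Integration.integrable_add i1(1) i2(1) integrable_mult_left integrable_real_indicator) (use T in auto)
    show "0 \<le> z t" for t using C by (simp add: z_def)
    fix L \<phi> assume *: "test_fun L \<phi>" "\<forall>x. 0 \<le> \<phi> x" "\<forall>x. \<phi> x \<le> 1"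
    note \<phi> = *(1) *(2)[rule_format] *(3)[rule_format]
    show "AE t in lborel. t \<in> {0..T} \<longrightarrow> \<bar>rate_lim \<phi> t\<bar> \<le> z t"
      using i1(2) i2(2)
    proof eventually_elim
      case (elim t)
      show ?case
      proof
        assume t: "t \<in> {0..T}"
        have "ennreal \<bar>1/2 * coag_lim \<phi> t\<bar> \<le> Z1 t"
          using coag_lim_le[of t, OF _ \<phi>] t unfolding Z1_def f1_def by simp
        then have "ennreal \<bar>1/2 * coag_lim \<phi> t\<bar> \<le> ennreal (enn2real (Z1 t))" by (subst elim(1))
        then have 1: "\<bar>1/2 * coag_lim \<phi> t\<bar> \<le> enn2real (Z1 t)" by (rule ennreal_le_iff[OF enn2real_nonneg, THEN iffD1])
        have "ennreal \<bar>bdry_lim \<phi> t\<bar> \<le> Z2 t"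
          using bdry_lim_le[of t, OF _ \<phi>] t unfolding Z2_def f2_def by simp
        then have "ennreal \<bar>bdry_lim \<phi> t\<bar> \<le> ennreal (enn2real (Z2 t))" by (subst elim(2))
        then have 2: "\<bar>bdry_lim \<phi> t\<bar> \<le> enn2real (Z2 t)" by (rule ennreal_le_iff[OF enn2real_nonneg, THEN iffD1])
        have "\<bar>rate_lim \<phi> t - (1/2 * coag_lim \<phi> t - bdry_lim \<phi> t)\<bar> \<le> C"
          unfolding C_def using t by (intro rem_bound[OF _ _ \<phi>]) auto
        with 1 2 t show "\<bar>rate_lim \<phi> t\<bar> \<le> z t" unfolding z_def by simp
      qed
    qed
  qed
qed

lemma test_increment:
  assumes z: "integrable lborel z" "\<And>t. 0 \<le> z t"
    and dom: "AE t in lborel. t \<in> {0..T} \<longrightarrow> \<bar>rate_lim \<phi> t\<bar> \<le> z t"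
    and \<phi>: "test_fun L \<phi>" and ab: "0 \<le> a" "a \<le> b" "b \<le> T"
  shows "\<bar>integral\<^sup>L (\<mu> b) \<phi> - integral\<^sup>L (\<mu> a) \<phi>\<bar> \<le> (\<integral>t. indicator {a..b} t * z t \<partial>lborel)"
proof -
  have ib: "integrable lborel (\<lambda>t. indicator {0..b} t * rate_lim \<phi> t)"
    and ia: "integrable lborel (\<lambda>t. indicator {0..a} t * rate_lim \<phi> t)"
    using rate_lim_integrable[OF _ \<phi>] ab by auto
  have "integral\<^sup>L (\<mu> b) \<phi> - integral\<^sup>L (\<mu> a) \<phi>
      = (\<integral>t. indicator {0..b} t * rate_lim \<phi> t - indicator {0..a} t * rate_lim \<phi> t \<partial>lborel)"
    using limit_equation[OF _ \<phi>, of a] limit_equation[OF _ \<phi>, of b] ab Bochner_Integration.integral_diff[OF ib ia] by simp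
  then have "\<bar>integral\<^sup>L (\<mu> b) \<phi> - integral\<^sup>L (\<mu> a) \<phi>\<bar>
      \<le> (\<integral>t. \<bar>indicator {0..b} t * rate_lim \<phi> t - indicator {0..a} t * rate_lim \<phi> t\<bar> \<partial>lborel)"
    by (simp only: integral_abs_bound)
  also have "\<dots> \<le> (\<integral>t. indicator {a..b} t * z t \<partial>lborel)"
  proof (rule integral_mono_AE)
    show "integrable lborel (\<lambda>t. \<bar>indicator {0..b} t * rate_lim \<phi> t - indicator {0..a} t * rate_lim \<phi> t\<bar>)"
      using ia ib by (intro integrable_abs Bochner_Integration.integrable_diff)
    show "integrable lborel (\<lambda>t. indicator {a..b} t * z t)"
      using integrable_real_mult_indicator[OF _ z(1), of "{a..b}"] by (simp add: mult.commute)
    show "AE t in lborel. \<bar>indicator {0..b} t * rate_lim \<phi> t - indicator {0..a} t * rate_lim \<phi> t\<bar> \<le> indicator {a..b} t * z t"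
      using dom by eventually_elim (use ab z(2) in \<open>auto simp: indicator_def\<close>)
  qed
  finally show ?thesis .
qed

end

text \<open>The partition is split according to the sign of the difference. Each part sums to the
  difference on one measurable set, the union of the part, so each contributes at most
  \<open>R\<close>.\<close>

lemma tv_dist_le:
  assumes \<mu>: "\<mu> \<in> finite_measures" and \<nu>: "\<nu> \<in> finite_measures"
    and R: "\<And>A. A \<in> sets (restrict_space borel {0<..1::real}) \<Longrightarrow> \<bar>measure \<mu> A - measure \<nu> A\<bar> \<le> R"
  shows "0 \<le> tv_dist \<mu> \<nu>" "tv_dist \<mu> \<nu> \<le> 2 * R"
proof -
  let ?S = "sets (restrict_space borel {0<..1::real})"
  let ?PP = "{P. finite P \<and> partition_on {0<..1} P \<and> P \<subseteq> ?S}"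
  interpret \<mu>: finite_measure \<mu> using \<mu> by (simp add: finite_measures_def)
  interpret \<nu>: finite_measure \<nu> using \<nu> by (simp add: finite_measures_def)
  have S: "sets \<mu> = ?S" "sets \<nu> = ?S" using \<mu> \<nu> by (auto simp: finite_measures_def)
  have bound: "(\<Sum>A\<in>P. \<bar>measure \<mu> A - measure \<nu> A\<bar>) \<le> 2 * R" if P: "P \<in> ?PP" for P
  proof -
    have part: "\<bar>\<Sum>A\<in>P'. (measure \<mu> A - measure \<nu> A)\<bar> \<le> R" if P': "P' \<subseteq> P" for P'
    proof -
      have fin: "finite P'" and sub: "P' \<subseteq> ?S" using P P' finite_subset by auto
      have disj: "disjoint_family_on (\<lambda>A. A) P'"
      proof -
        have "disjoint P" using P by (simp add: partition_on_def)
        then show ?thesis using P' unfolding disjoint_family_on_def disjoint_def by blast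
      qed
      have "(\<Sum>A\<in>P'. measure \<mu> A) = measure \<mu> (\<Union>A\<in>P'. A)"
        by (rule \<mu>.finite_measure_finite_Union[symmetric]) (use fin sub S disj in auto)
      moreover have "(\<Sum>A\<in>P'. measure \<nu> A) = measure \<nu> (\<Union>A\<in>P'. A)"
        by (rule \<nu>.finite_measure_finite_Union[symmetric]) (use fin sub S disj in auto)
      moreover have "(\<Union>A\<in>P'. A) \<in> ?S" using fin sub by (intro sets.finite_UN) auto
      ultimately show ?thesis using R by (simp add: sum_subtractf)
    qed
    define Pp where "Pp = {A\<in>P. measure \<nu> A \<le> measure \<mu> A}"
    have fin: "finite P" using P by simp
    have "(\<Sum>A\<in>P. \<bar>measure \<mu> A - measure \<nu> A\<bar>)
        = (\<Sum>A\<in>Pp. \<bar>measure \<mu> A - measure \<nu> A\<bar>) + (\<Sum>A\<in>P - Pp. \<bar>measure \<mu> A - measure \<nu> A\<bar>)"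
      using fin by (subst sum.subset_diff[of Pp P]) (auto simp: Pp_def)
    also have "(\<Sum>A\<in>Pp. \<bar>measure \<mu> A - measure \<nu> A\<bar>) = (\<Sum>A\<in>Pp. (measure \<mu> A - measure \<nu> A))"
      by (intro sum.cong) (auto simp: Pp_def)
    also have "(\<Sum>A\<in>P - Pp. \<bar>measure \<mu> A - measure \<nu> A\<bar>) = - (\<Sum>A\<in>P - Pp. (measure \<mu> A - measure \<nu> A))"
      unfolding sum_negf[symmetric] by (intro sum.cong) (auto simp: Pp_def)
    finally show ?thesis using part[of Pp] part[of "P - Pp"] by (auto simp: Pp_def)
  qed
  \<comment> \<open>The one-set partition makes the supremum run over a nonempty family and bounds
    it from below.\<close>
  have triv: "{{0<..1::real}} \<in> ?PP"
    by (auto simp: partition_on_def sets_restrict_space_iff)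
  have bdd: "bdd_above ((\<lambda>P. \<Sum>A\<in>P. \<bar>measure \<mu> A - measure \<nu> A\<bar>) ` ?PP)"
    using bound by (intro bdd_aboveI2[where M="2 * R"])
  show "tv_dist \<mu> \<nu> \<le> 2 * R"
    unfolding tv_dist_def by (rule cSUP_least) (use triv bound in auto)
  have "(\<Sum>A\<in>{{0<..1::real}}. \<bar>measure \<mu> A - measure \<nu> A\<bar>) \<le> tv_dist \<mu> \<nu>"
    unfolding tv_dist_def by (rule cSUP_upper[OF triv bdd])
  then show "0 \<le> tv_dist \<mu> \<nu>" by simp
qed

context bvcf_limit
begin

lemma \<mu>_finite_measures: "0 \<le> t \<Longrightarrow> \<mu> t \<in> finite_measures"
  by (simp add: finite_measures_def \<mu>_sets \<mu>_finite)

text \<open>A nonempty compact subset of (0,1] has a positive minimum \<open>\<kappa>\<close>, so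
  the ramp with threshold \<open>\<kappa>\<close> equals 1 on it, while ever steeper functions of
  the distance approximate the indicator. The Lipschitz constants tend to infinity, which is why the
  domination has to be uniform in them.\<close>

lemma compact_set_test:
  assumes C: "compact C" "C \<subseteq> {0<..1}" "C \<noteq> {}"
  obtains L \<phi> where "\<And>j::nat. test_fun (L j) (\<phi> j)" "\<And>j x. 0 \<le> \<phi> j x" "\<And>j x. \<phi> j x \<le> 1"
    "\<And>x. x \<in> {0<..1} \<Longrightarrow> (\<lambda>j. \<phi> j x) \<longlonglongrightarrow> indicator C x"
proof -
  have cl: "closed C" using C(1) by (rule compact_imp_closed)
  obtain \<kappa> where \<kappa>: "\<kappa> \<in> C" "\<And>x. x \<in> C \<Longrightarrow> \<kappa> \<le> x" using compact_attains_inf[OF C(1,3)] by blast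
  have \<kappa>01: "0 < \<kappa>" "\<kappa> \<le> 1" using \<kappa>(1) C(2) by auto
  define \<eta> where "\<eta> j x = max 0 (1 - real (Suc j) * infdist x C)" for j x
  define \<phi> where "\<phi> j x = \<eta> j (min x 1) * ramp \<kappa> x" for j x
  have \<eta>01: "0 \<le> \<eta> j x" "\<eta> j x \<le> 1" for j x by (auto simp: \<eta>_def infdist_nonneg)
  show thesis
  proof (rule that[of "\<lambda>j. real (Suc j) + 1 / \<kappa>" \<phi>])
    show "test_fun (real (Suc j) + 1 / \<kappa>) (\<phi> j)" for j
      unfolding \<phi>_def
    proof (rule test_fun_ramp_mult[OF \<kappa>01])
      show "\<bar>\<eta> j x\<bar> \<le> 1" for x using \<eta>01[of j x] by simp
      show "\<bar>\<eta> j x - \<eta> j y\<bar> \<le> real (Suc j) * \<bar>x - y\<bar>" for x y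
      proof -
        have "\<bar>\<eta> j x - \<eta> j y\<bar> \<le> \<bar>real (Suc j) * infdist x C - real (Suc j) * infdist y C\<bar>"
        proof -
          have "\<bar>max 0 (1 - p) - max 0 (1 - q)\<bar> \<le> \<bar>p - q\<bar>" for p q :: real by linarith
          then show ?thesis unfolding \<eta>_def .
        qed
        also have "\<dots> = real (Suc j) * \<bar>infdist x C - infdist y C\<bar>"
          unfolding right_diff_distrib[symmetric] abs_mult by simp
        also have "\<dots> \<le> real (Suc j) * \<bar>x - y\<bar>"
          using infdist_triangle_abs[of x C y] by (intro mult_left_mono) (auto simp: dist_real_def)
        finally show ?thesis .
      qed
    qed
    show "0 \<le> \<phi> j x" "\<phi> j x \<le> 1" for j x
      unfolding \<phi>_def using \<eta>01 ramp by (auto intro: mult_le_one)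
    show "(\<lambda>j. \<phi> j x) \<longlonglongrightarrow> indicator C x" if x: "x \<in> {0<..1}" for x
    proof (cases "x \<in> C")
      case True
      then have "\<phi> j x = 1" for j using \<kappa>(2)[OF True] \<kappa>01 x by (simp add: \<phi>_def \<eta>_def min_def ramp_one)
      then show ?thesis using True by simp
    next
      case False
      then have d: "0 < infdist x C" using in_closed_iff_infdist_zero[OF cl C(3), of x] infdist_nonneg[of x C] by linarith
      have "\<forall>\<^sub>F j in sequentially. \<phi> j x = 0"
      proof -
        obtain N where N: "1 / infdist x C < real N" using reals_Archimedean2 by blast
        have "\<phi> j x = 0" if "N \<le> j" for j
        proof -
          have "1 / infdist x C \<le> real (Suc j)" using N that by simp
          then have "1 \<le> real (Suc j) * infdist x C" using d by (simp only: pos_divide_le_eq)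
          then have "\<eta> j x = 0" by (simp add: \<eta>_def)
          then show ?thesis using x by (simp add: \<phi>_def min_def)
        qed
        then show ?thesis by (auto simp: eventually_sequentially)
      qed
      then show ?thesis using False by (simp add: tendsto_eventually)
    qed
  qed
qed

text \<open>The estimate passes from test functions to compact sets by pointwise approximation, and
  from compact to Borel sets by inner regularity. The images \<open>N t\<close> on the line are
  formed because inner regularity is applied to Borel measures there.\<close>

lemma measure_increment:
  assumes z: "integrable lborel z" "\<And>t. 0 \<le> z t"
    and dom: "\<And>L \<phi>. test_fun L \<phi> \<Longrightarrow> (\<And>x. 0 \<le> \<phi> x) \<Longrightarrow> (\<And>x. \<phi> x \<le> 1) \<Longrightarrow>
      AE t in lborel. t \<in> {0..T} \<longrightarrow> \<bar>rate_lim \<phi> t\<bar> \<le> z t"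
    and ab: "0 \<le> a" "a \<le> b" "b \<le> T" and A: "A \<in> sets (restrict_space borel {0<..1})"
  shows "\<bar>measure (\<mu> b) A - measure (\<mu> a) A\<bar> \<le> (\<integral>t. indicator {a..b} t * z t \<partial>lborel)"
proof -
  define R where "R = (\<integral>t. indicator {a..b} t * z t \<partial>lborel)"
  have R: "0 \<le> R" unfolding R_def using z(2) by (intro Bochner_Integration.integral_nonneg) auto
  have b: "0 \<le> b" using ab by simp
  define N where "N t = distr (\<mu> t) borel (\<lambda>x. x)" for t
  have idm: "(\<lambda>x. x) \<in> \<mu> t \<rightarrow>\<^sub>M borel" if "0 \<le> t" for t
    unfolding \<mu>_measurable[OF that] by (intro measurable_restrict_space1) simp
  have Nf: "finite_measure (N t)" if "0 \<le> t" for t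
    unfolding N_def by (rule finite_measure.finite_measure_distr[OF \<mu>_finite[OF that] idm[OF that]])
  have Nm: "emeasure (N t) B = ennreal (measure (\<mu> t) (B \<inter> {0<..1}))" if "0 \<le> t" "B \<in> sets borel" for t B
  proof -
    interpret \<mu>: finite_measure "\<mu> t" by (rule \<mu>_finite[OF that(1)])
    show ?thesis unfolding N_def using that
      by (subst emeasure_distr[OF idm]) (auto simp: \<mu>_space \<mu>.emeasure_eq_measure)
  qed
  have comp: "\<bar>measure (\<mu> b) C - measure (\<mu> a) C\<bar> \<le> R" if C: "compact C" "C \<subseteq> {0<..1}" for C
  proof (cases "C = {}")
    case False
    obtain L \<phi> where \<phi>: "\<And>j::nat. test_fun (L j) (\<phi> j)" "\<And>j x. 0 \<le> \<phi> j x" "\<And>j x. \<phi> j x \<le> 1"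
      "\<And>x. x \<in> {0<..1} \<Longrightarrow> (\<lambda>j. \<phi> j x) \<longlonglongrightarrow> indicator C x"
      using compact_set_test[OF C False] by metis
    have lim: "(\<lambda>j. integral\<^sup>L (\<mu> t) (\<phi> j)) \<longlonglongrightarrow> measure (\<mu> t) C" if t: "0 \<le> t" for t
    proof -
      interpret \<mu>: finite_measure "\<mu> t" by (rule \<mu>_finite[OF t])
      have Cs: "C \<in> sets (\<mu> t)" unfolding \<mu>_sets[OF t] using C compact_imp_closed[OF C(1)]
        by (auto simp: sets_restrict_space_iff)
      have m: "\<phi> j \<in> borel_measurable (\<mu> t)" for j
        using measurable_compose[OF idm[OF t] test_funD(8)[OF \<phi>(1)]] by simp
      have "(\<lambda>j. integral\<^sup>L (\<mu> t) (\<phi> j)) \<longlonglongrightarrow> integral\<^sup>L (\<mu> t) (indicator C)"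
      proof (rule integral_dominated_convergence[where w="\<lambda>_. 1"])
        show "AE x in \<mu> t. (\<lambda>j. \<phi> j x) \<longlonglongrightarrow> indicator C x"
          using \<phi>(4) by (auto simp: \<mu>_space[OF t] intro!: AE_I2)
        show "AE x in \<mu> t. norm (\<phi> j x) \<le> 1" for j using \<phi>(2,3) by (intro AE_I2) simp
      qed (use m Cs in auto)
      then show ?thesis using Cs sets.sets_into_space[OF Cs] by (simp add: Int_absorb2)
    qed
    have "(\<lambda>j. \<bar>integral\<^sup>L (\<mu> b) (\<phi> j) - integral\<^sup>L (\<mu> a) (\<phi> j)\<bar>) \<longlonglongrightarrow> \<bar>measure (\<mu> b) C - measure (\<mu> a) C\<bar>"
      by (intro tendsto_rabs tendsto_diff lim b ab)
    moreover have "\<bar>integral\<^sup>L (\<mu> b) (\<phi> j) - integral\<^sup>L (\<mu> a) (\<phi> j)\<bar> \<le> R" for j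
      unfolding R_def by (rule test_increment[OF z dom[OF \<phi>(1-3)] \<phi>(1) ab])
    ultimately show ?thesis by (intro tendsto_upperbound[of _ _ sequentially]) auto
  qed (use R in simp)
  have A': "A \<subseteq> {0<..1}" "A \<in> sets borel" using A by (auto simp: sets_restrict_space_iff)
  \<comment> \<open>Only \<open>\<mu> u\<close> is approximated from inside; on the other side
    monotonicity suffices. The estimate is one-sided and is used with both orders of the
    times.\<close>
  have one: "measure (\<mu> u) A \<le> measure (\<mu> v) A + R"
    if u: "0 \<le> u" and v: "0 \<le> v" and uv: "\<And>C. compact C \<Longrightarrow> C \<subseteq> {0<..1} \<Longrightarrow> measure (\<mu> u) C \<le> measure (\<mu> v) C + R" for u v
  proof -
    interpret \<mu>v: finite_measure "\<mu> v" by (rule \<mu>_finite[OF v])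
    interpret Nu: finite_measure "N u" by (rule Nf[OF u])
    have "emeasure (N u) A = (SUP C \<in> {C. C \<subseteq> A \<and> compact C}. emeasure (N u) C)"
      by (rule inner_regular) (use A' in \<open>auto simp: N_def\<close>, use Nu.emeasure_finite N_def in auto)
    also have "\<dots> \<le> ennreal (measure (\<mu> v) A + R)"
    proof (rule SUP_least)
      fix C assume "C \<in> {C. C \<subseteq> A \<and> compact C}"
      then have C: "C \<subseteq> A" "compact C" by auto
      have Cb: "C \<in> sets borel" using compact_imp_closed[OF C(2)] by simp
      have CE: "C \<inter> {0<..1} = C" using C(1) A'(1) by blast
      have "measure (\<mu> u) C \<le> measure (\<mu> v) C + R" using C A'(1) by (intro uv) auto
      also have "\<dots> \<le> measure (\<mu> v) A + R"
        using \<mu>v.finite_measure_mono[OF C(1)] A by (simp add: \<mu>_sets[OF v])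
      finally show "emeasure (N u) C \<le> ennreal (measure (\<mu> v) A + R)"
        unfolding Nm[OF u Cb] CE by (rule ennreal_leI)
    qed
    finally have "ennreal (measure (\<mu> u) A) \<le> ennreal (measure (\<mu> v) A + R)"
      unfolding Nm[OF u A'(2)] using A'(1) by (simp add: Int_absorb2)
    then show ?thesis by (rule ennreal_le_iff[THEN iffD1, rotated]) (use R in simp)
  qed
  have comp': "measure (\<mu> b) C \<le> measure (\<mu> a) C + R" "measure (\<mu> a) C \<le> measure (\<mu> b) C + R"
    if "compact C" "C \<subseteq> {0<..1}" for C
    using comp[OF that] by linarith+
  have "measure (\<mu> b) A \<le> measure (\<mu> a) A + R" by (rule one[OF b ab(1) comp'(1)])
  moreover have "measure (\<mu> a) A \<le> measure (\<mu> b) A + R" by (rule one[OF ab(1) b comp'(2)])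
  ultimately show ?thesis unfolding R_def by linarith
qed

lemma tv_continuous_\<mu>: "tv_continuous \<mu>"
  unfolding tv_continuous_def
proof (intro allI impI)
  fix t :: real assume t: "0 \<le> t"
  have t1: "0 \<le> t + 1" using t by simp
  obtain z where z: "integrable lborel z" "\<And>t. 0 \<le> z t"
    and dom: "\<And>L \<phi>. test_fun L \<phi> \<Longrightarrow> (\<forall>x. 0 \<le> \<phi> x) \<Longrightarrow> (\<forall>x. \<phi> x \<le> 1) \<Longrightarrow>
      AE u in lborel. u \<in> {0..t+1} \<longrightarrow> \<bar>rate_lim \<phi> u\<bar> \<le> z u"
    using rate_lim_dominated[OF t1] by blast
  have incr: "\<bar>measure (\<mu> b) A - measure (\<mu> a) A\<bar> \<le> (\<integral>t. indicator {a..b} t * z t \<partial>lborel)"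
    if "0 \<le> a" "a \<le> b" "b \<le> t + 1" "A \<in> sets (restrict_space borel {0<..1})" for a b A
    by (rule measure_increment[OF z _ that], rule dom) auto
  \<comment> \<open>Minimum and maximum treat times on both sides of \<open>t\<close> at once. The
    domination by \<open>z\<close> reaches up to \<open>t + 1\<close>, below which every sequence
    tending to \<open>t\<close> eventually stays; the interval then shrinks to a null set.\<close>
  define R where "R u = (\<integral>v. indicator {min u t..max u t} v * z v \<partial>lborel)" for u
  have le: "0 \<le> tv_dist (\<mu> u) (\<mu> t)" "tv_dist (\<mu> u) (\<mu> t) \<le> 2 * R u" if u: "0 \<le> u" "u \<le> t + 1" for u
  proof -
    have "\<bar>measure (\<mu> u) A - measure (\<mu> t) A\<bar> \<le> R u" if A: "A \<in> sets (restrict_space borel {0<..1})" for A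
    proof (cases "u \<le> t")
      case True
      then show ?thesis using incr[of u t A] u t A by (simp add: R_def abs_minus_commute)
    next
      case False
      then show ?thesis using incr[of t u A] u t A by (simp add: R_def)
    qed
    from tv_dist_le[OF \<mu>_finite_measures[OF u(1)] \<mu>_finite_measures[OF t] this]
    show "0 \<le> tv_dist (\<mu> u) (\<mu> t)" "tv_dist (\<mu> u) (\<mu> t) \<le> 2 * R u" by auto
  qed
  show "((\<lambda>u. tv_dist (\<mu> u) (\<mu> t)) \<longlongrightarrow> 0) (at t within {0..})"
    unfolding tendsto_at_iff_sequentially
  proof (intro allI impI)
    fix X :: "nat \<Rightarrow> real" assume X: "\<forall>i. X i \<in> {0..} - {t}" "X \<longlonglongrightarrow> t"
    have "(\<lambda>i. R (X i)) \<longlonglongrightarrow> (\<integral>v. 0 \<partial>(lborel :: real measure))"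
      unfolding R_def
    proof (rule integral_dominated_convergence[OF _ _ z(1)])
      show "(\<lambda>v. indicator {min (X i) t..max (X i) t} v * z v) \<in> borel_measurable lborel" for i
        using borel_measurable_integrable[OF z(1)] by (intro borel_measurable_times) auto
      show "AE v in lborel. norm (indicator {min (X i) t..max (X i) t} v * z v) \<le> z v" for i
        using z(2) by (intro AE_I2) (auto simp: indicator_def)
      have "AE v in lborel. v \<noteq> t" by (rule AE_lborel_singleton)
      then show "AE v in lborel. (\<lambda>i. indicator {min (X i) t..max (X i) t} v * z v) \<longlonglongrightarrow> 0"
      proof eventually_elim
        case (elim v)
        have "\<forall>\<^sub>F i in sequentially. \<bar>X i - t\<bar> < \<bar>v - t\<bar>"
          using X(2) elim unfolding tendsto_iff dist_real_def by simp
        then have "\<forall>\<^sub>F i in sequentially. indicator {min (X i) t..max (X i) t} v * z v = 0"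
          by eventually_elim (auto simp: indicator_def min_def max_def split: if_splits)
        then show ?case by (rule tendsto_eventually)
      qed
    qed simp
    then have "(\<lambda>i. 2 * R (X i)) \<longlonglongrightarrow> 2 * 0" by (intro tendsto_intros) simp
    then have lim: "(\<lambda>i. 2 * R (X i)) \<longlonglongrightarrow> 0" by simp
    have ev: "\<forall>\<^sub>F i in sequentially. 0 \<le> X i \<and> X i \<le> t + 1"
      using order_tendstoD(2)[OF X(2), of "t+1"] by (auto elim!: eventually_mono simp: less_imp_le) (use X(1) in auto)
    show "((\<lambda>u. tv_dist (\<mu> u) (\<mu> t)) \<circ> X) \<longlonglongrightarrow> 0"
      unfolding o_def
    proof (rule tendsto_sandwich[OF _ _ tendsto_const lim])
      show "\<forall>\<^sub>F i in sequentially. 0 \<le> tv_dist (\<mu> (X i)) (\<mu> t)" using ev by eventually_elim (simp add: le)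
      show "\<forall>\<^sub>F i in sequentially. tv_dist (\<mu> (X i)) (\<mu> t) \<le> 2 * R (X i)" using ev by eventually_elim (simp add: le)
    qed
  qed
qed

end

section \<open>Existence of a solution\<close>

text \<open>Letting one argument of the Lipschitz estimate tend to 0 gives a bound by
  \<open>L * x\<close>; this makes the extension by 0 to the left Lipschitz with the same
  constant.\<close>

lemma Lip0_test_fun:
  assumes "\<phi> \<in> Lip0"
  obtains L \<psi> where "test_fun L \<psi>" "\<And>x. x \<in> {0<..1} \<Longrightarrow> \<psi> x = \<phi> x"
proof -
  obtain L where lip: "L-lipschitz_on {0<..1} \<phi>" and lim: "(\<phi> \<longlongrightarrow> 0) (at_right 0)"
    using assms by (auto simp: Lip0_def)
  have L: "0 \<le> L" using lip by (rule lipschitz_on_nonneg)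
  have lip': "\<bar>\<phi> x - \<phi> y\<bar> \<le> L * \<bar>x - y\<bar>" if "x \<in> {0<..1}" "y \<in> {0<..1}" for x y
    using lipschitz_onD[OF lip that] by (simp add: dist_real_def)
  have lin: "\<bar>\<phi> x\<bar> \<le> L * x" if x: "x \<in> {0<..1}" for x
  proof (rule tendsto_upperbound)
    have "((\<lambda>y. \<bar>\<phi> x - \<phi> y\<bar>) \<longlongrightarrow> \<bar>\<phi> x - 0\<bar>) (at_right 0)" by (intro tendsto_intros lim)
    then show "((\<lambda>y. \<bar>\<phi> x - \<phi> y\<bar>) \<longlongrightarrow> \<bar>\<phi> x\<bar>) (at_right 0)" by simp
    have "\<forall>\<^sub>F y in at_right 0. y < x" using x by (intro eventually_at_right_real[THEN eventually_mono]) auto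
    moreover have "\<forall>\<^sub>F y in at_right (0::real). 0 < y" by (rule eventually_at_right_less)
    ultimately show "\<forall>\<^sub>F y in at_right 0. \<bar>\<phi> x - \<phi> y\<bar> \<le> L * x"
    proof eventually_elim
      case (elim y)
      have "\<bar>\<phi> x - \<phi> y\<bar> \<le> L * \<bar>x - y\<bar>" using elim x by (intro lip') auto
      also have "\<dots> \<le> L * x" using elim L by (intro mult_left_mono) auto
      finally show ?case .
    qed
  qed simp
  define \<psi> where "\<psi> x = (if x \<le> 0 then 0 else \<phi> (min x 1))" for x
  have le: "\<bar>\<psi> x - \<psi> y\<bar> \<le> L * (y - x)" if xy: "x \<le> y" for x y
  proof -
    consider "y \<le> 0" | "x \<le> 0" "0 < y" | "0 < x" by linarith
    then show ?thesis
    proof cases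
      case 1
      then show ?thesis using xy L by (simp add: \<psi>_def)
    next
      case 2
      have "\<bar>\<phi> (min y 1)\<bar> \<le> L * min y 1" using 2 by (intro lin) auto
      also have "\<dots> \<le> L * (y - x)" using 2 L by (intro mult_left_mono) auto
      finally show ?thesis using 2 by (simp add: \<psi>_def)
    next
      case 3
      have "\<bar>\<phi> (min x 1) - \<phi> (min y 1)\<bar> \<le> L * \<bar>min x 1 - min y 1\<bar>" using 3 xy by (intro lip') auto
      also have "\<dots> \<le> L * (y - x)" using xy L by (intro mult_left_mono) (auto simp: min_def)
      finally show ?thesis using 3 xy by (simp add: \<psi>_def)
    qed
  qed
  have "L-lipschitz_on UNIV \<psi>"
  proof (rule lipschitz_onI)
    fix x y :: real
    show "dist (\<psi> x) (\<psi> y) \<le> L * dist x y"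
      using le[of x y] le[of y x] by (cases "x \<le> y") (auto simp: dist_real_def abs_minus_commute)
  qed (rule L)
  moreover have "\<forall>x\<ge>1. \<psi> x = \<psi> 1" by (simp add: \<psi>_def min_def)
  ultimately have "test_fun L \<psi>" unfolding test_fun_def by (simp add: \<psi>_def)
  moreover have "\<psi> x = \<phi> x" if "x \<in> {0<..1}" for x using that by (simp add: \<psi>_def min_def)
  ultimately show thesis by (rule that)
qed

context bvcf
begin

text \<open>Replaces the datum by its everywhere nonnegative representative, from which it differs
  on \<open>{1<..}\<close> only in a null set.\<close>

lemma bint_datum:
  assumes \<kappa>: "bdry_kernel \<kappa> A" and s: "0 \<le> s" and x: "x \<in> {0<..1}"
  shows "set_integrable lborel {1<..} (\<lambda>y. \<kappa> x y * g s y)"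
    "(LINT y:{1<..}|lborel. \<kappa> x y * g s y) = bint \<kappa> (datum_pos s) x"
proof -
  have m: "(\<lambda>y. indicator {1<..} y *\<^sub>R (\<kappa> x y * g s y)) \<in> borel_measurable lborel"
  proof -
    have "(\<lambda>y. (indicator {1<..} y * \<kappa> x y) * (indicator {1<..} y * g s y)) \<in> borel_measurable lborel"
      using \<kappa> x g_meas[OF s] by (intro borel_measurable_times[of "\<lambda>y. indicator {1<..} y * \<kappa> x y"]) (auto simp: bdry_kernel_def)
    also have "(\<lambda>y. (indicator {1<..} y * \<kappa> x y) * (indicator {1<..} y * g s y)) = (\<lambda>y. indicator {1<..} y *\<^sub>R (\<kappa> x y * g s y))"
      by (auto simp: indicator_def)
    finally show ?thesis .
  qed
  have w: "weight (datum_pos s)" by (rule datum_pos_weight(1)[OF s])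
  have ae: "AE y in lborel. indicator {1<..} y *\<^sub>R (\<kappa> x y * g s y) = \<kappa> x y * datum_pos s y"
    using datum_pos_AE[OF s] by eventually_elim (auto simp: indicator_def)
  show "set_integrable lborel {1<..} (\<lambda>y. \<kappa> x y * g s y)"
    unfolding set_integrable_def
    using bint_integrable[OF \<kappa> w x] integrable_cong_AE[OF m bint_measurable[OF \<kappa> w x] ae] by simp
  show "(LINT y:{1<..}|lborel. \<kappa> x y * g s y) = bint \<kappa> (datum_pos s) x"
    unfolding set_lebesgue_integral_def bint_def
    by (rule integral_cong_AE[OF m bint_measurable[OF \<kappa> w x] ae])
qed

lemma bdry_coag_eq:
  assumes s: "0 \<le> s" and x: "x \<in> {0<..1}"
  shows "set_integrable lborel {1<..} (\<lambda>y. K x y * g s y)" "bdry_coag K g s x = bint K (datum_pos s) x"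
proof -
  \<comment> \<open>The estimates are stated for \<open>\<kappa>K\<close>; at a fixed positive
    \<open>x\<close> the regularising factor can be divided out.\<close>
  have eq: "K x y * g s y = (1 / x) * (\<kappa>K x y * g s y)" for y using x by (simp add: \<kappa>K_def)
  show "set_integrable lborel {1<..} (\<lambda>y. K x y * g s y)"
    unfolding eq by (rule set_integrable_mult_right) (rule bint_datum(1)[OF bdry_kernel_K s x])
  have "bdry_coag K g s x = (1 / x) * bint \<kappa>K (datum_pos s) x"
    unfolding bdry_coag_def eq set_integral_mult_right bint_datum(2)[OF bdry_kernel_K s x] ..
  then show "bdry_coag K g s x = bint K (datum_pos s) x" using x by (simp add: bint_K)
qed

lemma bdry_frag_eq:
  assumes s: "0 \<le> s" and x: "x \<in> {0<..1}"
  shows "set_integrable lborel {1<..} (\<lambda>y. F (y - x) x * g s y)" "bdry_frag F g s x = bint \<kappa>F (datum_pos s) x"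
  using bint_datum[OF bdry_kernel_F s x] by (simp_all add: bdry_frag_def \<kappa>F_def)

lemma frag_op_cong:
  assumes x: "x \<in> {0<..1}" and eq: "\<And>x. x \<in> {0<..1} \<Longrightarrow> \<psi> x = \<phi> x" and \<psi>: "test_fun L \<psi>"
  shows "set_integrable lborel {0<..<x} (frag_integrand F \<phi> x)"
    "frag_op F \<phi> x = frag_rate x * \<psi> x - fragint \<psi> x"
proof -
  have c: "indicator {0<..<x} y *\<^sub>R frag_integrand F \<phi> x y = indicator {0<..<x} y *\<^sub>R frag_integrand F \<psi> x y" for y
  proof (cases "y \<in> {0<..<x}")
    case True
    then have "\<phi> x = \<psi> x" "\<phi> (x - y) = \<psi> (x - y)" "\<phi> y = \<psi> y" using x by (auto intro!: eq[symmetric])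
    then show ?thesis by (simp add: frag_integrand_def)
  qed simp
  note fo = frag_op_eq[OF x test_funD(6)[OF \<psi>] test_funD(8)[OF \<psi>]]
  show "set_integrable lborel {0<..<x} (frag_integrand F \<phi> x)"
    using fo(1) unfolding set_integrable_def c .
  have "frag_op F \<phi> x = frag_op F \<psi> x" unfolding frag_op_def set_lebesgue_integral_def c ..
  then show "frag_op F \<phi> x = frag_rate x * \<psi> x - fragint \<psi> x" using fo(2) by simp
qed

end

context bvcf_limit
begin

text \<open>All integrals see the test function only on (0,1], including the bracket, where
  \<open>extend_const\<close> reads it at 1; so \<open>\<phi>\<close> may be replaced by its normal
  form \<open>\<psi>\<close>.\<close>

lemma weak_rhs_eq:
  assumes \<psi>: "test_fun L \<psi>" and eq: "\<And>x. x \<in> {0<..1} \<Longrightarrow> \<psi> x = \<phi> x" and t: "0 \<le> t"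
  shows "integrable (\<mu> t \<Otimes>\<^sub>M \<mu> t) (\<lambda>(x, y). K x y * coag_op \<phi> x y)"
    "integrable (\<mu> t) (\<lambda>x. bdry_coag K g t x * \<phi> x + frag_op F \<phi> x)"
    "set_integrable lborel {0<..1} (\<lambda>x. bdry_frag F g t x * \<phi> x)"
    "weak_rhs K F g \<mu> \<phi> t = rate_lim \<psi> t"
proof -
  note m = test_funD(8)[OF \<psi>]
  have cph: "continuous_on {0<..1} \<psi>" using test_funD(7)[OF \<psi>] by (rule continuous_on_subset) auto
  have cK: "(case p of (x, y) \<Rightarrow> K x y * coag_op \<phi> x y) = (case p of (x, y) \<Rightarrow> K x y * coag_op \<psi> x y)"
    if "p \<in> space (\<mu> t \<Otimes>\<^sub>M \<mu> t)" for p
    using that coag_op_cong[of \<psi> \<phi>, OF eq] by (auto simp: space_pair_measure \<mu>_space[OF t])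
  show "integrable (\<mu> t \<Otimes>\<^sub>M \<mu> t) (\<lambda>(x, y). K x y * coag_op \<phi> x y)"
    by (rule Bochner_Integration.integrable_cong[OF refl cK, THEN iffD2]) (assumption, rule pair_integrable[OF t \<psi>])
  have cB: "bdry_coag K g t x * \<phi> x + frag_op F \<phi> x = bint K (datum_pos t) x * \<psi> x - (fragint \<psi> x - frag_rate x * \<psi> x)"
    if "x \<in> space (\<mu> t)" for x
  proof -
    have x: "x \<in> {0<..1}" using that by (simp add: \<mu>_space[OF t])
    show ?thesis using bdry_coag_eq(2)[OF t x] frag_op_cong(2)[OF x eq \<psi>] eq[OF x] by simp
  qed
  have i1: "integrable (\<mu> t) (\<lambda>x. bint K (datum_pos t) x * \<psi> x)" by (rule bdry_integrable[OF t \<psi>])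
  have i2: "integrable (\<mu> t) (\<lambda>x. fragint \<psi> x - frag_rate x * \<psi> x)"
  proof (rule \<mu>_integrable[OF t])
    show "continuous_on {0<..1} (\<lambda>x. fragint \<psi> x - frag_rate x * \<psi> x)"
      by (intro continuous_intros fragint_cont[OF _ m] frag_rate_cont cph) (rule test_funD(6)[OF \<psi>])
    show "\<bar>fragint \<psi> x - frag_rate x * \<psi> x\<bar> \<le> 2 * F0 * L + F0 * L" if x: "x \<in> {0<..1}" for x
    proof -
      have "\<bar>frag_rate x * \<psi> x\<bar> \<le> F0 * L"
        unfolding abs_mult using frag_rate[OF x] test_funD(6)[OF \<psi>] F0 by (intro mult_mono) auto
      then show ?thesis using fragint_bound[OF x test_funD(6)[OF \<psi>] m] by linarith
    qed
  qed
  show "integrable (\<mu> t) (\<lambda>x. bdry_coag K g t x * \<phi> x + frag_op F \<phi> x)"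
    by (rule Bochner_Integration.integrable_cong[OF refl cB, THEN iffD2])
      (assumption, rule Bochner_Integration.integrable_diff[OF i1 i2])
  have cS: "indicator {0<..1} x *\<^sub>R (bdry_frag F g t x * \<phi> x) = indicator {0<..1} x * (bint \<kappa>F (datum_pos t) x * \<psi> x)" for x
    using bdry_frag_eq(2)[OF t, of x] eq[of x] by (cases "x \<in> {0<..1}") simp_all
  show "set_integrable lborel {0<..1} (\<lambda>x. bdry_frag F g t x * \<phi> x)"
    unfolding set_integrable_def cS by (rule source_lim(1)[OF t m test_funD(6)[OF \<psi>]])
  have "integral\<^sup>L (\<mu> t \<Otimes>\<^sub>M \<mu> t) (\<lambda>(x, y). K x y * coag_op \<phi> x y) = coag_lim \<psi> t"
    unfolding coag_lim_def by (rule Bochner_Integration.integral_cong[OF refl cK])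
  moreover have "(\<integral>x. bdry_coag K g t x * \<phi> x + frag_op F \<phi> x \<partial>\<mu> t)
     = bdry_lim \<psi> t - (\<integral>x. fragint \<psi> x - frag_rate x * \<psi> x \<partial>\<mu> t)"
    unfolding bdry_lim_def Bochner_Integration.integral_diff[OF i1 i2, symmetric]
    by (rule Bochner_Integration.integral_cong[OF refl cB])
  ultimately show "weak_rhs K F g \<mu> \<phi> t = rate_lim \<psi> t"
    unfolding weak_rhs_def rate_lim_eq[OF t \<psi>] set_lebesgue_integral_def cS by simp
qed

lemma solution: "bvcf_solution K F \<mu>in g \<mu>"
  unfolding bvcf_solution_def
proof (intro conjI allI impI ballI)
  show "\<mu> t \<in> finite_measures" if "0 \<le> t" for t using that by (rule \<mu>_finite_measures)
  show "tv_continuous \<mu>" by (rule tv_continuous_\<mu>)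
  fix \<phi> assume \<phi>: "\<phi> \<in> Lip0"
  obtain L \<psi> where \<psi>: "test_fun L \<psi>" and eq: "\<And>x. x \<in> {0<..1} \<Longrightarrow> \<psi> x = \<phi> x"
    using Lip0_test_fun[OF \<phi>] by metis
  note W = weak_rhs_eq[OF \<psi> eq]
  have ind: "indicator {0..t} u *\<^sub>R weak_rhs K F g \<mu> \<phi> u = indicator {0..t} u * rate_lim \<psi> u" for t u
    using W(4)[of u] by (cases "u \<in> {0..t}") simp_all
  show "weak_integrals_exist K F g \<mu> \<phi>"
    unfolding weak_integrals_exist_def
  proof (intro conjI allI impI ballI)
    show "set_integrable lborel {0<..<x} (frag_integrand F \<phi> x)" if "x \<in> {0<..1}" for x
      by (rule frag_op_cong(1)[OF that eq \<psi>])
    show "set_integrable lborel {1<..} (\<lambda>y. K x y * g s y)" if "0 \<le> s" "x \<in> {0<..1}" for s x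
      by (rule bdry_coag_eq(1)[OF that])
    show "set_integrable lborel {1<..} (\<lambda>y. F (y - x) x * g s y)" if "0 \<le> s" "x \<in> {0<..1}" for s x
      by (rule bdry_frag_eq(1)[OF that])
    show "set_integrable lborel {0..t} (weak_rhs K F g \<mu> \<phi>)" if "0 \<le> t" for t
      unfolding set_integrable_def ind by (rule rate_lim_integrable[OF that \<psi>])
  qed (use W in auto)
  fix t :: real assume t: "0 \<le> t"
  have "(LINT x|\<mu> t. \<phi> x) = integral\<^sup>L (\<mu> t) \<psi>"
    by (rule Bochner_Integration.integral_cong[OF refl]) (simp add: \<mu>_space[OF t] eq)
  moreover have "(LINT x|\<mu>in. \<phi> x) = integral\<^sup>L \<mu>in \<psi>"
    by (rule Bochner_Integration.integral_cong[OF refl]) (simp add: \<mu>in_space eq)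
  ultimately show "(LINT x|\<mu> t. \<phi> x) = (LINT x|\<mu>in. \<phi> x) + (LINT u:{0..t}|lborel. weak_rhs K F g \<mu> \<phi> u)"
    using limit_equation[OF t \<psi>] unfolding set_lebesgue_integral_def ind by simp
qed

end

context bvcf
begin

lemma solution_exists: "\<exists>\<mu>. bvcf_solution K F \<mu>in g \<mu>"
proof -
  obtain s Q where lim: "strict_mono s" "\<And>t. 0 \<le> t \<Longrightarrow> real_distribution (Q t)"
    "\<And>t. 0 \<le> t \<Longrightarrow> weak_conv_m (\<lambda>n. P (s n) t) (Q t)"
    using weak_limit_exists by metis
  interpret bvcf_limit \<alpha> \<beta> \<gamma> K0 F0 K F \<mu>in g s Q
    by (intro bvcf_limit.intro bvcf_axioms bvcf_limit_axioms.intro lim)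
  show ?thesis using solution by blast
qed

end

theorem theorem1p6:
  fixes \<alpha> \<beta> \<gamma> K0 F0 :: real
    and K F :: "real \<Rightarrow> real \<Rightarrow> real"
    and \<mu>in :: "real measure"
    and g :: "real \<Rightarrow> real \<Rightarrow> real"
  assumes "\<alpha> \<in> {0..1}" and "\<beta> \<in> {0..1}" and "\<gamma> \<in> {0..1}"
    and "K0 \<ge> 0" and "F0 \<ge> 0"
    and "continuous_on ({0<..} \<times> {0<..}) (\<lambda>(x, y). K x y)"
    and "continuous_on ({0<..} \<times> {0<..}) (\<lambda>(x, y). F x y)"
    and "\<And>x y. x > 0 \<Longrightarrow> y > 0 \<Longrightarrow> K x y \<ge> 0"
    and "\<And>x y. x > 0 \<Longrightarrow> y > 0 \<Longrightarrow> F x y \<ge> 0"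
    and "\<And>x y. x > 0 \<Longrightarrow> y > 0 \<Longrightarrow> K x y = K y x"
    and "\<And>x y. x > 0 \<Longrightarrow> y > 0 \<Longrightarrow> F x y = F y x"
    and "\<And>x y. x > 0 \<Longrightarrow> y > 0 \<Longrightarrow>
           K x y \<le> K0 * (x powr (-\<alpha>) + y powr (-\<alpha>)) * (x powr \<beta> + y powr \<beta>)"
    and "\<And>x y. x > 0 \<Longrightarrow> y > 0 \<Longrightarrow> F x y \<le> F0 * (x powr \<gamma> + y powr \<gamma>)"
    and "\<mu>in \<in> finite_measures"
    and "boundary_datum g"
    and "sup_moment g (max \<beta> \<gamma>) < \<infinity>"
  shows "\<exists>\<mu>. bvcf_solution K F \<mu>in g \<mu>"
proof -
  interpret bvcf \<alpha> \<beta> \<gamma> K0 F0 K F \<mu>in g by unfold_locales (fact assms)+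
  show ?thesis by (rule solution_exists)
qed

end
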